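(* For any grapheur $\mathsf M\in\mathcal M$ and $n\in\mathbb N$, let $\mathsf G^{(n)}[\mathsf M]$ be the random graph obtained by sampling $n$ edges from $\mathsf M$. Then $\mathbb E\big[W_\square(\mathsf M,\mathsf M_{\mathsf G^{(n)}[\mathsf M]})\big]\le\mathbb E\big[\overline{W_\square}(\mathsf M,\mathsf M_{\mathsf G^{(n)}[\mathsf M]})\big]\le\frac{174}{\sqrt n}$, where the expectation is over the realization of $\mathsf G^{(n)}[\mathsf M]$. Moreover, for every $\epsilon>0$, with probability at least $1-\exp(-2\epsilon^2)$ over $\mathsf G^{(n)}[\mathsf M]$, $W_\square(\mathsf M,\mathsf M_{\mathsf G^{(n)}[\mathsf M]})\le\overline{W_\square}(\mathsf M,\mathsf M_{\mathsf G^{(n)}[\mathsf M]})\le\frac{174+\epsilon}{\sqrt n}$.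
   Context: A grapheur is a random probability measure on $[0,1]^2$ of the form $\sum_{i,j}E_{i,j}\delta_{(T_i,T_j)}+\sum_i[\sigma_i(\delta_{T_i}\otimes\lambda)+\varsigma_i(\lambda\otimes\delta_{T_i})]+\theta\lambda^2+\vartheta\lambda_D$ ($T_i$ iid uniform; $\lambda,\lambda^2$ Lebesgue; $\lambda_D$ uniform probability on the diagonal; deterministic nonnegative coefficients summing to $1$); $\mathcal M$ is the set of grapheurs. For a deterministic $G\in\Delta^{m\times m}$ (nonnegative, entries summing to $1$), $\mathsf M_G=\sum_{i,j}G_{i,j}\delta_{(T_i,T_j)}$ with $T_1,\dots,T_m$ iid uniform. Edge sampling: sample $\mu\sim\mathsf M$, then $(x_1,y_1),\dots,(x_n,y_n)$ iid from $\mu$; enumerate the distinct points $\{x_l\}\cup\{y_l\}=\{t_1,\dots,t_N\}$ arbitrarily and set $(\mathsf G^{(n)}[\mathsf M])_{i,j}=|\{l:(x_l,y_l)=(t_i,t_j)\}|/n$. For grapheurs (or random measures) $\mathsf M_1,\mathsf M_2$, with infima over couplings $(\mathsf M_1',\mathsf M_2')$ and suprema over intervals $S,T\subseteq[0,1]$: $W_\square(\mathsf M_1,\mathsf M_2)=\inf\sup_{S,T}\mathbb E|\mathsf M_1'(S\times T)-\mathsf M_2'(S\times T)|$ and $\overline{W_\square}(\mathsf M_1,\mathsf M_2)=\inf\mathbb E\sup_{S,T}|\mathsf M_1'(S\times T)-\mathsf M_2'(S\times T)|$. *)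

theory Defs
  imports "HOL-Probability.Probability"
begin

text \<open>A probability measure on [0,1]^2 is represented as a measure on the Borel sets of
  real \<times> real (all measures considered are concentrated on [0,1]^2).  A random measure is
  a probability measure on the Giry space prob_algebra borel; its law is all that matters
  for W_box and its overline version.\<close>

type_synonym pmeas = "(real \<times> real) measure"

abbreviation unif01 :: "real measure" where
  "unif01 \<equiv> uniform_measure lborel {0..1}"

definition iid_unif :: "(nat \<Rightarrow> real) measure" where
  "iid_unif = (\<Pi>\<^sub>M i\<in>(UNIV::nat set). unif01)"

definition grapheur_coeffs ::
  "(nat \<Rightarrow> nat \<Rightarrow> real) \<Rightarrow> (nat \<Rightarrow> real) \<Rightarrow> (nat \<Rightarrow> real) \<Rightarrow> real \<Rightarrow> real \<Rightarrow> bool" where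
  "grapheur_coeffs E \<sigma> \<tau> \<theta> \<kappa> \<longleftrightarrow>
     (\<forall>i j. 0 \<le> E i j) \<and> (\<forall>i. 0 \<le> \<sigma> i) \<and> (\<forall>i. 0 \<le> \<tau> i) \<and> 0 \<le> \<theta> \<and> 0 \<le> \<kappa> \<and>
     (\<exists>e s t. ((\<lambda>(i,j). E i j) has_sum e) UNIV \<and> (\<sigma> has_sum s) UNIV \<and> (\<tau> has_sum t) UNIV \<and>
              e + s + t + \<theta> + \<kappa> = 1)"

text \<open>The realisation of the grapheur for given atoms T:
  sum E_ij delta_(T_i,T_j) + sum sigma_i (delta_(T_i) x lambda) + sum tau_i (lambda x delta_(T_i))
  + theta lambda^2 + vartheta lambda_D  (lambda = Lebesgue measure on [0,1]).\<close>
definition grapheur_real ::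
  "(nat \<Rightarrow> nat \<Rightarrow> real) \<Rightarrow> (nat \<Rightarrow> real) \<Rightarrow> (nat \<Rightarrow> real) \<Rightarrow> real \<Rightarrow> real \<Rightarrow> (nat \<Rightarrow> real) \<Rightarrow> pmeas" where
  "grapheur_real E \<sigma> \<tau> \<theta> \<kappa> T = measure_of UNIV (sets borel)
     (\<lambda>A. (\<Sum>i. \<Sum>j. ennreal (E i j) * indicator A (T i, T j))
        + (\<Sum>i. ennreal (\<sigma> i) * emeasure lborel {y\<in>{0..1}. (T i, y) \<in> A})
        + (\<Sum>i. ennreal (\<tau> i) * emeasure lborel {x\<in>{0..1}. (x, T i) \<in> A})
        + ennreal \<theta> * emeasure lborel (A \<inter> ({0..1} \<times> {0..1}))
        + ennreal \<kappa> * emeasure lborel {t\<in>{0..1}. (t, t) \<in> A})"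

definition grapheur_law ::
  "(nat \<Rightarrow> nat \<Rightarrow> real) \<Rightarrow> (nat \<Rightarrow> real) \<Rightarrow> (nat \<Rightarrow> real) \<Rightarrow> real \<Rightarrow> real \<Rightarrow> pmeas measure" where
  "grapheur_law E \<sigma> \<tau> \<theta> \<kappa> =
     distr iid_unif (prob_algebra borel) (grapheur_real E \<sigma> \<tau> \<theta> \<kappa>)"

definition graph_real :: "nat \<Rightarrow> (nat \<Rightarrow> nat \<Rightarrow> real) \<Rightarrow> (nat \<Rightarrow> real) \<Rightarrow> pmeas" where
  "graph_real m G T = measure_of UNIV (sets borel)
     (\<lambda>A. \<Sum>i<m. \<Sum>j<m. ennreal (G i j) * indicator A (T i, T j))"

definition graph_law :: "nat \<Rightarrow> (nat \<Rightarrow> nat \<Rightarrow> real) \<Rightarrow> pmeas measure" where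
  "graph_law m G = distr iid_unif (prob_algebra borel) (graph_real m G)"

definition couplings :: "'a measure \<Rightarrow> 'a measure \<Rightarrow> 'a measure \<Rightarrow> ('a \<times> 'a) measure set" where
  "couplings K P Q = {C. prob_space C \<and> sets C = sets (K \<Otimes>\<^sub>M K) \<and>
      distr C K fst = P \<and> distr C K snd = Q}"

definition unit_intervals :: "real set set" where
  "unit_intervals = {S. is_interval S \<and> S \<subseteq> {0..1}}"

definition cut_diff :: "real set \<Rightarrow> real set \<Rightarrow> pmeas \<times> pmeas \<Rightarrow> ennreal" where
  "cut_diff S T \<mu>\<nu> = ennreal \<bar>measure (fst \<mu>\<nu>) (S \<times> T) - measure (snd \<mu>\<nu>) (S \<times> T)\<bar>"

definition W_box :: "pmeas measure \<Rightarrow> pmeas measure \<Rightarrow> ennreal" where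
  "W_box P Q = (INF C \<in> couplings (prob_algebra borel) P Q.
       SUP S \<in> unit_intervals. SUP T \<in> unit_intervals. \<integral>\<^sup>+ x. cut_diff S T x \<partial>C)"

definition W_box_bar :: "pmeas measure \<Rightarrow> pmeas measure \<Rightarrow> ennreal" where
  "W_box_bar P Q = (INF C \<in> couplings (prob_algebra borel) P Q.
       \<integral>\<^sup>+ x. (SUP S \<in> unit_intervals. SUP T \<in> unit_intervals. cut_diff S T x) \<partial>C)"

definition sample_vertices :: "nat \<Rightarrow> (nat \<Rightarrow> real \<times> real) \<Rightarrow> real list" where
  "sample_vertices n z = remdups (concat (map (\<lambda>l. [fst (z l), snd (z l)]) [0..<n]))"

definition sample_graph :: "nat \<Rightarrow> (nat \<Rightarrow> real \<times> real) \<Rightarrow> nat \<times> (nat \<Rightarrow> nat \<Rightarrow> real)" where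
  "sample_graph n z = (let ts = sample_vertices n z in
      (length ts, \<lambda>i j. real (card {l\<in>{..<n}. z l = (ts ! i, ts ! j)}) / real n))"

definition edge_sample ::
  "(nat \<Rightarrow> nat \<Rightarrow> real) \<Rightarrow> (nat \<Rightarrow> real) \<Rightarrow> (nat \<Rightarrow> real) \<Rightarrow> real \<Rightarrow> real \<Rightarrow> nat \<Rightarrow> (nat \<Rightarrow> real \<times> real) measure" where
  "edge_sample E \<sigma> \<tau> \<theta> \<kappa> n =
     iid_unif \<bind> (\<lambda>T. \<Pi>\<^sub>M l\<in>{..<n}. grapheur_real E \<sigma> \<tau> \<theta> \<kappa> T)"

definition sampled_graph_law :: "nat \<Rightarrow> (nat \<Rightarrow> real \<times> real) \<Rightarrow> pmeas measure" where
  "sampled_graph_law n z = (case sample_graph n z of (m, G) \<Rightarrow> graph_law m G)"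

end

theory Submission
  imports Defs
begin

text \<open>
  An edge of the sample can be drawn by first choosing a label that says which of its endpoints are
  atoms and which are fresh uniform points, and only then the positions of the atoms and of the
  fresh points. The sampled graph depends on the labels alone (almost surely all positions are
  distinct), and for fixed labels the positions are still independent and uniform. Hence, for
  fixed labels, the realised measure and the empirical measure of the sample form a coupling of the
  grapheur and the step grapheur of the sampled graph. The distance is therefore bounded by the
  expected discrepancy, over rectangles, of an empirical measure of \<open>n\<close> independent points.

  That expectation is at most \<open>152 / sqrt n\<close> for every law in the plane: symmetrize, write a rectangle
  as a signed combination of four quadrants, and chain over dyadic quantile grids of the sample.
  The tail bound is McDiarmid's inequality given the atoms, transferred to the label average by
  Jensen's inequality.
\<close>

section \<open>Rademacher averages over quadrants\<close>

text \<open>Conditioning is on the labels and not on the sampled points: given the points, the atoms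
  that they hit are known and no longer uniform, whereas both laws compared by
  \<open>W_box_bar\<close> have free uniform atoms. The price is that the distance is controlled by
  the mean of the discrepancy given the labels, whereas bounds for empirical measures hold given the
  atoms. Since labels are independent of all positions, Fubini switches between the two. A tail
  bound on the discrepancy would not pass to a conditional mean, but an exponential moment does, by
  convexity; hence the exponential form of McDiarmid's inequality. The constant is
  \<open>152 = 2 * 4 * 19\<close>: two copies of the sample in the symmetrization, four quadrants
  per rectangle, and the value \<open>19\<close> of the chaining series. Two measurability obstacles
  shape the rest: suprema over all intervals are reduced to countably many rational rectangles, and
  the infimum over couplings is measurable in the sample because, for fixed \<open>n\<close>, it
  takes finitely many values.\<close>

lemma exp_plus_exp_minus_le: "exp a + exp (- a) \<le> 2 * exp (a\<^sup>2 / 2)" for a :: real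
proof -
  have pos: "exp a + exp (- a) \<le> 2 * exp (a\<^sup>2 / 2)" if "a > 0" for a :: real
  proof -
    \<comment> \<open>Hoeffding's lemma for a fair sign: its range has width 2, and
      \<open>2^2 / 8 = 1 / 2\<close> is the constant in the exponent.\<close>
    let ?p = "pmf_of_set {-1, 1 :: real}"
    interpret interval_bounded_random_variable "measure_pmf ?p" "\<lambda>x. x" "-1" 1
      by unfold_locales (auto simp: AE_measure_pmf_iff)
    have "ennreal ((exp a + exp (- a)) / 2) = (\<integral>\<^sup>+x. ennreal (exp (a * x)) \<partial>measure_pmf ?p)"
      by (subst nn_integral_pmf_of_set) (auto simp: ennreal_plus[symmetric] add.commute
            divide_ennreal[symmetric] simp del: ennreal_plus)
    also have "\<dots> \<le> ennreal (exp (a\<^sup>2 * (1 - (-1))\<^sup>2 / 8))"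
      by (rule Hoeffdings_lemma_nn_integral_0) (use that in \<open>auto simp: integral_pmf_of_set\<close>)
    finally show ?thesis by (simp add: ennreal_le_iff)
  qed
  consider "a > 0" | "a = 0" | "- a > 0" by linarith
  then show ?thesis using pos[of a] pos[of "- a"] by cases (auto simp: add.commute)
qed

text \<open>A sign vector is encoded by the set \<open>B\<close> of its positive positions. An
  expectation over independent fair signs is then a finite sum over \<open>Pow A\<close>, up to the
  factor \<open>2 ^ card A\<close>.\<close>

definition rademacher :: "'a set \<Rightarrow> 'a \<Rightarrow> real" where
  "rademacher B l = (if l \<in> B then 1 else - 1)"

lemma abs_rademacher [simp]: "\<bar>rademacher B l\<bar> = 1"
  by (simp add: rademacher_def)

text \<open>Independence of the signs: expanding the product picks \<open>exp (a l)\<close> for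
  \<open>l\<close> in \<open>B\<close> and \<open>exp (- a l)\<close> elsewhere.\<close>

lemma sum_Pow_exp_rademacher:
  fixes a :: "'a \<Rightarrow> real"
  assumes "finite A"
  shows "(\<Sum>B\<in>Pow A. exp (\<Sum>l\<in>A. rademacher B l * a l)) = (\<Prod>l\<in>A. exp (a l) + exp (- a l))"
  unfolding prod_add[OF assms]
proof (intro sum.cong refl)
  fix B assume "B \<in> Pow A"
  then have "(\<Sum>l\<in>A. rademacher B l * a l) = (\<Sum>l\<in>B. a l) + (\<Sum>l\<in>A - B. - a l)"
    using assms by (subst sum.subset_diff[of B A])
      (auto simp: rademacher_def add.commute sum_negf[symmetric] intro!: arg_cong2[where f = "(+)"] sum.cong)
  moreover have "finite B" "finite (A - B)" using assms \<open>B \<in> Pow A\<close> finite_subset by auto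
  ultimately show "exp (\<Sum>l\<in>A. rademacher B l * a l) = (\<Prod>x\<in>B. exp (a x)) * (\<Prod>x\<in>A - B. exp (- a x))"
    by (simp add: exp_add exp_sum)
qed

text \<open>The sub-Gaussian bound for a sum of \<open>card L\<close> signs. Taking coefficient 0
  outside \<open>L\<close> keeps the sum over all of \<open>Pow A\<close>, so that different sets
  \<open>L\<close> can be compared under the same signs.\<close>

lemma sum_Pow_exp_rademacher_le:
  assumes "finite A" "L \<subseteq> A" "card L \<le> v"
  shows "(\<Sum>B\<in>Pow A. exp (s * (\<Sum>l\<in>L. rademacher B l))) \<le> 2 ^ card A * exp (s\<^sup>2 * v / 2)"
proof -
  let ?a = "\<lambda>l. if l \<in> L then s else 0"
  have "(\<Sum>l\<in>A. rademacher B l * ?a l) = s * (\<Sum>l\<in>L. rademacher B l)" for B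
  proof -
    have "(\<Sum>l\<in>A. rademacher B l * ?a l) = (\<Sum>l\<in>L. rademacher B l * s)"
      using assms by (intro sum.mono_neutral_cong_right) auto
    then show ?thesis by (simp add: sum_distrib_left mult.commute)
  qed
  then have "(\<Sum>B\<in>Pow A. exp (s * (\<Sum>l\<in>L. rademacher B l))) = (\<Prod>l\<in>A. exp (?a l) + exp (- ?a l))"
    using sum_Pow_exp_rademacher[OF assms(1), of ?a] by simp
  also have "\<dots> \<le> (\<Prod>l\<in>A. 2 * exp ((?a l)\<^sup>2 / 2))"
    by (intro prod_mono) (auto intro!: exp_plus_exp_minus_le add_nonneg_nonneg)
  also have "\<dots> = 2 ^ card A * exp (\<Sum>l\<in>A. (?a l)\<^sup>2 / 2)"
    using assms by (simp add: prod.distrib exp_sum)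
  also have "(\<Sum>l\<in>A. (?a l)\<^sup>2 / 2) = (\<Sum>l\<in>L. s\<^sup>2 / 2)"
    using assms by (intro sum.mono_neutral_cong_right) auto
  also have "\<dots> \<le> s\<^sup>2 * v / 2"
    using assms(3) by (simp add: mult_left_mono mult.commute[of "s\<^sup>2"] mult_right_mono)
  finally show ?thesis by simp
qed

text \<open>Averaging \<open>ln u \<le> u - 1\<close> at \<open>u = exp (s * max) / D\<close> replaces Jensen's inequality.\<close>

lemma rademacher_average_Max_le:
  fixes L :: "'j \<Rightarrow> 'a set"
  assumes A: "finite A" and J: "finite J" "J \<noteq> {}"
    and L: "\<And>j. j \<in> J \<Longrightarrow> L j \<subseteq> A" "\<And>j. j \<in> J \<Longrightarrow> card (L j) \<le> v" and s: "s > 0"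
  shows "(\<Sum>B\<in>Pow A. Max ((\<lambda>j. \<bar>\<Sum>l\<in>L j. rademacher B l\<bar>) ` J))
           \<le> 2 ^ card A * ((ln (2 * card J) + s\<^sup>2 * v / 2) / s)"
proof -
  let ?Y = "\<lambda>B j. \<Sum>l\<in>L j. rademacher B l"
  let ?M = "\<lambda>B. Max ((\<lambda>j. \<bar>?Y B j\<bar>) ` J)"
  \<comment> \<open>Union bound: \<open>D\<close> dominates the mean of
    \<open>exp (s * ?M B)\<close>, with one term for each index in \<open>J\<close> and each of the
    two signs hidden in the absolute value.\<close>
  define D where "D = 2 * card J * exp (s\<^sup>2 * v / 2)"
  have cJ: "card J > 0" using J by (simp add: card_gt_0_iff)
  have D: "D > 0" using cJ by (simp add: D_def)
  have lnD: "ln D = ln (2 * card J) + s\<^sup>2 * v / 2"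
    using cJ by (simp add: D_def ln_mult)
  have 1: "exp (s * ?M B) \<le> (\<Sum>j\<in>J. exp (s * ?Y B j) + exp (- s * ?Y B j))" for B
  proof -
    have "?M B \<in> (\<lambda>j. \<bar>?Y B j\<bar>) ` J" using J by (intro Max_in) auto
    then obtain j where j: "j \<in> J" "?M B = \<bar>?Y B j\<bar>" by auto
    have "exp (s * ?M B) \<le> exp (s * ?Y B j) + exp (- s * ?Y B j)"
      unfolding j(2) by (cases "?Y B j \<ge> 0") (auto simp: abs_if)
    also have "\<dots> \<le> (\<Sum>j\<in>J. exp (s * ?Y B j) + exp (- s * ?Y B j))"
      using J j by (intro member_le_sum) (auto intro: add_nonneg_nonneg)
    finally show ?thesis .
  qed
  have "(\<Sum>B\<in>Pow A. exp (s * ?M B)) \<le> (\<Sum>B\<in>Pow A. \<Sum>j\<in>J. exp (s * ?Y B j) + exp (- s * ?Y B j))"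
    by (intro sum_mono 1)
  also have "\<dots> = (\<Sum>j\<in>J. (\<Sum>B\<in>Pow A. exp (s * ?Y B j)) + (\<Sum>B\<in>Pow A. exp (- s * ?Y B j)))"
    by (subst sum.swap) (simp add: sum.distrib)
  also have "\<dots> \<le> (\<Sum>j\<in>J. 2 ^ card A * exp (s\<^sup>2 * v / 2) + 2 ^ card A * exp ((-s)\<^sup>2 * v / 2))"
    using L by (intro sum_mono add_mono sum_Pow_exp_rademacher_le A) auto
  also have "\<dots> = 2 ^ card A * D"
    by (simp add: D_def)
  finally have 2: "(\<Sum>B\<in>Pow A. exp (s * ?M B)) \<le> 2 ^ card A * D" .
  have 3: "s * ?M B \<le> ln D - 1 + exp (s * ?M B) / D" for B
  proof -
    have "ln (exp (s * ?M B) / D) \<le> exp (s * ?M B) / D - 1"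
      using D by (intro ln_le_minus_one) auto
    then show ?thesis using D by (simp add: ln_div)
  qed
  have "s * (\<Sum>B\<in>Pow A. ?M B) = (\<Sum>B\<in>Pow A. s * ?M B)" by (simp add: sum_distrib_left)
  also have "\<dots> \<le> (\<Sum>B\<in>Pow A. ln D - 1 + exp (s * ?M B) / D)" by (intro sum_mono 3)
  also have "\<dots> = 2 ^ card A * (ln D - 1) + (\<Sum>B\<in>Pow A. exp (s * ?M B)) / D"
    using A by (simp add: sum.distrib card_Pow sum_divide_distrib)
  also have "\<dots> \<le> 2 ^ card A * (ln D - 1) + 2 ^ card A"
    using 2 D by (simp add: divide_le_eq)
  also have "\<dots> = 2 ^ card A * ln D" by (simp add: algebra_simps)
  finally show ?thesis using s unfolding lnD by (simp add: field_simps)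
qed

section \<open>Chaining over dyadic quantile grids\<close>

definition quadrant :: "'a set \<Rightarrow> ('a \<Rightarrow> nat) \<Rightarrow> ('a \<Rightarrow> nat) \<Rightarrow> nat \<times> nat \<Rightarrow> 'a set" where
  "quadrant A f g p = {l \<in> A. f l < fst p \<and> g l < snd p}"

lemma quadrant_mono: "a \<le> a' \<Longrightarrow> b \<le> b' \<Longrightarrow> quadrant A f g (a, b) \<subseteq> quadrant A f g (a', b')"
  by (auto simp: quadrant_def)

text \<open>The points gained lie in a vertical and a horizontal strip, and an injective integer
  coordinate puts at most as many points into a strip as it is wide. With ranks as coordinates, this
  makes the size of an increment a matter of grid width alone, whatever the law of the
  points.\<close>

lemma card_quadrant_diff_le:
  assumes "finite A" "inj_on f A" "inj_on g A"
  shows "card (quadrant A f g (a', b') - quadrant A f g (a, b)) \<le> (a' - a) + (b' - b)"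
proof -
  have bound: "card {l \<in> A. h l \<in> {c..<c'}} \<le> c' - c" if "inj_on h A" for h :: "'a \<Rightarrow> nat" and c c'
  proof -
    have "card {l \<in> A. h l \<in> {c..<c'}} = card (h ` {l \<in> A. h l \<in> {c..<c'}})"
      by (rule card_image[symmetric]) (use that in \<open>auto intro: inj_on_subset\<close>)
    also have "\<dots> \<le> card {c..<c'}" by (intro card_mono) auto
    finally show ?thesis by simp
  qed
  have "quadrant A f g (a', b') - quadrant A f g (a, b)
          \<subseteq> {l \<in> A. f l \<in> {a..<a'}} \<union> {l \<in> A. g l \<in> {b..<b'}}"
    by (auto simp: quadrant_def)
  then have "card (quadrant A f g (a', b') - quadrant A f g (a, b))
          \<le> card ({l \<in> A. f l \<in> {a..<a'}} \<union> {l \<in> A. g l \<in> {b..<b'}})"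
    using assms(1) by (intro card_mono) auto
  also have "\<dots> \<le> card {l \<in> A. f l \<in> {a..<a'}} + card {l \<in> A. g l \<in> {b..<b'}}"
    by (rule card_Un_le)
  also have "\<dots> \<le> (a' - a) + (b' - b)"
    by (intro add_mono bound assms)
  finally show ?thesis .
qed

text \<open>The constants in the following sum come from \<open>ln (2 * 4 ^ k) \<le> 7 / 5 * k + 7 / 10\<close>.\<close>

lemma chaining_sum: "(\<Sum>k=1..N. (5/7) ^ k * (7/5 * real k + 27/10)) \<le> 19"
proof -
  \<comment> \<open>The infinite series has value exactly 19, and the subtracted term is its tail.
    The summand \<open>27/10\<close> is \<open>7/10\<close> plus the bound 2 on the variance term of
    each level.\<close>
  have "(\<Sum>k=1..N. (5/7) ^ k * (7/5 * real k + 27/10)) = 19 - (7/2 * real N + 19) * (5/7) ^ N"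
  proof (induction N)
    case (Suc N)
    have "(\<Sum>k=1..Suc N. (5/7) ^ k * (7/5 * real k + 27/10))
        = 19 - (7/2 * real N + 19) * (5/7) ^ N + (5/7) ^ Suc N * (7/5 * real (Suc N) + 27/10)"
      using Suc by simp
    also have "\<dots> = 19 - (7/2 * real (Suc N) + 19) * (5/7) ^ Suc N"
      by (simp add: algebra_simps add_divide_distrib)
    finally show ?case .
  qed simp
  then show ?thesis by simp
qed

text \<open>A single union bound over all quadrants would lose a factor of order
  \<open>sqrt (ln n)\<close>. Rounding corners to grids of width \<open>2 ^ (N - k)\<close> avoids
  it: level \<open>k\<close> has only \<open>4 ^ k\<close> increments, each with at most
  \<open>2 * 2 ^ (N - k)\<close> points, so the variance decays geometrically while the logarithm of
  the count grows linearly. As \<open>card A < 2 ^ N\<close>, the finest grid contains every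
  possible count of points.\<close>

lemma rademacher_average_quadrant_le:
  assumes A: "finite A" and inj: "inj_on f A" "inj_on g A"
    and N: "card A < 2 ^ N" "2 ^ N \<le> 2 * card A"
  shows "(\<Sum>B\<in>Pow A. Max ((\<lambda>p. \<bar>\<Sum>l\<in>quadrant A f g p. rademacher B l\<bar>) ` ({..<2 ^ N} \<times> {..<2 ^ N})))
           \<le> 2 ^ card A * (19 * sqrt (card A))"
proof -
  let ?n = "card A" and ?Q = "quadrant A f g"
  define step where "step k p = (fst p * 2 ^ (N - k), snd p * 2 ^ (N - k))" for k and p :: "nat \<times> nat"
  \<comment> \<open>The parent of a grid point on the next coarser grid is obtained by halving its
    coordinates, so an increment is indexed by the finer point alone.\<close>
  define L where "L k p = ?Q (step k p) - ?Q (step (k - 1) (fst p div 2, snd p div 2))" for k p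
  define J :: "nat \<Rightarrow> (nat \<times> nat) set" where "J k = {..<2 ^ k} \<times> {..<2 ^ k}" for k
  define M where "M k B = Max ((\<lambda>p. \<bar>\<Sum>l\<in>L k p. rademacher B l\<bar>) ` J k)" for k B
  have J: "finite (J k)" "J k \<noteq> {}" "card (J k) = 4 ^ k" for k
    by (auto simp: J_def power_mult_distrib[symmetric] lessThan_empty_iff)
  have n: "?n > 0" using N by (cases "?n = 0") auto
  have fQ: "finite (?Q p)" for p using A by (simp add: quadrant_def)
  have pow: "(2::nat) ^ (N - (k - 1)) = 2 * 2 ^ (N - k)" if "1 \<le> k" "k \<le> N" for k
  proof -
    have "N - (k - 1) = Suc (N - k)" using that by linarith
    then show ?thesis by simp
  qed
  have "\<bar>\<Sum>l\<in>?Q p. rademacher B l\<bar> \<le> (\<Sum>k=1..N. M k B)" if p: "p \<in> {..<2 ^ N} \<times> {..<2 ^ N}" for B p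
  proof -
    define q where "q k = (fst p div 2 ^ (N - k), snd p div 2 ^ (N - k))" for k
    \<comment> \<open>Both coordinates of \<open>p\<close> are below \<open>2 ^ N\<close>, so the
      coarsest corner is the origin, whose quadrant is empty. The telescoping sum therefore starts
      from 0.\<close>
    have q0: "?Q (step 0 (q 0)) = {}" using p by (auto simp: quadrant_def step_def q_def)
    have qN: "step N (q N) = p" by (simp add: step_def q_def)
    have half: "(fst (q k) div 2, snd (q k) div 2) = q (k - 1)" if "1 \<le> k" "k \<le> N" for k
      using pow[OF that] by (simp add: q_def div_mult2_eq[symmetric] mult.commute)
    have qJ: "q k \<in> J k" if "k \<le> N" for k
    proof -
      have "(2::nat) ^ N = 2 ^ k * 2 ^ (N - k)" using that by (simp add: power_add[symmetric])
      then show ?thesis using p by (auto simp: q_def J_def less_mult_imp_div_less)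
    qed
    \<comment> \<open>Coarser rounding moves the corner further down, so the quadrants are nested
      and the difference of two consecutive sums is the sum over \<open>L k (q k)\<close>.\<close>
    have sub: "?Q (step (k - 1) (q (k - 1))) \<subseteq> ?Q (step k (q k))" if k: "1 \<le> k" "k \<le> N" for k
    proof -
      have "x div (2 * h) * (2 * h) \<le> x div h * h" for x h :: nat
      proof -
        have "x div (2 * h) = x div h div 2" by (metis div_mult2_eq mult.commute)
        then have "x div (2 * h) * 2 \<le> x div h" by simp
        then have "x div (2 * h) * 2 * h \<le> x div h * h" by (rule mult_le_mono1)
        then show ?thesis by (simp only: mult.assoc)
      qed
      then show ?thesis
        unfolding step_def fst_conv snd_conv q_def unfolding pow[OF k] by (intro quadrant_mono)
    qed
    have tele: "(\<Sum>l\<in>?Q (step m (q m)). rademacher B l) = (\<Sum>k=1..m. \<Sum>l\<in>L k (q k). rademacher B l)"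
      if "m \<le> N" for m
      using that
    proof (induction m)
      case (Suc m)
      have "(\<Sum>l\<in>?Q (step (Suc m) (q (Suc m))). rademacher B l)
          = (\<Sum>l\<in>L (Suc m) (q (Suc m)). rademacher B l) + (\<Sum>l\<in>?Q (step m (q m)). rademacher B l)"
        using sub[of "Suc m"] half[of "Suc m"] Suc.prems fQ
        by (subst sum.subset_diff[of "?Q (step m (q m))"]) (auto simp: L_def)
      then show ?case using Suc by simp
    qed (simp add: q0)
    have "\<bar>\<Sum>l\<in>?Q p. rademacher B l\<bar> \<le> (\<Sum>k=1..N. \<bar>\<Sum>l\<in>L k (q k). rademacher B l\<bar>)"
      using tele[of N] qN by simp
    also have "\<dots> \<le> (\<Sum>k=1..N. M k B)"
      unfolding M_def by (intro sum_mono Max_ge) (use J qJ in auto)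
    finally show ?thesis .
  qed
  then have le: "Max ((\<lambda>p. \<bar>\<Sum>l\<in>?Q p. rademacher B l\<bar>) ` ({..<2 ^ N} \<times> {..<2 ^ N})) \<le> (\<Sum>k=1..N. M k B)" for B
    by (subst Max_le_iff) (auto simp: lessThan_empty_iff)
  have level: "(\<Sum>B\<in>Pow A. M k B) \<le> 2 ^ ?n * (sqrt ?n * ((5/7) ^ k * (7/5 * real k + 27/10)))"
    if k: "k \<in> {1..N}" for k
  proof -
    \<comment> \<open>The ratio \<open>7/5\<close> lies just below \<open>sqrt 2\<close>. Hence
      \<open>s^2\<close> grows more slowly than the size of the increments shrinks, and the variance
      term is at most \<open>(49/50) ^ k * 2 ^ N / n\<close>, thus at most 2; dividing by
      \<open>s\<close> supplies the factor \<open>(5/7) ^ k\<close> that makes the levels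
      summable.\<close>
    define s where "s = (7/5) ^ k / sqrt ?n"
    have s: "s > 0" using n by (simp add: s_def)
    have cardL: "card (L k p) \<le> 2 * 2 ^ (N - k)" for p
    proof -
      let ?h = "2 ^ (N - k) :: nat"
      have *: "x * ?h - x div 2 * (2 * ?h) \<le> ?h" for x
      proof -
        have "x * ?h - x div 2 * (2 * ?h) = (x - x div 2 * 2) * ?h" by (simp add: diff_mult_distrib)
        also have "\<dots> \<le> 1 * ?h" by (intro mult_le_mono1) linarith
        finally show ?thesis by simp
      qed
      have "card (L k p) \<le> (fst p * ?h - fst p div 2 * (2 * ?h)) + (snd p * ?h - snd p div 2 * (2 * ?h))"
        unfolding L_def step_def fst_conv snd_conv using pow[of k] k
        by (simp only: atLeastAtMost_iff) (rule card_quadrant_diff_le[OF A inj])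
      also have "\<dots> \<le> ?h + ?h" by (intro add_mono *)
      finally show ?thesis by simp
    qed
    have "((7/5) ^ k)\<^sup>2 = (49/25 :: real) ^ k"
      unfolding power2_eq_square power_mult_distrib[symmetric] by simp
    then have "s\<^sup>2 = (49/25) ^ k / ?n" unfolding s_def power_divide[of _ "sqrt ?n"] by simp
    then have "s\<^sup>2 * (2 * 2 ^ (N - k) :: nat) / 2 = (49/25) ^ k * 2 ^ (N - k) / ?n"
      by simp
    also have "(2::real) ^ (N - k) = 2 ^ N / 2 ^ k" using k by (simp add: power_diff)
    also have "(49/25) ^ k * (2 ^ N / 2 ^ k) / ?n = (49/50) ^ k * (2 ^ N / ?n)"
      by (simp add: power_divide field_simps power_mult_distrib[symmetric])
    also have "\<dots> \<le> 1 * 2"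
    proof (rule mult_mono)
      have "real (2 ^ N) \<le> real (2 * ?n)" using N(2) of_nat_le_iff by blast
      then show "2 ^ N / ?n \<le> (2::real)" using n by (simp add: divide_le_eq)
    qed (auto intro: power_le_one)
    finally have sv: "s\<^sup>2 * (2 * 2 ^ (N - k) :: nat) / 2 \<le> 2" by simp
    have "ln (real (2 * card (J k))) = ln (2 ^ (2 * k + 1))"
      unfolding J by (simp add: power_mult)
    also have "\<dots> = real (2 * k + 1) * ln 2" by (rule ln_realpow)
    also have "\<dots> \<le> real (2 * k + 1) * (7/10)"
      using ln2_le_25_over_36 by (intro mult_left_mono) auto
    finally have lnJ: "ln (real (2 * card (J k))) \<le> real (2 * k + 1) * (7/10)" .
    have "(\<Sum>B\<in>Pow A. M k B) \<le> 2 ^ ?n * ((ln (2 * card (J k)) + s\<^sup>2 * (2 * 2 ^ (N - k) :: nat) / 2) / s)"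
      unfolding M_def by (rule rademacher_average_Max_le[OF A J(1,2) _ cardL s]) (auto simp: L_def quadrant_def)
    also have "\<dots> \<le> 2 ^ ?n * ((real (2 * k + 1) * (7/10) + 2) / s)"
      using lnJ sv s by (intro mult_left_mono divide_right_mono add_mono) auto
    also have "\<dots> = 2 ^ ?n * (sqrt ?n * ((5/7) ^ k * (7/5 * real k + 27/10)))"
      by (simp add: s_def power_divide field_simps)
    finally show ?thesis .
  qed
  have "(\<Sum>B\<in>Pow A. Max ((\<lambda>p. \<bar>\<Sum>l\<in>?Q p. rademacher B l\<bar>) ` ({..<2 ^ N} \<times> {..<2 ^ N})))
      \<le> (\<Sum>B\<in>Pow A. \<Sum>k=1..N. M k B)"
    by (intro sum_mono le)
  also have "\<dots> = (\<Sum>k=1..N. \<Sum>B\<in>Pow A. M k B)" by (rule sum.swap)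
  also have "\<dots> \<le> (\<Sum>k=1..N. 2 ^ ?n * (sqrt ?n * ((5/7) ^ k * (7/5 * real k + 27/10))))"
    by (intro sum_mono level)
  also have "\<dots> = 2 ^ ?n * sqrt ?n * (\<Sum>k=1..N. (5/7) ^ k * (7/5 * real k + 27/10))"
    by (simp add: sum_distrib_left mult.assoc)
  also have "\<dots> \<le> 2 ^ ?n * sqrt ?n * 19"
    by (intro mult_left_mono chaining_sum) auto
  finally show ?thesis by (simp add: mult_ac)
qed

text \<open>Ties are broken by the index, so ranks stay injective when the law has atoms and sampled
  coordinates coincide.\<close>

definition lex_rank :: "nat \<Rightarrow> (nat \<Rightarrow> real) \<Rightarrow> nat \<Rightarrow> nat" where
  "lex_rank n x l = card {k \<in> {..<n}. x k < x l \<or> x k = x l \<and> k < l}"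

lemma inj_on_lex_rank: "inj_on (lex_rank n x) {..<n}"
proof (rule inj_onI, rule ccontr)
  have less: "lex_rank n x l < lex_rank n x l'"
    if "l \<in> {..<n}" "x l < x l' \<or> x l = x l' \<and> l < l'" for l l'
    unfolding lex_rank_def by (rule psubset_card_mono) (use that in auto)
  fix l l' assume "l \<in> {..<n}" "l' \<in> {..<n}" "lex_rank n x l = lex_rank n x l'" "l \<noteq> l'"
  with less[of l l'] less[of l' l] show False by (metis less_irrefl linorder_cases)
qed

text \<open>Points with the same coordinate are counted together by a closed threshold, so breaking
  ties does no harm: every real quadrant \<open>x \<le> a\<close>, \<open>y \<le> b\<close> is a
  quadrant of ranks, with the two counts as its corner.\<close>

lemma lex_rank_less_iff:
  assumes "l < n"
  shows "lex_rank n x l < card {k \<in> {..<n}. x k \<le> a} \<longleftrightarrow> x l \<le> a"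
proof
  assume "x l \<le> a"
  then show "lex_rank n x l < card {k \<in> {..<n}. x k \<le> a}"
    unfolding lex_rank_def using assms by (intro psubset_card_mono) auto
next
  have "card {k \<in> {..<n}. x k \<le> a} \<le> lex_rank n x l" if "x l > a"
    unfolding lex_rank_def using that by (intro card_mono) auto
  then show "lex_rank n x l < card {k \<in> {..<n}. x k \<le> a} \<Longrightarrow> x l \<le> a" by force
qed

text \<open>Half-open sides make the rectangle a signed combination of closed lower quadrants;
  rational corners make the family countable, so that its suprema are measurable.\<close>

definition rat_rect :: "rat \<times> rat \<times> rat \<times> rat \<Rightarrow> (real \<times> real) set" where
  "rat_rect r = (case r of (a, b, c, d) \<Rightarrow> {of_rat a<..of_rat b} \<times> {of_rat c<..of_rat d})"

lemma rademacher_average_rat_rect_le: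
  fixes z :: "nat \<Rightarrow> real \<times> real"
  assumes n: "n \<ge> 1"
  shows "(\<Sum>B\<in>Pow {..<n}. SUP r. \<bar>\<Sum>l<n. rademacher B l * indicator (rat_rect r) (z l)\<bar>)
           \<le> 2 ^ n * (76 * sqrt n)"
proof -
  obtain m where m: "2 ^ m \<le> n" "n < 2 ^ (m + 1)"
    using ex_power_ivl1[of 2 n] n by auto
  define N where "N = m + 1"
  let ?x = "\<lambda>l. fst (z l)" and ?y = "\<lambda>l. snd (z l)"
  let ?Q = "quadrant {..<n} (lex_rank n ?x) (lex_rank n ?y)"
  let ?M = "\<lambda>B. Max ((\<lambda>p. \<bar>\<Sum>l\<in>?Q p. rademacher B l\<bar>) ` ({..<2 ^ N} \<times> {..<2 ^ N}))"
  have N: "card {..<n} < 2 ^ N" "2 ^ N \<le> 2 * card {..<n}" using m by (auto simp: N_def)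
  have quad: "\<bar>\<Sum>l<n. rademacher B l * (of_bool (?x l \<le> a) * of_bool (?y l \<le> b))\<bar> \<le> ?M B" for B a b
  proof -
    let ?p = "(card {k \<in> {..<n}. ?x k \<le> a}, card {k \<in> {..<n}. ?y k \<le> b})"
    have Q: "?Q ?p = {l \<in> {..<n}. ?x l \<le> a \<and> ?y l \<le> b}"
      using lex_rank_less_iff[of _ n ?x a] lex_rank_less_iff[of _ n ?y b] by (auto simp: quadrant_def)
    have "(\<Sum>l<n. rademacher B l * (of_bool (?x l \<le> a) * of_bool (?y l \<le> b))) = (\<Sum>l\<in>?Q ?p. rademacher B l)"
      unfolding Q by (intro sum.mono_neutral_cong_right) (auto simp: of_bool_def)
    moreover have "?p \<in> {..<2 ^ N} \<times> {..<2 ^ N}"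
    proof -
      have *: "card {k \<in> {..<n}. h k \<le> c} < 2 ^ N" for h and c :: real
        by (rule le_less_trans[OF card_mono N(1)]) auto
      show ?thesis using *[of ?x a] *[of ?y b] by (simp only: mem_Sigma_iff lessThan_iff)
    qed
    ultimately show ?thesis by (intro Max_ge) auto
  qed
  have "(SUP r. \<bar>\<Sum>l<n. rademacher B l * indicator (rat_rect r) (z l)\<bar>) \<le> 4 * ?M B" for B
  proof (rule cSUP_least)
    fix r :: "rat \<times> rat \<times> rat \<times> rat"
    obtain a b c d where r: "r = (a, b, c, d)" by (cases r)
    \<comment> \<open>If the endpoints are in the wrong order, the rectangle is empty; the minimum
      makes the corresponding difference of indicators vanish as well.\<close>
    let ?a = "min (of_rat a) (of_rat b) :: real" and ?b = "of_rat b :: real"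
      and ?c = "min (of_rat c) (of_rat d) :: real" and ?d = "of_rat d :: real"
    let ?q = "\<lambda>u v. \<Sum>l<n. rademacher B l * (of_bool (?x l \<le> u) * of_bool (?y l \<le> v))"
    have *: "indicator (rat_rect r) (z l) = (of_bool (?x l \<le> ?b) - of_bool (?x l \<le> ?a))
        * (of_bool (?y l \<le> ?d) - of_bool (?y l \<le> ?c) :: real)" for l
      by (cases "z l") (auto simp: r rat_rect_def indicator_def)
    have "(\<Sum>l<n. rademacher B l * indicator (rat_rect r) (z l))
        = ?q ?b ?d - ?q ?b ?c - ?q ?a ?d + ?q ?a ?c"
      unfolding * left_diff_distrib right_diff_distrib sum_subtractf by linarith
    then show "\<bar>\<Sum>l<n. rademacher B l * indicator (rat_rect r) (z l)\<bar> \<le> 4 * ?M B"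
      using quad[of B ?b ?d] quad[of B ?b ?c] quad[of B ?a ?d] quad[of B ?a ?c] by linarith
  qed auto
  then have "(\<Sum>B\<in>Pow {..<n}. SUP r. \<bar>\<Sum>l<n. rademacher B l * indicator (rat_rect r) (z l)\<bar>)
      \<le> (\<Sum>B\<in>Pow {..<n}. 4 * ?M B)" by (intro sum_mono)
  also have "\<dots> \<le> 4 * (2 ^ card {..<n} * (19 * sqrt (card {..<n})))"
    unfolding sum_distrib_left[symmetric]
    by (intro mult_left_mono rademacher_average_quadrant_le inj_on_lex_rank N) auto
  finally show ?thesis by simp
qed

section \<open>Discrepancy of empirical measures\<close>

text \<open>McDiarmid's inequality in exponential form: integrating out one coordinate at a time,
  Hoeffding's lemma controls each step.\<close>

lemma bounded_differences_exp_moment_le: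
  fixes f :: "('i \<Rightarrow> 'a) \<Rightarrow> real"
  assumes M: "prob_space M" and I: "finite I" and s: "s > 0"
    and meas: "f \<in> borel_measurable (\<Pi>\<^sub>M i\<in>I. M)"
    and bnd: "\<And>x. x \<in> space (\<Pi>\<^sub>M i\<in>I. M) \<Longrightarrow> \<bar>f x\<bar> \<le> C"
    and diff: "\<And>x i y. x \<in> space (\<Pi>\<^sub>M i\<in>I. M) \<Longrightarrow> i \<in> I \<Longrightarrow> y \<in> space M \<Longrightarrow> f (x(i := y)) \<le> f x + c"
  shows "(\<integral>\<^sup>+x. ennreal (exp (s * f x)) \<partial>(\<Pi>\<^sub>M i\<in>I. M))
           \<le> ennreal (exp (s * (\<integral>x. f x \<partial>(\<Pi>\<^sub>M i\<in>I. M)) + s\<^sup>2 * card I * c\<^sup>2 / 8))"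
  using I meas bnd diff
proof (induction I arbitrary: f rule: finite_induct)
  case empty
  then show ?case
    by (simp add: PiM_empty lebesgue_integral_count_space_finite nn_integral_count_space_finite)
next
  case (insert j I)
  interpret M: prob_space M by (rule M)
  interpret product_sigma_finite "\<lambda>_. M" by unfold_locales
  interpret I: prob_space "\<Pi>\<^sub>M i\<in>I. M" by (intro prob_space_PiM M)
  interpret jI: prob_space "\<Pi>\<^sub>M i\<in>insert j I. M" by (intro prob_space_PiM M)
  let ?P = "\<Pi>\<^sub>M i\<in>I. M"
  note insert.prems(1)[measurable]
  have upd: "x(j := y) \<in> space (\<Pi>\<^sub>M i\<in>insert j I. M)" if "x \<in> space ?P" "y \<in> space M" for x y
    using that by (auto simp: space_PiM PiE_iff extensional_def)
  define g where "g x = (\<integral>y. f (x(j := y)) \<partial>M)" for x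
  have fm [measurable]: "(\<lambda>(x, y). f (x(j := y))) \<in> borel_measurable (?P \<Otimes>\<^sub>M M)"
    by measurable
  have fm1: "(\<lambda>y. f (x(j := y))) \<in> borel_measurable M" if "x \<in> space ?P" for x
    using measurable_compose[OF measurable_Pair1'[OF that] fm] by simp
  have int1: "integrable M (\<lambda>y. f (x(j := y)))" if "x \<in> space ?P" for x
    using insert.prems(2) upd that by (intro M.integrable_const_bound[where B = C] fm1) auto
  have gm: "g \<in> borel_measurable ?P" unfolding g_def by measurable
  have gb: "\<bar>g x\<bar> \<le> C" if "x \<in> space ?P" for x
  proof -
    have "\<bar>g x\<bar> \<le> (\<integral>y. \<bar>f (x(j := y))\<bar> \<partial>M)" unfolding g_def by (rule integral_abs_bound)
    also have "\<dots> \<le> C"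
      using insert.prems(2) upd that int1 by (intro M.integral_le_const) (auto intro!: AE_I2)
    finally show ?thesis .
  qed
  have gd: "g (x(i := y)) \<le> g x + c" if x: "x \<in> space ?P" "i \<in> I" "y \<in> space M" for x i y
  proof -
    have x': "x(i := y) \<in> space ?P" using x by (auto simp: space_PiM PiE_iff extensional_def)
    have "g (x(i := y)) \<le> (\<integral>y'. f (x(j := y')) + c \<partial>M)"
      unfolding g_def
    proof (rule integral_mono)
      fix y' assume y': "y' \<in> space M"
      have "x(i := y, j := y') = x(j := y', i := y)" using x insert.hyps by (intro fun_upd_twist) auto
      then show "f (x(i := y, j := y')) \<le> f (x(j := y')) + c"
        using insert.prems(3)[OF upd[OF x(1) y'] insertI2[OF x(2)] x(3)] by (simp only:)
    qed (use int1 x x' in auto)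
    also have "\<dots> = g x + c" using int1[OF x(1)] by (simp add: g_def M.prob_space)
    finally show ?thesis .
  qed
  have step: "(\<integral>\<^sup>+y. ennreal (exp (s * f (x(j := y)))) \<partial>M) \<le> ennreal (exp (s\<^sup>2 * c\<^sup>2 / 8)) * ennreal (exp (s * g x))"
    if x: "x \<in> space ?P" for x
  proof -
    \<comment> \<open>The hypothesis \<open>diff\<close> is one-sided, but it can be applied from
      any \<open>x(j := y')\<close> to any \<open>x(j := y)\<close>. So the values of
      \<open>f\<close> along coordinate \<open>j\<close> lie in an interval of width
      \<open>c\<close> starting at their infimum, as Hoeffding's lemma requires.\<close>
    define a where "a = (INF y\<in>space M. f (x(j := y)))"
    have ne: "space M \<noteq> {}" by (rule M.not_empty)
    have bdd: "bdd_below ((\<lambda>y. f (x(j := y))) ` space M)"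
      by (rule bdd_belowI[where m = "- C"]) (use insert.prems(2) upd x in \<open>force simp: abs_le_iff\<close>)
    have in_int: "f (x(j := y)) \<in> {a..a + c}" if y: "y \<in> space M" for y
    proof -
      have "f (x(j := y)) - c \<le> a"
        unfolding a_def
      proof (rule cINF_greatest[OF ne])
        fix y' assume y': "y' \<in> space M"
        show "f (x(j := y)) - c \<le> f (x(j := y'))"
          using insert.prems(3)[OF upd[OF x y'] insertI1 y] unfolding fun_upd_upd by linarith
      qed
      moreover have "a \<le> f (x(j := y))" unfolding a_def by (rule cINF_lower[OF bdd y])
      ultimately show ?thesis by simp
    qed
    interpret interval_bounded_random_variable M "\<lambda>y. f (x(j := y))" a "a + c"
      by unfold_locales (use fm1[OF x] in_int in \<open>auto intro!: AE_I2\<close>)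
    have "(\<integral>\<^sup>+y. ennreal (exp (s * f (x(j := y)))) \<partial>M)
        = (\<integral>\<^sup>+y. ennreal (exp (s * g x)) * ennreal (exp (s * (f (x(j := y)) - g x))) \<partial>M)"
      by (intro nn_integral_cong) (simp add: ennreal_mult'[symmetric] exp_add[symmetric] algebra_simps)
    also have "\<dots> = ennreal (exp (s * g x)) * (\<integral>\<^sup>+y. ennreal (exp (s * (f (x(j := y)) - g x))) \<partial>M)"
      using fm1[OF x] by (intro nn_integral_cmult) measurable
    also have "\<dots> \<le> ennreal (exp (s * g x)) * ennreal (exp (s\<^sup>2 * (a + c - a)\<^sup>2 / 8))"
      unfolding g_def by (intro mult_left_mono Hoeffdings_lemma_nn_integral s) auto
    finally show ?thesis by (simp add: mult.commute)
  qed
  have "(\<integral>\<^sup>+x. ennreal (exp (s * f x)) \<partial>(\<Pi>\<^sub>M i\<in>insert j I. M))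
      = (\<integral>\<^sup>+x. \<integral>\<^sup>+y. ennreal (exp (s * f (x(j := y)))) \<partial>M \<partial>?P)"
    by (rule product_nn_integral_insert[OF insert.hyps]) measurable
  also have "\<dots> \<le> (\<integral>\<^sup>+x. ennreal (exp (s\<^sup>2 * c\<^sup>2 / 8)) * ennreal (exp (s * g x)) \<partial>?P)"
    by (intro nn_integral_mono step)
  also have "\<dots> = ennreal (exp (s\<^sup>2 * c\<^sup>2 / 8)) * (\<integral>\<^sup>+x. ennreal (exp (s * g x)) \<partial>?P)"
    using gm by (intro nn_integral_cmult) measurable
  also have "\<dots> \<le> ennreal (exp (s\<^sup>2 * c\<^sup>2 / 8)) * ennreal (exp (s * (\<integral>x. g x \<partial>?P) + s\<^sup>2 * card I * c\<^sup>2 / 8))"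
    by (intro mult_left_mono insert.IH gm gb gd) auto
  also have "\<dots> = ennreal (exp (s * (\<integral>x. g x \<partial>?P) + s\<^sup>2 * card (insert j I) * c\<^sup>2 / 8))"
    using insert.hyps by (simp add: ennreal_mult'[symmetric] exp_add[symmetric] algebra_simps add_divide_distrib)
  also have "(\<integral>x. g x \<partial>?P) = (\<integral>x. f x \<partial>(\<Pi>\<^sub>M i\<in>insert j I. M))"
    unfolding g_def
    by (rule product_integral_insert[symmetric, OF insert.hyps], rule jI.integrable_const_bound[where B = C])
       (use insert.prems in \<open>auto intro!: AE_I2\<close>)
  finally show ?case .
qed

section \<open>Discrepancy: elementary bounds and symmetrization\<close>

definition discrepancy :: "('r \<Rightarrow> 'a set) \<Rightarrow> 'a measure \<Rightarrow> nat \<Rightarrow> (nat \<Rightarrow> 'a) \<Rightarrow> real" where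
  "discrepancy R M n z = (SUP r. \<bar>measure M (R r) - (\<Sum>l<n. indicator (R r) (z l)) / n\<bar>)"

lemma sum_indicator_bounds:
  fixes n :: nat
  shows "0 \<le> (\<Sum>l<n. indicator S (z l) :: real)" "(\<Sum>l<n. indicator S (z l) :: real) \<le> n"
  using sum_mono[of "{..<n}" "\<lambda>l. indicator S (z l) :: real" "\<lambda>_. 1"] by (auto simp: sum_nonneg indicator_le_1)

lemma empirical_diff_le_1:
  assumes "prob_space M"
  shows "\<bar>measure M S - (\<Sum>l<n. indicator S (z l)) / real n\<bar> \<le> 1"
proof -
  have "(\<Sum>l<n. indicator S (z l)) / real n \<in> {0..1}"
    using sum_indicator_bounds[where S = S and z = z and n = n] by (auto simp: divide_le_eq)
  moreover have "0 \<le> measure M S" "measure M S \<le> 1" using prob_space.prob_le_1[OF assms] by auto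
  ultimately show ?thesis unfolding atLeastAtMost_iff by linarith
qed

lemma bdd_above_discrepancy:
  assumes "prob_space M"
  shows "bdd_above (range (\<lambda>r. \<bar>measure M (R r) - (\<Sum>l<n. indicator (R r) (z l)) / real n\<bar>))"
  using empirical_diff_le_1[OF assms] by (intro bdd_aboveI[where M = 1]) auto

lemma discrepancy_upper:
  assumes "prob_space M"
  shows "\<bar>measure M (R r) - (\<Sum>l<n. indicator (R r) (z l)) / n\<bar> \<le> discrepancy R M n z"
  unfolding discrepancy_def by (rule cSUP_upper[OF _ bdd_above_discrepancy[OF assms]]) simp

lemma discrepancy_bounds:
  assumes "prob_space M"
  shows "0 \<le> discrepancy R M n z" "discrepancy R M n z \<le> 1"
proof -
  show "0 \<le> discrepancy R M n z" using discrepancy_upper[OF assms, where R = R and r = undefined and n = n and z = z] by linarith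
  show "discrepancy R M n z \<le> 1"
    unfolding discrepancy_def using empirical_diff_le_1[OF assms] by (intro cSUP_least) auto
qed

lemma borel_measurable_discrepancy:
  fixes R :: "'r::countable \<Rightarrow> 'a set"
  assumes M: "prob_space M" and R: "\<And>r. R r \<in> sets M"
  shows "discrepancy R M n \<in> borel_measurable (\<Pi>\<^sub>M l\<in>{..<n}. M)"
proof -
  note R[measurable]
  have "(\<lambda>z. SUP r. \<bar>measure M (R r) - (\<Sum>l<n. indicator (R r) (z l)) / n\<bar>)
      \<in> borel_measurable (\<Pi>\<^sub>M l\<in>{..<n}. M)"
    by (intro borel_measurable_cSUP bdd_above_discrepancy[OF M]) (auto simp: countableI_type)
  then show ?thesis by (simp add: discrepancy_def[abs_def])
qed

text \<open>One point has mass \<open>1 / n\<close> in the empirical measure; this is the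
  bounded-difference constant for McDiarmid's inequality.\<close>

lemma discrepancy_update_le:
  assumes M: "prob_space M" and i: "i < n"
  shows "discrepancy R M n (z(i := y)) \<le> discrepancy R M n z + 1 / n"
  unfolding discrepancy_def[of R M n "z(i := y)"]
proof (rule cSUP_least)
  fix r
  have "(\<Sum>l<n. indicator (R r) ((z(i := y)) l) :: real)
      = (\<Sum>l\<in>{..<n} - {i}. indicator (R r) (z l)) + indicator (R r) y"
    using i by (subst sum.remove[of _ i]) (auto simp: add.commute intro!: sum.cong)
  moreover have "(\<Sum>l<n. indicator (R r) (z l) :: real)
      = (\<Sum>l\<in>{..<n} - {i}. indicator (R r) (z l)) + indicator (R r) (z i)"
    using i by (subst sum.remove[of _ i]) (auto simp: add.commute)
  ultimately have "\<bar>(\<Sum>l<n. indicator (R r) ((z(i := y)) l)) - (\<Sum>l<n. indicator (R r) (z l) :: real)\<bar> \<le> 1"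
    by (simp add: indicator_def)
  then have "\<bar>(\<Sum>l<n. indicator (R r) ((z(i := y)) l)) / n - (\<Sum>l<n. indicator (R r) (z l)) / n\<bar> \<le> 1 / real n"
    unfolding diff_divide_distrib[symmetric] abs_divide by (simp add: divide_right_mono)
  then show "\<bar>measure M (R r) - (\<Sum>l<n. indicator (R r) ((z(i := y)) l)) / n\<bar> \<le> discrepancy R M n z + 1 / n"
    using discrepancy_upper[OF M, where R = R and r = r and n = n and z = z] by linarith
qed simp

text \<open>Symmetrization: the points \<open>n, \<dots>, 2n - 1\<close> are a ghost sample, and exchanging the point \<open>l\<close>
  with its ghost \<open>n + l\<close> for the \<open>l\<close> in a set \<open>B\<close> introduces the signs \<open>rademacher B\<close>.\<close>

lemma nn_integral_discrepancy_le:
  fixes R :: "'r::countable \<Rightarrow> 'a set"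
  assumes M: "prob_space M" and R: "\<And>r. R r \<in> sets M" and n: "n \<ge> 1"
    and K: "\<And>z :: nat \<Rightarrow> 'a. (\<Sum>B\<in>Pow {..<n}. SUP r. \<bar>\<Sum>l<n. rademacher B l * indicator (R r) (z l)\<bar>) \<le> 2 ^ n * K"
  shows "(\<integral>\<^sup>+z. ennreal (discrepancy R M n z) \<partial>(\<Pi>\<^sub>M l\<in>{..<n}. M)) \<le> ennreal (2 * K / n)"
proof -
  note R[measurable]
  interpret M: prob_space M by (rule M)
  interpret product_sigma_finite "\<lambda>_::nat. M" by unfold_locales
  let ?X = "\<Pi>\<^sub>M l\<in>{..<n}. M" and ?Y = "\<Pi>\<^sub>M l\<in>{n..<2*n}. M" and ?J = "\<Pi>\<^sub>M l\<in>{..<2*n}. M"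
  interpret Y: prob_space ?Y by (intro prob_space_PiM M)
  interpret J: prob_space ?J by (intro prob_space_PiM M)
  define h where "h r w = (indicator (R r) w :: real)" for r w
  have hm [measurable]: "h r \<in> borel_measurable M" for r unfolding h_def by measurable
  have h01: "0 \<le> h r w" "h r w \<le> 1" for r w by (auto simp: h_def)
  define G where "G B w = (SUP r. \<bar>\<Sum>l<n. rademacher B l * (h r (w (n + l)) - h r (w l))\<bar>)" for B and w :: "nat \<Rightarrow> 'a"
  have Gle: "\<bar>\<Sum>l<n. rademacher B l * (h r (w (n + l)) - h r (w l))\<bar> \<le> n" for B r w
  proof -
    have "\<bar>rademacher B l * (h r (w (n + l)) - h r (w l))\<bar> \<le> 1" for l
      using h01[of r "w (n + l)"] h01[of r "w l"] by (simp add: abs_mult abs_le_iff)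
    then show ?thesis
      using order_trans[OF sum_abs sum_mono[of "{..<n}" _ "\<lambda>_. 1::real"]] by simp
  qed
  have Gbdd: "bdd_above (range (\<lambda>r. \<bar>\<Sum>l<n. rademacher B l * (h r (w (n + l)) - h r (w l))\<bar>))" for B w
    using Gle by (intro bdd_aboveI[where M = "real n"]) auto
  have Gup: "\<bar>\<Sum>l<n. rademacher B l * (h r (w (n + l)) - h r (w l))\<bar> \<le> G B w" for B r w
    unfolding G_def by (rule cSUP_upper[OF _ Gbdd]) simp
  have Gb: "0 \<le> G B w" "G B w \<le> n" for B w
  proof -
    show "0 \<le> G B w" using Gup[of B undefined w] by linarith
    show "G B w \<le> n" unfolding G_def by (rule cSUP_least[OF _ Gle]) simp
  qed
  have Gm [measurable]: "G B \<in> borel_measurable ?J" for B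
  proof -
    have [measurable]: "(\<lambda>w. w l) \<in> ?J \<rightarrow>\<^sub>M M" if "l < 2 * n" for l
      by (rule measurable_component_singleton) (use that in auto)
    have "(\<lambda>w. \<Sum>l<n. rademacher B l * (h r (w (n + l)) - h r (w l))) \<in> borel_measurable ?J" for r
      by (intro borel_measurable_sum borel_measurable_times borel_measurable_diff borel_measurable_const)
         measurable
    then have "(\<lambda>w. SUP r. \<bar>\<Sum>l<n. rademacher B l * (h r (w (n + l)) - h r (w l))\<bar>) \<in> borel_measurable ?J"
      by (intro borel_measurable_cSUP Gbdd) (auto simp: countableI_type)
    then show ?thesis by (simp add: G_def[abs_def])
  qed
  have idx: "{..<n} \<union> {n..<2*n} = {..<2*n}" "{..<n} \<inter> {n..<2*n} = {}" by auto
  have swap: "(\<integral>\<^sup>+w. ennreal (G {..<n} w) \<partial>?J) = (\<integral>\<^sup>+w. ennreal (G B w) \<partial>?J)" if B: "B \<subseteq> {..<n}" for B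
  proof -
    \<comment> \<open>The permutation fixes the pairs with index in \<open>B\<close> and exchanges
      \<open>l\<close> with \<open>n + l\<close> for \<open>l < n\<close> outside \<open>B\<close>,
      which are the indices where \<open>rademacher B\<close> is negative. It carries the case of
      all signs positive to the signs of \<open>B\<close>, and the product measure is
      invariant.\<close>
    define \<pi> where "\<pi> i = (if i < n then (if i \<in> B then i else n + i)
                              else (if i - n \<in> B then i else i - n))" for i :: nat
    have \<pi>: "inj_on \<pi> {..<2*n}" "\<pi> \<in> {..<2*n} \<rightarrow> {..<2*n}"
      using B by (auto simp: inj_on_def \<pi>_def split: if_splits)
    let ?t = "\<lambda>w. \<lambda>i\<in>{..<2*n}. w (\<pi> i)"
    have "(\<integral>\<^sup>+w. ennreal (G {..<n} w) \<partial>?J) = (\<integral>\<^sup>+w. ennreal (G {..<n} w) \<partial>distr ?J ?J ?t)"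
      using distr_PiM_reindex[of "{..<2*n}" "\<lambda>_. M" \<pi> "{..<2*n}"] M \<pi> by simp
    also have "\<dots> = (\<integral>\<^sup>+w. ennreal (G {..<n} (?t w)) \<partial>?J)"
      by (rule nn_integral_distr)
         (use \<pi>(2) in \<open>auto intro!: measurable_restrict measurable_component_singleton\<close>)
    also have "(\<lambda>w. G {..<n} (?t w)) = G B"
    proof
      fix w
      have "(\<Sum>l<n. rademacher {..<n} l * (h r (?t w (n + l)) - h r (?t w l)))
          = (\<Sum>l<n. rademacher B l * (h r (w (n + l)) - h r (w l)))" for r
        by (intro sum.cong) (auto simp: rademacher_def \<pi>_def)
      then show "G {..<n} (?t w) = G B w" by (simp add: G_def)
    qed
    finally show ?thesis .
  qed
  \<comment> \<open>The sample and the ghost sample each satisfy the hypothesis on \<open>K\<close>;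
    the triangle inequality gives the factor 2.\<close>
  have Kle: "(\<Sum>B\<in>Pow {..<n}. G B w) \<le> 2 ^ n * (2 * K)" for w
  proof -
    define F where "F B z = (SUP r. \<bar>\<Sum>l<n. rademacher B l * h r (z l)\<bar>)" for B and z :: "nat \<Rightarrow> 'a"
    have "bdd_above (range (\<lambda>r. \<bar>\<Sum>l<n. rademacher B l * h r (z l)\<bar>))" for B and z :: "nat \<Rightarrow> 'a"
    proof (rule bdd_aboveI[where M = "real n"])
      have "\<bar>rademacher B l * h r (z l)\<bar> \<le> 1" for l r
        using h01[of r "z l"] by (simp add: abs_mult abs_le_iff)
      then have "\<bar>\<Sum>l<n. rademacher B l * h r (z l)\<bar> \<le> real n" for r
        using order_trans[OF sum_abs sum_mono[of "{..<n}" _ "\<lambda>_. 1::real"]] by simp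
      then show "v \<in> range (\<lambda>r. \<bar>\<Sum>l<n. rademacher B l * h r (z l)\<bar>) \<Longrightarrow> v \<le> real n" for v by auto
    qed
    then have Fup: "\<bar>\<Sum>l<n. rademacher B l * h r (z l)\<bar> \<le> F B z" for B r and z :: "nat \<Rightarrow> 'a"
      unfolding F_def by (intro cSUP_upper) auto
    have "G B w \<le> F B (\<lambda>l. w (n + l)) + F B w" for B
      unfolding G_def
    proof (rule cSUP_least)
      fix r
      have "(\<Sum>l<n. rademacher B l * (h r (w (n + l)) - h r (w l)))
          = (\<Sum>l<n. rademacher B l * h r (w (n + l))) - (\<Sum>l<n. rademacher B l * h r (w l))"
        by (simp add: sum_subtractf right_diff_distrib)
      then show "\<bar>\<Sum>l<n. rademacher B l * (h r (w (n + l)) - h r (w l))\<bar> \<le> F B (\<lambda>l. w (n + l)) + F B w"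
        using Fup[of B r "\<lambda>l. w (n + l)"] Fup[of B r w] by linarith
    qed simp
    then have "(\<Sum>B\<in>Pow {..<n}. G B w) \<le> (\<Sum>B\<in>Pow {..<n}. F B (\<lambda>l. w (n + l))) + (\<Sum>B\<in>Pow {..<n}. F B w)"
      unfolding sum.distrib[symmetric] by (intro sum_mono)
    also have "\<dots> \<le> 2 ^ n * K + 2 ^ n * K"
      unfolding F_def h_def by (intro add_mono K)
    finally show ?thesis by (simp add: mult_ac)
  qed
  \<comment> \<open>All sign sets have the same integral, so the one with all signs positive may be
    replaced by the average over signs, to which the pointwise bound applies.\<close>
  have "ennreal (2 ^ n) * (\<integral>\<^sup>+w. ennreal (G {..<n} w) \<partial>?J) = (\<Sum>B\<in>Pow {..<n}. \<integral>\<^sup>+w. ennreal (G {..<n} w) \<partial>?J)"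
    by (simp add: card_Pow ennreal_power[symmetric])
  also have "\<dots> = (\<Sum>B\<in>Pow {..<n}. \<integral>\<^sup>+w. ennreal (G B w) \<partial>?J)"
    by (intro sum.cong swap) auto
  also have "\<dots> = (\<integral>\<^sup>+w. (\<Sum>B\<in>Pow {..<n}. ennreal (G B w)) \<partial>?J)"
    by (rule nn_integral_sum[symmetric]) measurable
  also have "\<dots> \<le> (\<integral>\<^sup>+w. ennreal (2 ^ n * (2 * K)) \<partial>?J)"
    using Kle Gb by (intro nn_integral_mono) (auto simp: sum_ennreal ennreal_leI)
  also have "\<dots> = ennreal (2 ^ n) * ennreal (2 * K)"
    by (simp add: J.emeasure_space_1 ennreal_mult')
  finally have GK: "(\<integral>\<^sup>+w. ennreal (G {..<n} w) \<partial>?J) \<le> ennreal (2 * K)"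
    by (subst (asm) ennreal_mult_le_mult_iff) auto
  \<comment> \<open>With the sample \<open>x\<close> fixed, \<open>measure M (R r)\<close> is the
    mean of the ghost frequencies, and the supremum of means is at most the mean of the
    supremum.\<close>
  have ghost: "ennreal (n * discrepancy R M n x) \<le> (\<integral>\<^sup>+y. ennreal (G {..<n} (merge {..<n} {n..<2*n} (x, y))) \<partial>?Y)"
    if x: "x \<in> space ?X" for x
  proof -
    let ?m = "\<lambda>y. merge {..<n} {n..<2*n} (x, y)"
    have mm: "?m \<in> ?Y \<rightarrow>\<^sub>M ?J"
      using measurable_compose[OF measurable_Pair1'[OF x] measurable_merge[of _ "{n..<2*n}"]] unfolding idx .
    have Gm': "(\<lambda>y. G {..<n} (?m y)) \<in> borel_measurable ?Y" by (rule measurable_compose[OF mm Gm])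
    have Gint: "integrable ?Y (\<lambda>y. G {..<n} (?m y))"
      using Gb by (intro Y.integrable_const_bound[OF _ Gm', where B = n]) auto
    have comp: "integrable ?Y (\<lambda>y. h r (y (n + l)))" "(\<integral>y. h r (y (n + l)) \<partial>?Y) = measure M (R r)"
      if "l < n" for r l
    proof -
      have ym: "(\<lambda>y. y (n + l)) \<in> ?Y \<rightarrow>\<^sub>M M" using that by (intro measurable_component_singleton) auto
      show "integrable ?Y (\<lambda>y. h r (y (n + l)))"
        using h01 by (intro Y.integrable_const_bound[where B = 1] measurable_compose[OF ym hm]) auto
      have "(\<integral>y. h r (y (n + l)) \<partial>?Y) = (\<integral>w. h r w \<partial>distr ?Y M (\<lambda>y. y (n + l)))"
        by (rule integral_distr[symmetric, OF ym hm])
      also have "distr ?Y M (\<lambda>y. y (n + l)) = M"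
        using that by (intro distr_PiM_component[of "{n..<2*n}" "\<lambda>_. M"] M) auto
      finally show "(\<integral>y. h r (y (n + l)) \<partial>?Y) = measure M (R r)" by (simp add: h_def)
    qed
    have "discrepancy R M n x \<le> (\<integral>y. G {..<n} (?m y) \<partial>?Y) / n"
      unfolding discrepancy_def
    proof (rule cSUP_least)
      fix r
      have "(\<integral>y. (\<Sum>l<n. h r (y (n + l)) - h r (x l)) \<partial>?Y) = (\<Sum>l<n. measure M (R r) - h r (x l))"
        using comp by (subst Bochner_Integration.integral_sum) (auto simp: Y.prob_space)
      also have "\<dots> = n * (measure M (R r) - (\<Sum>l<n. indicator (R r) (x l)) / n)"
        using n by (simp add: sum_subtractf h_def right_diff_distrib)
      finally have "n * \<bar>measure M (R r) - (\<Sum>l<n. indicator (R r) (x l)) / n\<bar>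
          = \<bar>\<integral>y. (\<Sum>l<n. h r (y (n + l)) - h r (x l)) \<partial>?Y\<bar>"
        by (simp add: abs_mult)
      also have "\<dots> \<le> (\<integral>y. \<bar>\<Sum>l<n. h r (y (n + l)) - h r (x l)\<bar> \<partial>?Y)" by (rule integral_abs_bound)
      also have "\<dots> \<le> (\<integral>y. G {..<n} (?m y) \<partial>?Y)"
      proof (rule integral_mono[OF _ Gint])
        show "integrable ?Y (\<lambda>y. \<bar>\<Sum>l<n. h r (y (n + l)) - h r (x l)\<bar>)"
          using comp by (intro integrable_abs Bochner_Integration.integrable_sum Bochner_Integration.integrable_diff) auto
        fix y
        have "(\<Sum>l<n. h r (y (n + l)) - h r (x l))
            = (\<Sum>l<n. rademacher {..<n} l * (h r (?m y (n + l)) - h r (?m y l)))"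
          by (intro sum.cong) (auto simp: rademacher_def merge_def)
        then show "\<bar>\<Sum>l<n. h r (y (n + l)) - h r (x l)\<bar> \<le> G {..<n} (?m y)"
          using Gup[of "{..<n}" r "?m y"] by simp
      qed
      finally show "\<bar>measure M (R r) - (\<Sum>l<n. indicator (R r) (x l)) / n\<bar> \<le> (\<integral>y. G {..<n} (?m y) \<partial>?Y) / n"
        using n by (simp add: field_simps)
    qed simp
    then have "n * discrepancy R M n x \<le> (\<integral>y. G {..<n} (?m y) \<partial>?Y)" using n by (simp add: field_simps)
    then have "ennreal (n * discrepancy R M n x) \<le> ennreal (\<integral>y. G {..<n} (?m y) \<partial>?Y)" by (rule ennreal_leI)
    also have "\<dots> = (\<integral>\<^sup>+y. ennreal (G {..<n} (?m y)) \<partial>?Y)"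
      using Gint Gb by (intro nn_integral_eq_integral[symmetric]) auto
    finally show ?thesis .
  qed
  have dm: "discrepancy R M n \<in> borel_measurable ?X" by (rule borel_measurable_discrepancy[OF M R])
  have "ennreal n * (\<integral>\<^sup>+x. ennreal (discrepancy R M n x) \<partial>?X) = (\<integral>\<^sup>+x. ennreal (n * discrepancy R M n x) \<partial>?X)"
    using dm by (subst nn_integral_cmult[symmetric]) (auto simp: ennreal_mult')
  also have "\<dots> \<le> (\<integral>\<^sup>+x. \<integral>\<^sup>+y. ennreal (G {..<n} (merge {..<n} {n..<2*n} (x, y))) \<partial>?Y \<partial>?X)"
    by (intro nn_integral_mono ghost)
  also have "\<dots> = (\<integral>\<^sup>+w. ennreal (G {..<n} w) \<partial>?J)"
    using product_nn_integral_fold[OF idx(2), of "\<lambda>w. ennreal (G {..<n} w)"] unfolding idx by simp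
  also note GK
  also have "ennreal (2 * K) = ennreal n * ennreal (2 * K / n)"
    using n by (subst ennreal_mult'[symmetric]) auto
  finally show ?thesis using n by (subst (asm) ennreal_mult_le_mult_iff) auto
qed

lemma rat_rect_in_sets: "rat_rect r \<in> sets borel"
  by (cases r) (auto simp: rat_rect_def intro: borel_Times)

context
  fixes M :: "(real \<times> real) measure" and n :: nat
  assumes M: "prob_space M" "sets M = sets borel" and n: "n \<ge> 1"
begin

lemma nn_integral_discrepancy_rat_rect_le:
  "(\<integral>\<^sup>+z. ennreal (discrepancy rat_rect M n z) \<partial>(\<Pi>\<^sub>M l\<in>{..<n}. M)) \<le> ennreal (152 / sqrt n)"
proof -
  have "(\<integral>\<^sup>+z. ennreal (discrepancy rat_rect M n z) \<partial>(\<Pi>\<^sub>M l\<in>{..<n}. M)) \<le> ennreal (2 * (76 * sqrt n) / n)"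
    using rademacher_average_rat_rect_le[OF n] M rat_rect_in_sets
    by (intro nn_integral_discrepancy_le n) auto
  also have "2 * (76 * sqrt n) / n = 152 / sqrt n"
    using n by (simp add: field_simps)
  finally show ?thesis .
qed

lemma nn_integral_exp_discrepancy_rat_rect_le:
  assumes s: "s > 0"
  shows "(\<integral>\<^sup>+z. ennreal (exp (s * discrepancy rat_rect M n z)) \<partial>(\<Pi>\<^sub>M l\<in>{..<n}. M))
           \<le> ennreal (exp (s * (152 / sqrt n) + s\<^sup>2 / (8 * n)))"
proof -
  let ?P = "\<Pi>\<^sub>M l\<in>{..<n}. M" and ?d = "discrepancy rat_rect M n"
  interpret P: prob_space ?P by (intro prob_space_PiM M)
  have dm: "?d \<in> borel_measurable ?P"
    using M rat_rect_in_sets by (intro borel_measurable_discrepancy) auto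
  note db = discrepancy_bounds[OF M(1), of rat_rect n]
  have int: "integrable ?P ?d"
    using db by (intro P.integrable_const_bound[OF _ dm, where B = 1]) auto
  have "ennreal (\<integral>z. ?d z \<partial>?P) \<le> ennreal (152 / sqrt n)"
    using nn_integral_discrepancy_rat_rect_le nn_integral_eq_integral[OF int] db by simp
  then have mean: "(\<integral>z. ?d z \<partial>?P) \<le> 152 / sqrt n" by (subst (asm) ennreal_le_iff) auto
  have "(\<integral>\<^sup>+z. ennreal (exp (s * ?d z)) \<partial>?P)
      \<le> ennreal (exp (s * (\<integral>z. ?d z \<partial>?P) + s\<^sup>2 * card {..<n} * (1 / n)\<^sup>2 / 8))"
    using db discrepancy_update_le[OF M(1)]
    by (intro bounded_differences_exp_moment_le[where C = 1] M dm s) auto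
  also have "s\<^sup>2 * card {..<n} * (1 / n)\<^sup>2 / 8 = s\<^sup>2 / (8 * n)"
    using n by (simp add: power2_eq_square field_simps)
  also have "ennreal (exp (s * (\<integral>z. ?d z \<partial>?P) + s\<^sup>2 / (8 * n))) \<le> ennreal (exp (s * (152 / sqrt n) + s\<^sup>2 / (8 * n)))"
    using mean s by (intro ennreal_leI) (simp only: exp_le_cancel_iff add_le_cancel_right mult_left_mono less_imp_le)
  finally show ?thesis .
qed

end

section \<open>From rational rectangles to arbitrary intervals\<close>

lemma lower_set_rat_approx:
  fixes L :: "real set"
  assumes "\<And>x y. x \<in> L \<Longrightarrow> y \<le> x \<Longrightarrow> y \<in> L"
  obtains q :: "nat \<Rightarrow> rat" where "\<And>x. \<forall>\<^sub>F k in sequentially. x \<le> of_rat (q k) \<longleftrightarrow> x \<in> L"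
proof -
  consider "L = {}" | "L = UNIV" | "L \<noteq> {}" "L \<noteq> UNIV" by blast
  then show ?thesis
  proof cases
    case 1
    have "\<forall>\<^sub>F k in sequentially. x \<le> of_rat (- of_nat k) \<longleftrightarrow> x \<in> L" for x
      using eventually_gt_at_top[of "nat \<lceil>- x\<rceil>"] by eventually_elim (use 1 in \<open>simp add: of_rat_minus, linarith\<close>)
    then show ?thesis by (rule that)
  next
    case 2
    have "\<forall>\<^sub>F k in sequentially. x \<le> of_rat (of_nat k) \<longleftrightarrow> x \<in> L" for x
      using eventually_gt_at_top[of "nat \<lceil>x\<rceil>"] by eventually_elim (use 2 in \<open>simp, linarith\<close>)
    then show ?thesis by (rule that)
  next
    case 3
    then obtain b where b: "b \<notin> L" by blast
    have bdd: "bdd_above L" using assms b by (intro bdd_aboveI[of _ b]) (meson linear)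
    define a where "a = Sup L"
    have less: "x \<in> L" if "x < a" for x
      using that less_cSup_iff[OF 3(1) bdd, of x] assms unfolding a_def by (meson less_imp_le)
    have ge: "x \<le> a" if "x \<in> L" for x using cSup_upper[OF that bdd] by (simp add: a_def)
    have small: "\<forall>\<^sub>F k in sequentially. 1 / real (Suc k) < e" if "e > 0" for e
      using order_tendstoD(2)[OF LIMSEQ_inverse_real_of_nat that] by (simp add: inverse_eq_divide)
    show ?thesis
    \<comment> \<open>The approximating endpoints must decide the boundary point \<open>a\<close>
      correctly: they decrease strictly from above to \<open>a\<close> if the supremum is attained
      and approach it strictly from below otherwise.\<close>
    proof (cases "a \<in> L")
      case True
      have "\<exists>q. a < of_rat q \<and> of_rat q < a + 1 / real (Suc k)" for k
        by (rule of_rat_dense) simp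
      then obtain q where q: "\<And>k. a < of_rat (q k)" "\<And>k. of_rat (q k) < a + 1 / real (Suc k)" by metis
      have "\<forall>\<^sub>F k in sequentially. x \<le> of_rat (q k) \<longleftrightarrow> x \<in> L" for x
      proof (cases "x \<le> a")
        case True
        then show ?thesis using q(1) assms[OF \<open>a \<in> L\<close> True] by (intro always_eventually) (auto intro: less_imp_le order_trans)
      next
        case False
        then have "\<forall>\<^sub>F k in sequentially. 1 / real (Suc k) < x - a" by (intro small) auto
        then show ?thesis
        proof eventually_elim
          case (elim k)
          then show ?case using q(2)[of k] ge[of x] False by linarith
        qed
      qed
      then show ?thesis by (rule that)
    next
      case False
      have "\<exists>q. a - 1 / real (Suc k) < of_rat q \<and> of_rat q < a" for k
        by (rule of_rat_dense) simp
      then obtain q where q: "\<And>k. a - 1 / real (Suc k) < of_rat (q k)" "\<And>k. of_rat (q k) < a" by metis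
      have "\<forall>\<^sub>F k in sequentially. x \<le> of_rat (q k) \<longleftrightarrow> x \<in> L" for x
      proof (cases "x < a")
        case True
        then have "\<forall>\<^sub>F k in sequentially. 1 / real (Suc k) < a - x" by (intro small) auto
        then show ?thesis
        proof eventually_elim
          case (elim k)
          then show ?case using q(1)[of k] less[OF True] by linarith
        qed
      next
        case False
        have "x \<notin> L" using ge[of x] \<open>a \<notin> L\<close> False by (metis order_le_less)
        then show ?thesis using q(2) False by (intro always_eventually) (auto simp: not_le not_less intro: less_le_trans)
      qed
      then show ?thesis by (rule that)
    qed
  qed
qed

text \<open>An interval is a difference of two down-closed sets: the points dominated by some
  element of \<open>S\<close>, minus the points strictly below all of \<open>S\<close>. This treats
  open, closed, degenerate, unbounded and empty intervals alike.\<close>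

lemma interval_rat_approx:
  fixes S :: "real set"
  assumes "is_interval S"
  obtains a b :: "nat \<Rightarrow> rat" where "\<And>x. \<forall>\<^sub>F k in sequentially. x \<in> {of_rat (a k)<..of_rat (b k)} \<longleftrightarrow> x \<in> S"
proof -
  define U where "U = {y. \<exists>x\<in>S. y \<le> x}"
  define L where "L = {y. \<forall>x\<in>S. y < x}"
  obtain b where b: "\<And>x. \<forall>\<^sub>F k in sequentially. x \<le> of_rat (b k) \<longleftrightarrow> x \<in> U"
    by (rule lower_set_rat_approx[of U]) (auto simp: U_def intro: order_trans)
  obtain a where a: "\<And>x. \<forall>\<^sub>F k in sequentially. x \<le> of_rat (a k) \<longleftrightarrow> x \<in> L"
    by (rule lower_set_rat_approx[of L]) (auto simp: L_def intro: le_less_trans)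
  have S: "x \<in> S \<longleftrightarrow> x \<in> U \<and> x \<notin> L" for x
    using assms by (auto simp: U_def L_def is_interval_1 not_less)
  have "\<forall>\<^sub>F k in sequentially. x \<in> {of_rat (a k)<..of_rat (b k)} \<longleftrightarrow> x \<in> S" for x
    using a[of x] b[of x] by eventually_elim (auto simp: S)
  then show ?thesis by (rule that)
qed

text \<open>Indicators of rational rectangles converge pointwise to that of
  \<open>S \<times> T\<close>, so by dominated convergence a bound on the countable family controls
  the uncountable supremum inside \<open>W_box_bar\<close>.\<close>

lemma interval_rect_diff_le:
  fixes \<mu> \<nu> :: "(real \<times> real) measure"
  assumes \<mu>: "prob_space \<mu>" "sets \<mu> = sets borel" and \<nu>: "prob_space \<nu>" "sets \<nu> = sets borel"
    and K: "\<And>r. \<bar>measure \<mu> (rat_rect r) - measure \<nu> (rat_rect r)\<bar> \<le> K"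
    and S: "is_interval S" and T: "is_interval T"
  shows "\<bar>measure \<mu> (S \<times> T) - measure \<nu> (S \<times> T)\<bar> \<le> K"
proof -
  obtain a b where ab: "\<And>x. \<forall>\<^sub>F k in sequentially. x \<in> {of_rat (a k)<..of_rat (b k)} \<longleftrightarrow> x \<in> S"
    by (rule interval_rat_approx[OF S]) blast
  obtain c d where cd: "\<And>x. \<forall>\<^sub>F k in sequentially. x \<in> {of_rat (c k)<..of_rat (d k)} \<longleftrightarrow> x \<in> T"
    by (rule interval_rat_approx[OF T]) blast
  define R where "R k = rat_rect (a k, b k, c k, d k)" for k
  have lim: "(\<lambda>k. indicator (R k) w :: real) \<longlonglongrightarrow> indicator (S \<times> T) w" for w
  proof (rule tendsto_eventually)
    show "\<forall>\<^sub>F k in sequentially. indicator (R k) w = (indicator (S \<times> T) w :: real)"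
      using ab[of "fst w"] cd[of "snd w"]
      by eventually_elim (auto simp: R_def rat_rect_def indicator_def mem_Times_iff)
  qed
  have ST: "S \<times> T \<in> sets borel"
    by (intro borel_Times) (auto intro: real_interval_borel_measurable S T)
  have conv: "(\<lambda>k. measure N (R k)) \<longlonglongrightarrow> measure N (S \<times> T)" if N: "prob_space N" "sets N = sets borel" for N
  proof -
    interpret prob_space N by (rule N)
    have "(\<lambda>k. \<integral>w. indicator (R k) w \<partial>N) \<longlonglongrightarrow> (\<integral>w. indicator (S \<times> T) w \<partial>N :: real)"
      using N ST rat_rect_in_sets lim
      by (intro integral_dominated_convergence[where w = "\<lambda>_. 1"]) (auto simp: R_def indicator_def)
    moreover have "space N = UNIV" using sets_eq_imp_space_eq[OF N(2)] by simp
    ultimately show ?thesis by simp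
  qed
  have "(\<lambda>k. \<bar>measure \<mu> (R k) - measure \<nu> (R k)\<bar>) \<longlonglongrightarrow> \<bar>measure \<mu> (S \<times> T) - measure \<nu> (S \<times> T)\<bar>"
    by (intro tendsto_intros conv \<mu> \<nu>)
  then show ?thesis by (rule Lim_bounded[where M = 0]) (use K in \<open>auto simp: R_def\<close>)
qed

section \<open>Graph laws as functions of the coincidence pattern\<close>

text \<open>The sampled graph over an arbitrary vertex type, so that it can also be formed from
  edges between formal sites whose positions are not yet drawn.\<close>

definition vertex_list :: "nat \<Rightarrow> (nat \<Rightarrow> 'v \<times> 'v) \<Rightarrow> 'v list" where
  "vertex_list n z = remdups (concat (map (\<lambda>l. [fst (z l), snd (z l)]) [0..<n]))"

definition edge_weight :: "nat \<Rightarrow> (nat \<Rightarrow> 'v \<times> 'v) \<Rightarrow> nat \<Rightarrow> nat \<Rightarrow> real" where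
  "edge_weight n z i j = card {l \<in> {..<n}. z l = (vertex_list n z ! i, vertex_list n z ! j)} / n"

definition pattern_law :: "nat \<Rightarrow> (nat \<Rightarrow> 'v \<times> 'v) \<Rightarrow> pmeas measure" where
  "pattern_law n z = graph_law (length (vertex_list n z)) (edge_weight n z)"

lemma sampled_graph_law_eq: "sampled_graph_law n = pattern_law n"
  by (simp add: fun_eq_iff sampled_graph_law_def pattern_law_def sample_graph_def sample_vertices_def
      vertex_list_def edge_weight_def[abs_def] Let_def)

lemma set_vertex_list: "set (vertex_list n z) = (\<Union>l<n. {fst (z l), snd (z l)})"
  by (auto simp: vertex_list_def)

lemma distinct_vertex_list: "distinct (vertex_list n z)"
  by (simp add: vertex_list_def)

lemma graph_law_cong:
  "(\<And>i j. i < m \<Longrightarrow> j < m \<Longrightarrow> G i j = G' i j) \<Longrightarrow> graph_law m G = graph_law m G'"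
  unfolding graph_law_def
  unfolding graph_real_def[abs_def]
  by (intro arg_cong[where f = "distr _ _"] arg_cong[where f = "measure_of _ _"] ext sum.cong refl
        arg_cong2[where f = "(*)"] arg_cong[where f = ennreal]) auto

lemma remdups_map_inj_on: "inj_on f (set xs) \<Longrightarrow> remdups (map f xs) = map f (remdups xs)"
  by (induction xs) (auto simp: inj_on_def)

text \<open>Removing duplicates commutes with an injective map and keeps the order of enumeration,
  so the two weight matrices agree entry by entry and invariance of \<open>graph_law\<close> under
  permutations does not enter.\<close>

lemma pattern_law_relabel:
  assumes inj: "inj_on f (set (vertex_list n z))" and z': "\<And>l. l < n \<Longrightarrow> z' l = map_prod f f (z l)"
  shows "pattern_law n z' = pattern_law n z"
proof -
  let ?xs = "concat (map (\<lambda>l. [fst (z l), snd (z l)]) [0..<n])"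
  let ?ts = "vertex_list n z"
  have "concat (map (\<lambda>l. [fst (z' l), snd (z' l)]) [0..<n]) = map f ?xs"
    unfolding map_concat by (intro arg_cong[where f = concat]) (simp add: z')
  then have ts: "vertex_list n z' = map f ?ts"
    using inj by (simp add: vertex_list_def remdups_map_inj_on)
  have "edge_weight n z' i j = edge_weight n z i j" if ij: "i < length ?ts" "j < length ?ts" for i j
  proof -
    have "z' l = (f (?ts ! i), f (?ts ! j)) \<longleftrightarrow> z l = (?ts ! i, ?ts ! j)" if "l < n" for l
    proof -
      have "fst (z l) \<in> set ?ts" "snd (z l) \<in> set ?ts" using that by (auto simp: set_vertex_list)
      then show ?thesis using ij z'[OF that]
        by (simp add: prod_eq_iff fst_map_prod snd_map_prod inj_on_eq_iff[OF inj])
    qed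
    then have "{l \<in> {..<n}. z' l = (f (?ts ! i), f (?ts ! j))} = {l \<in> {..<n}. z l = (?ts ! i, ?ts ! j)}"
      by auto
    then show ?thesis using ij by (simp add: edge_weight_def ts)
  qed
  then show ?thesis unfolding pattern_law_def ts length_map by (rule graph_law_cong)
qed

definition endpoint :: "(nat \<Rightarrow> 'v \<times> 'v) \<Rightarrow> nat \<times> bool \<Rightarrow> 'v" where
  "endpoint z p = (if snd p then snd (z (fst p)) else fst (z (fst p)))"

definition endpoint_pattern :: "nat \<Rightarrow> (nat \<Rightarrow> 'v \<times> 'v) \<Rightarrow> ((nat \<times> bool) \<times> (nat \<times> bool)) set" where
  "endpoint_pattern n z = {(p, q) \<in> ({..<n} \<times> UNIV) \<times> ({..<n} \<times> UNIV). endpoint z p = endpoint z q}"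

text \<open>Equal coincidence relations on the \<open>2 n\<close> endpoints make the map from the
  value of an endpoint in \<open>z\<close> to its value in \<open>z'\<close> well defined and
  injective, hence a relabelling.\<close>

lemma pattern_law_eqI:
  fixes z :: "nat \<Rightarrow> 'v \<times> 'v" and z' :: "nat \<Rightarrow> 'w \<times> 'w"
  assumes "endpoint_pattern n z = endpoint_pattern n z'"
  shows "pattern_law n z' = pattern_law n z"
proof (rule pattern_law_relabel)
  let ?I = "{..<n} \<times> (UNIV :: bool set)"
  have pat: "endpoint z p = endpoint z q \<longleftrightarrow> endpoint z' p = endpoint z' q" if "p \<in> ?I" "q \<in> ?I" for p q
    using assms that by (auto simp: endpoint_pattern_def set_eq_iff)
  define f where "f v = endpoint z' (SOME p. p \<in> ?I \<and> endpoint z p = v)" for v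
  have f: "f (endpoint z p) = endpoint z' p" if p: "p \<in> ?I" for p
  proof -
    define q where "q = (SOME q. q \<in> ?I \<and> endpoint z q = endpoint z p)"
    have "q \<in> ?I \<and> endpoint z q = endpoint z p"
      unfolding q_def by (rule someI[of _ p]) (use p in simp)
    then show ?thesis unfolding f_def q_def[symmetric] using pat[of q p] p by simp
  qed
  have "set (vertex_list n z) = endpoint z ` ?I"
  proof -
    have "endpoint z ` ?I = (\<Union>l<n. \<Union>b. {endpoint z (l, b)})" by auto
    also have "\<dots> = set (vertex_list n z)" by (auto simp: set_vertex_list endpoint_def UNIV_bool)
    finally show ?thesis by simp
  qed
  then show "inj_on f (set (vertex_list n z))"
  proof (simp only:, intro inj_onI, elim imageE)
    fix v w p q assume "f v = f w" "v = endpoint z p" "p \<in> ?I" "w = endpoint z q" "q \<in> ?I"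
    then show "v = w" using f pat by metis
  qed
  show "z' l = map_prod f f (z l)" if "l < n" for l
    using f[of "(l, False)"] f[of "(l, True)"] that
    by (simp add: endpoint_def prod_eq_iff fst_map_prod snd_map_prod)
qed

text \<open>\<open>pattern_law n\<close> factors through the coincidence relation of the endpoints,
  which has finitely many values, each attained on a measurable set. So any property of the law is
  measurable, even one involving an infimum over couplings.\<close>

lemma sets_pattern_law:
  "{z \<in> space (\<Pi>\<^sub>M l\<in>{..<n}. (borel :: (real \<times> real) measure)). Q (pattern_law n z)}
     \<in> sets (\<Pi>\<^sub>M l\<in>{..<n}. (borel :: (real \<times> real) measure))"
proof -
  let ?B = "\<Pi>\<^sub>M l\<in>{..<n}. (borel :: (real \<times> real) measure)" and ?I = "{..<n} \<times> (UNIV :: bool set)"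
  have em: "(\<lambda>z. endpoint z p) \<in> borel_measurable ?B" if "p \<in> ?I" for p
  proof -
    have [measurable]: "(\<lambda>z. z (fst p)) \<in> ?B \<rightarrow>\<^sub>M borel \<Otimes>\<^sub>M borel"
      unfolding borel_prod by (rule measurable_component_singleton) (use that in auto)
    show ?thesis unfolding endpoint_def by (cases "snd p") (simp_all only: if_True if_False, measurable)
  qed
  have ps: "{z \<in> space ?B. endpoint_pattern n z = E} \<in> sets ?B" if E: "E \<subseteq> ?I \<times> ?I" for E
  proof -
    have "{z \<in> space ?B. endpoint_pattern n z = E}
        = {z \<in> space ?B. \<forall>p\<in>?I. \<forall>q\<in>?I. (endpoint z p = endpoint z q) = ((p, q) \<in> E)}"
      using E by (intro Collect_cong conj_cong refl) (force simp: endpoint_pattern_def)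
    also have "\<dots> \<in> sets ?B"
    proof (intro sets.sets_Collect_finite_All)
      fix p q assume "p \<in> ?I" "q \<in> ?I"
      then have "{z \<in> space ?B. endpoint z p = endpoint z q} \<in> sets ?B"
        by (intro borel_measurable_eq em)
      moreover from this have "{z \<in> space ?B. endpoint z p \<noteq> endpoint z q} \<in> sets ?B"
        by (rule sets.sets_Collect_neg)
      ultimately
      show "{z \<in> space ?B. (endpoint z p = endpoint z q) = ((p, q) \<in> E)} \<in> sets ?B"
        by (cases "(p, q) \<in> E") auto
    qed auto
    finally show ?thesis .
  qed
  have "{z \<in> space ?B. Q (pattern_law n z)}
      = (\<Union>E\<in>{E \<in> Pow (?I \<times> ?I). \<exists>z :: nat \<Rightarrow> real \<times> real. endpoint_pattern n z = E \<and> Q (pattern_law n z)}.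
           {z \<in> space ?B. endpoint_pattern n z = E})" (is "?L = ?R")
  proof (intro set_eqI iffI)
    fix z assume "z \<in> ?L"
    then show "z \<in> ?R" by (intro UN_I[of "endpoint_pattern n z"]) (auto simp: endpoint_pattern_def)
  next
    fix z assume "z \<in> ?R"
    then obtain z' :: "nat \<Rightarrow> real \<times> real" where "z \<in> space ?B" "endpoint_pattern n z' = endpoint_pattern n z" "Q (pattern_law n z')"
      by auto
    then show "z \<in> ?L" using pattern_law_eqI[of n z' z] by simp
  qed
  also have "\<dots> \<in> sets ?B" by (intro sets.finite_UN ps) auto
  finally show ?thesis .
qed

section \<open>Empirical measures of labelled points\<close>

text \<open>For a function that need not be measurable, \<open>nn_integral\<close> is the lower integral, so only this
  inequality survives.\<close>

lemma nn_integral_distr_le: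
  assumes g: "g \<in> M \<rightarrow>\<^sub>M N"
  shows "(\<integral>\<^sup>+x. f x \<partial>distr M N g) \<le> (\<integral>\<^sup>+x. f (g x) \<partial>M)"
  unfolding nn_integral_def[of "distr M N g"]
proof (rule SUP_least, clarsimp)
  fix h assume h: "simple_function (distr M N g) h" "h \<le> f"
  have hm: "h \<in> borel_measurable (distr M N g)" by (rule borel_measurable_simple_function[OF h(1)])
  have "integral\<^sup>S (distr M N g) h = (\<integral>\<^sup>+x. h x \<partial>distr M N g)"
    by (rule nn_integral_eq_simple_integral[symmetric, OF h(1)])
  also have "\<dots> = (\<integral>\<^sup>+x. h (g x) \<partial>M)" using hm by (intro nn_integral_distr g) simp
  also have "\<dots> \<le> (\<integral>\<^sup>+x. f (g x) \<partial>M)" using h(2) by (intro nn_integral_mono) (auto simp: le_fun_def)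
  finally show "integral\<^sup>S (distr M N g) h \<le> (\<integral>\<^sup>+x. f (g x) \<partial>M)" .
qed

text \<open>\<open>measure_of\<close> yields the intended set function only if that function is a
  measure; agreement with an existing measure \<open>N\<close> settles this without a direct proof
  of countable additivity.\<close>

lemma measure_of_borel_eqI:
  fixes N :: "'a::topological_space measure"
  assumes "sets N = sets borel" "\<And>A. A \<in> sets borel \<Longrightarrow> f A = emeasure N A"
  shows "measure_of UNIV (sets borel) f = N"
proof -
  have sp: "space N = UNIV" using sets_eq_imp_space_eq[OF assms(1)] by simp
  have "measure_of UNIV (sets borel) f = measure_of UNIV (sets borel) (emeasure N)"
    using sets.sigma_sets_eq[of "borel :: 'a measure"] assms(2) by (intro measure_of_eq) auto
  then show ?thesis using measure_of_of_measure[of N] by (simp add: sp assms(1))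
qed

definition empirical :: "nat \<Rightarrow> (nat \<Rightarrow> real \<times> real) \<Rightarrow> pmeas" where
  "empirical n z = distr (uniform_count_measure {..<n}) borel z"

lemma sets_empirical [simp]: "sets (empirical n z) = sets borel"
  by (simp add: empirical_def)

lemma prob_space_empirical:
  assumes "n \<ge> 1"
  shows "prob_space (empirical n z)"
proof -
  have ne: "{..<n} \<noteq> {}" using assms by (auto simp: lessThan_empty_iff)
  show ?thesis
    unfolding empirical_def
    by (rule prob_space.prob_space_distr[OF prob_space_uniform_count_measure])
       (use ne in \<open>auto simp: uniform_count_measure_def measurable_def space_point_measure sets_point_measure\<close>)
qed

lemma measure_empirical:
  assumes "A \<in> sets borel"
  shows "measure (empirical n z) A = (\<Sum>l<n. indicator A (z l)) / n"
proof -
  let ?U = "uniform_count_measure {..<n}"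
  have m: "z \<in> ?U \<rightarrow>\<^sub>M borel"
    by (auto simp: uniform_count_measure_def measurable_def space_point_measure sets_point_measure)
  have "measure (empirical n z) A = measure ?U (z -` A \<inter> {..<n})"
    unfolding empirical_def using assms by (subst measure_distr[OF m]) (auto simp: space_uniform_count_measure)
  also have "\<dots> = card (z -` A \<inter> {..<n}) / n"
    by (subst measure_uniform_count_measure) auto
  also have "real (card (z -` A \<inter> {..<n})) = (\<Sum>l\<in>{..<n}. indicator (z -` A) l)"
    by (simp add: indicator_def Int_def conj_commute)
  also have "\<dots> = (\<Sum>l<n. indicator A (z l))" by (intro sum.cong) (auto simp: indicator_def)
  finally show ?thesis .
qed

lemma emeasure_empirical:
  assumes "n \<ge> 1" "A \<in> sets borel"
  shows "emeasure (empirical n z) A = ennreal ((\<Sum>l<n. indicator A (z l)) / n)"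
proof -
  interpret prob_space "empirical n z" by (rule prob_space_empirical[OF assms(1)])
  show ?thesis using measure_empirical[OF assms(2)] by (simp add: emeasure_eq_measure)
qed

lemma empirical_cong: "(\<And>l. l < n \<Longrightarrow> z l = z' l) \<Longrightarrow> empirical n z = empirical n z'"
  unfolding empirical_def by (intro distr_cong) (auto simp: space_uniform_count_measure)

lemma measurable_empirical:
  assumes "n \<ge> 1"
  shows "empirical n \<in> (\<Pi>\<^sub>M l\<in>{..<n}. borel) \<rightarrow>\<^sub>M prob_algebra borel"
proof (rule measurable_prob_algebraI[OF prob_space_empirical[OF assms] measurable_subprob_algebra])
  show "subprob_space (empirical n z)" for z
    by (intro prob_space_imp_subprob_space prob_space_empirical assms)
  show "(\<lambda>z. emeasure (empirical n z) A) \<in> borel_measurable (\<Pi>\<^sub>M l\<in>{..<n}. borel)"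
    if [measurable]: "A \<in> sets borel" for A
    unfolding emeasure_empirical[OF assms that] by measurable
qed simp

text \<open>Each edge contributes \<open>1 / n\<close> at the image of its two endpoints; grouping
  the edges by their pair of vertices turns the weighted double sum into a sum over edges. Images of
  different vertices may coincide.\<close>

lemma graph_real_edge_weight:
  assumes n: "n \<ge> 1" and T: "\<And>i. i < length (vertex_list n z) \<Longrightarrow> T i = f (vertex_list n z ! i)"
  shows "graph_real (length (vertex_list n z)) (edge_weight n z) T = empirical n (\<lambda>l. map_prod f f (z l))"
  unfolding graph_real_def
proof (rule measure_of_borel_eqI[OF sets_empirical])
  fix A :: "(real \<times> real) set" assume A: "A \<in> sets borel"
  let ?ts = "vertex_list n z"
  let ?V = "set ?ts" and ?m = "length ?ts"
  have nth: "(\<Sum>i<?m. h (?ts ! i)) = (\<Sum>v\<in>?V. h v)" for h :: "_ \<Rightarrow> real"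
    by (rule sum.reindex_bij_betw[OF bij_betw_nth[OF distinct_vertex_list refl refl]])
  have "(\<Sum>i<?m. \<Sum>j<?m. ennreal (edge_weight n z i j) * indicator A (T i, T j))
      = ennreal (\<Sum>i<?m. \<Sum>j<?m. edge_weight n z i j * indicator A (f (?ts ! i), f (?ts ! j)))"
  proof -
    have nn: "0 \<le> edge_weight n z i j" for i j by (simp add: edge_weight_def)
    have "ennreal (edge_weight n z i j) * indicator A (T i, T j)
        = ennreal (edge_weight n z i j * indicator A (f (?ts ! i), f (?ts ! j)))" if "i < ?m" "j < ?m" for i j
      unfolding ennreal_mult'[OF nn] ennreal_indicator T[OF that(1)] T[OF that(2)] ..
    then have "(\<Sum>i<?m. \<Sum>j<?m. ennreal (edge_weight n z i j) * indicator A (T i, T j))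
        = (\<Sum>i<?m. \<Sum>j<?m. ennreal (edge_weight n z i j * indicator A (f (?ts ! i), f (?ts ! j))))"
      by (intro sum.cong refl) auto
    also have "\<dots> = (\<Sum>i<?m. ennreal (\<Sum>j<?m. edge_weight n z i j * indicator A (f (?ts ! i), f (?ts ! j))))"
      by (intro sum.cong refl sum_ennreal mult_nonneg_nonneg nn) auto
    also have "\<dots> = ennreal (\<Sum>i<?m. \<Sum>j<?m. edge_weight n z i j * indicator A (f (?ts ! i), f (?ts ! j)))"
      by (intro sum_ennreal sum_nonneg mult_nonneg_nonneg nn) auto
    finally show ?thesis .
  qed
  also have "(\<Sum>i<?m. \<Sum>j<?m. edge_weight n z i j * indicator A (f (?ts ! i), f (?ts ! j)))
      = (\<Sum>i<?m. \<Sum>j<?m. (card {l \<in> {..<n}. z l = (?ts ! i, ?ts ! j)} / n) * indicator A (f (?ts ! i), f (?ts ! j)))"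
    unfolding edge_weight_def ..
  also have "\<dots> = (\<Sum>v\<in>?V. \<Sum>w\<in>?V. (card {l \<in> {..<n}. z l = (v, w)} / n) * indicator A (f v, f w))"
    unfolding nth[symmetric] ..
  also have "\<dots> = (\<Sum>p\<in>?V \<times> ?V. \<Sum>l\<in>{l \<in> {..<n}. z l = p}. indicator A (map_prod f f (z l)) / n)"
    unfolding sum.cartesian_product
    by (intro sum.cong) (auto simp: case_prod_beta' map_prod_def intro!: sum.cong)
  also have "\<dots> = (\<Sum>l<n. indicator A (map_prod f f (z l)) / n)"
  proof (rule sum.group)
    show "z ` {..<n} \<subseteq> ?V \<times> ?V"
      unfolding set_vertex_list image_subset_iff mem_Times_iff by blast
  qed auto
  finally show "(\<Sum>i<?m. \<Sum>j<?m. ennreal (edge_weight n z i j) * indicator A (T i, T j))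
      = emeasure (empirical n (\<lambda>l. map_prod f f (z l))) A"
    by (simp add: emeasure_empirical[OF n A] sum_divide_distrib)
qed

section \<open>Grapheurs as random labellings\<close>

lemma prob_space_unif01: "prob_space unif01"
  by (rule prob_space_uniform_measure) auto

lemma sets_unif01: "sets unif01 = sets borel" by simp

lemma emeasure_unif01_Collect:
  assumes "Measurable.pred borel P"
  shows "emeasure unif01 {x. P x} = emeasure lborel {x\<in>{0..1}. P x}"
proof -
  have "emeasure unif01 {x. P x} = emeasure lborel ({0..1} \<inter> {x. P x}) / 1"
    using assms by (subst emeasure_uniform_measure) (auto simp: pred_def)
  also have "{0..1} \<inter> {x. P x} = {x\<in>{0..1}. P x}" by auto
  finally show ?thesis by (simp add: divide_ennreal_def)
qed

lemma nn_integral_unif01: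
  "f \<in> borel_measurable borel \<Longrightarrow> (\<integral>\<^sup>+x. f x \<partial>unif01) = (\<integral>\<^sup>+x. f x * indicator {0..1} x \<partial>lborel)"
  by (subst nn_integral_uniform_measure) (auto simp: divide_ennreal_def)

abbreviation unif2 :: "(real \<times> real) measure" where
  "unif2 \<equiv> unif01 \<Otimes>\<^sub>M unif01"

lemma sets_unif2: "sets unif2 = sets borel"
  unfolding borel_prod[symmetric] by (rule sets_pair_measure_cong) auto

lemma prob_space_unif2: "prob_space unif2"
proof -
  interpret prob_space unif01 by (rule prob_space_unif01)
  interpret pair_prob_space unif01 unif01 ..
  show ?thesis by unfold_locales
qed

lemma nn_integral_unif2:
  assumes "f \<in> borel_measurable borel"
  shows "(\<integral>\<^sup>+w. f w \<partial>unif2) = (\<integral>\<^sup>+x. \<integral>\<^sup>+y. f (x, y) \<partial>unif01 \<partial>unif01)"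
proof -
  interpret prob_space unif01 by (rule prob_space_unif01)
  have "f \<in> borel_measurable unif2"
    using assms measurable_cong_sets[OF sets_unif2 refl] by blast
  then show ?thesis by (rule nn_integral_fst[symmetric])
qed

lemma emeasure_unif2:
  assumes A: "A \<in> sets borel"
  shows "emeasure unif2 A = emeasure lborel (A \<inter> ({0..1} \<times> {0..1}))"
proof -
  have [measurable]: "A \<in> sets (borel \<Otimes>\<^sub>M borel)" unfolding borel_prod by (rule A)
  have "emeasure unif2 A = (\<integral>\<^sup>+w. indicator A w \<partial>unif2)"
    using A by (intro nn_integral_indicator[symmetric]) (simp add: sets_unif2)
  also have "\<dots> = (\<integral>\<^sup>+x. \<integral>\<^sup>+y. indicator A (x, y) \<partial>unif01 \<partial>unif01)"
    using A by (intro nn_integral_unif2) simp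
  also have "\<dots> = (\<integral>\<^sup>+x. \<integral>\<^sup>+y. indicator A (x, y) * indicator {0..1} y \<partial>lborel \<partial>unif01)"
    by (intro nn_integral_cong nn_integral_unif01) measurable
  also have "\<dots> = (\<integral>\<^sup>+x. (\<integral>\<^sup>+y. indicator A (x, y) * indicator {0..1} y \<partial>lborel) * indicator {0..1} x \<partial>lborel)"
    by (intro nn_integral_unif01) measurable
  also have "\<dots> = (\<integral>\<^sup>+x. \<integral>\<^sup>+y. indicator (A \<inter> ({0..1} \<times> {0..1})) (x, y) \<partial>lborel \<partial>lborel)"
    by (intro nn_integral_cong, subst nn_integral_multc[symmetric])
       (auto intro!: nn_integral_cong split: split_indicator)
  also have "\<dots> = (\<integral>\<^sup>+w. indicator (A \<inter> ({0..1} \<times> {0..1})) w \<partial>(lborel \<Otimes>\<^sub>M lborel))"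
    by (intro lborel.nn_integral_fst) measurable
  also have "\<dots> = emeasure lborel (A \<inter> ({0..1} \<times> {0..1}))"
    unfolding lborel_prod using A by (intro nn_integral_indicator) (auto intro!: sets.Int borel_Times)
  finally show ?thesis .
qed

text \<open>A label \<open>(a, b)\<close> describes the two endpoints of an edge: \<open>0\<close> and \<open>1\<close> stand for fresh uniform
  points and \<open>i + 2\<close> for the atom \<open>T i\<close>.\<close>

fun label_weight ::
  "(nat \<Rightarrow> nat \<Rightarrow> real) \<Rightarrow> (nat \<Rightarrow> real) \<Rightarrow> (nat \<Rightarrow> real) \<Rightarrow> real \<Rightarrow> real \<Rightarrow> nat \<Rightarrow> nat \<Rightarrow> real" where
  "label_weight E \<sigma> \<tau> \<theta> \<kappa> 0 0 = \<kappa>"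
| "label_weight E \<sigma> \<tau> \<theta> \<kappa> 0 (Suc 0) = \<theta>"
| "label_weight E \<sigma> \<tau> \<theta> \<kappa> 0 (Suc (Suc i)) = \<tau> i"
| "label_weight E \<sigma> \<tau> \<theta> \<kappa> (Suc 0) b = 0"
| "label_weight E \<sigma> \<tau> \<theta> \<kappa> (Suc (Suc i)) 0 = \<sigma> i"
| "label_weight E \<sigma> \<tau> \<theta> \<kappa> (Suc (Suc i)) (Suc 0) = 0"
| "label_weight E \<sigma> \<tau> \<theta> \<kappa> (Suc (Suc i)) (Suc (Suc j)) = E i j"

text \<open>Both endpoints of an edge read the same pair \<open>w\<close>. So label
  \<open>(0, 0)\<close> repeats one fresh point and gives the diagonal part, with weight
  \<open>\<kappa>\<close>, while \<open>(0, 1)\<close> gives two independent points, with weight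
  \<open>\<theta>\<close>.\<close>

fun vertex :: "(nat \<Rightarrow> real) \<Rightarrow> real \<times> real \<Rightarrow> nat \<Rightarrow> real" where
  "vertex T w 0 = fst w"
| "vertex T w (Suc 0) = snd w"
| "vertex T w (Suc (Suc i)) = T i"

definition edge :: "(nat \<Rightarrow> real) \<Rightarrow> real \<times> real \<Rightarrow> nat \<times> nat \<Rightarrow> real \<times> real" where
  "edge T w c = (vertex T w (fst c), vertex T w (snd c))"

lemma suminf_ennreal_Suc: "(\<Sum>n. f n) = f 0 + (\<Sum>n. f (Suc n))" for f :: "nat \<Rightarrow> ennreal"
  using sums_unique[OF sums_Suc[of f, OF summable_sums[OF summableI]]] by (simp add: add.commute)

lemma measurable_vertex [measurable (raw)]:
  assumes T [measurable]: "T \<in> M \<rightarrow>\<^sub>M iid_unif" and w [measurable]: "w \<in> M \<rightarrow>\<^sub>M unif2"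
    and a: "a \<in> M \<rightarrow>\<^sub>M count_space UNIV"
  shows "(\<lambda>x. vertex (T x) (w x) (a x)) \<in> borel_measurable M"
proof (rule measurable_compose_countable[OF _ a])
  fix i
  have [measurable]: "(\<lambda>x. T x k) \<in> borel_measurable M" for k
    using measurable_compose[OF T, of "\<lambda>T. T k" unif01] measurable_cong_sets[OF refl sets_unif01, of M]
    unfolding iid_unif_def by auto
  have "w \<in> M \<rightarrow>\<^sub>M borel \<Otimes>\<^sub>M borel"
    using w measurable_cong_sets[OF refl sets_unif2, of M] unfolding borel_prod by blast
  then have [measurable]: "(\<lambda>x. fst (w x)) \<in> borel_measurable M" "(\<lambda>x. snd (w x)) \<in> borel_measurable M"
    by measurable
  show "(\<lambda>x. vertex (T x) (w x) i) \<in> borel_measurable M"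
  proof (cases i)
    case (Suc j)
    then show ?thesis by (cases j) auto
  qed auto
qed

lemma measurable_edge:
  assumes "T \<in> M \<rightarrow>\<^sub>M iid_unif" "w \<in> M \<rightarrow>\<^sub>M unif2" "c \<in> M \<rightarrow>\<^sub>M count_space UNIV"
  shows "(\<lambda>x. edge (T x) (w x) (c x)) \<in> borel_measurable M"
proof -
  have "(\<lambda>x. fst (c x)) \<in> M \<rightarrow>\<^sub>M count_space UNIV" "(\<lambda>x. snd (c x)) \<in> M \<rightarrow>\<^sub>M count_space UNIV"
    using assms(3) by (auto intro: measurable_compose[of c])
  then have "(\<lambda>x. edge (T x) (w x) (c x)) \<in> M \<rightarrow>\<^sub>M borel \<Otimes>\<^sub>M borel"
    unfolding edge_def using assms by (intro measurable_Pair measurable_vertex)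
  then show ?thesis unfolding borel_prod .
qed

lemma space_iid_unif: "space iid_unif = UNIV"
  by (simp add: iid_unif_def space_PiM)

lemma space_unif2: "space unif2 = UNIV"
  by (simp add: space_pair_measure)

lemma prob_space_iid_unif: "prob_space iid_unif"
  unfolding iid_unif_def by (intro prob_space_PiM prob_space_unif01)

locale grapheur =
  fixes E :: "nat \<Rightarrow> nat \<Rightarrow> real" and \<sigma> \<tau> :: "nat \<Rightarrow> real" and \<theta> \<kappa> :: real
  assumes coeffs: "grapheur_coeffs E \<sigma> \<tau> \<theta> \<kappa>"
begin

definition label :: "(nat \<times> nat) measure" where
  "label = density (count_space UNIV) (\<lambda>c. ennreal (label_weight E \<sigma> \<tau> \<theta> \<kappa> (fst c) (snd c)))"

abbreviation \<mu> :: "(nat \<Rightarrow> real) \<Rightarrow> pmeas" where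
  "\<mu> \<equiv> grapheur_real E \<sigma> \<tau> \<theta> \<kappa>"

lemma sets_label [measurable_cong]: "sets label = sets (count_space UNIV)"
  by (simp add: label_def)

text \<open>Splitting off the first two rows and columns of the double series produces the five
  summands of \<open>grapheur_real\<close>.\<close>

lemma nn_integral_label:
  "(\<integral>\<^sup>+c. g c \<partial>label) =
     (\<Sum>i. \<Sum>j. ennreal (E i j) * g (Suc (Suc i), Suc (Suc j))) + (\<Sum>i. ennreal (\<sigma> i) * g (Suc (Suc i), 0))
     + (\<Sum>i. ennreal (\<tau> i) * g (0, Suc (Suc i))) + ennreal \<theta> * g (0, 1) + ennreal \<kappa> * g (0, 0)"
proof -
  let ?w = "\<lambda>a b. ennreal (label_weight E \<sigma> \<tau> \<theta> \<kappa> a b)"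
  have "(\<integral>\<^sup>+c. g c \<partial>label) = (\<integral>\<^sup>+c. ?w (fst c) (snd c) * g c \<partial>count_space UNIV)"
    unfolding label_def by (rule nn_integral_density) auto
  also have "\<dots> = (\<integral>\<^sup>+a. \<integral>\<^sup>+b. ?w a b * g (a, b) \<partial>count_space UNIV \<partial>count_space UNIV)"
    by (subst nn_integral_fst_count_space[symmetric]) simp
  also have "\<dots> = (\<Sum>a. \<Sum>b. ?w a b * g (a, b))"
    by (simp add: nn_integral_count_space_nat)
  also have "\<dots> = (\<Sum>b. ?w 0 b * g (0, b)) + (\<Sum>i. \<Sum>b. ?w (Suc (Suc i)) b * g (Suc (Suc i), b))"
    by (simp add: suminf_ennreal_Suc[of "\<lambda>a. \<Sum>b. ?w a b * g (a, b)"]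
        suminf_ennreal_Suc[of "\<lambda>a. \<Sum>b. ?w (Suc a) b * g (Suc a, b)"])
  also have "(\<Sum>b. ?w 0 b * g (0, b)) = ennreal \<kappa> * g (0, 0) + (ennreal \<theta> * g (0, 1)
      + (\<Sum>i. ennreal (\<tau> i) * g (0, Suc (Suc i))))"
    by (simp add: suminf_ennreal_Suc[of "\<lambda>b. ?w 0 b * g (0, b)"]
        suminf_ennreal_Suc[of "\<lambda>b. ?w 0 (Suc b) * g (0, Suc b)"])
  also have "(\<lambda>i. \<Sum>b. ?w (Suc (Suc i)) b * g (Suc (Suc i), b)) = (\<lambda>i. ennreal (\<sigma> i) * g (Suc (Suc i), 0)
      + (\<Sum>j. ennreal (E i j) * g (Suc (Suc i), Suc (Suc j))))"
    by (rule ext) (simp add: suminf_ennreal_Suc[of "\<lambda>b. ?w (Suc (Suc _)) b * g (Suc (Suc _), b)"]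
        suminf_ennreal_Suc[of "\<lambda>b. ?w (Suc (Suc _)) (Suc b) * g (Suc (Suc _), Suc b)"])
  also have "(\<Sum>i. ennreal (\<sigma> i) * g (Suc (Suc i), 0) + (\<Sum>j. ennreal (E i j) * g (Suc (Suc i), Suc (Suc j))))
      = (\<Sum>i. ennreal (\<sigma> i) * g (Suc (Suc i), 0)) + (\<Sum>i. \<Sum>j. ennreal (E i j) * g (Suc (Suc i), Suc (Suc j)))"
    by (rule suminf_add[symmetric]) (auto intro: summableI)
  finally show ?thesis by (simp add: add_ac)
qed

lemma prob_space_label: "prob_space label"
proof
  obtain e s t where nn: "\<And>i j. 0 \<le> E i j" "\<And>i. 0 \<le> \<sigma> i" "\<And>i. 0 \<le> \<tau> i" "0 \<le> \<theta>" "0 \<le> \<kappa>"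
    and e: "((\<lambda>(i, j). E i j) has_sum e) UNIV" and s: "(\<sigma> has_sum s) UNIV" and t: "(\<tau> has_sum t) UNIV"
    and sum: "e + s + t + \<theta> + \<kappa> = 1"
    using coeffs unfolding grapheur_coeffs_def by blast
  have ge: "0 \<le> e" "0 \<le> s" "0 \<le> t"
    using has_sum_nonneg[OF e] has_sum_nonneg[OF s] has_sum_nonneg[OF t] nn by auto
  \<comment> \<open>The normalisation is stated with an unordered sum over pairs; the row sums turn
    it into the iterated series that occurs in \<open>nn_integral_label\<close>.\<close>
  define r where "r i = (\<Sum>\<^sub>\<infinity>j. E i j)" for i
  have e': "((\<lambda>(i, j). E i j) has_sum e) (SIGMA i:UNIV. UNIV)" using e by (simp only: UNIV_Times_UNIV)
  have row: "(E i has_sum r i) UNIV" for i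
    unfolding r_def by (rule has_sum_infsum[OF summable_on_SigmaD1[OF has_sum_imp_summable[OF e'] UNIV_I]])
  have "(r has_sum e) UNIV" by (rule has_sum_SigmaD[OF e']) (use row in simp)
  then have "(\<Sum>i. ennreal (r i)) = ennreal e"
    using has_sum_nonneg[OF row] nn by (intro suminf_ennreal_eq has_sum_imp_sums) auto
  moreover have "(\<Sum>j. ennreal (E i j)) = ennreal (r i)" for i
    using nn row by (intro suminf_ennreal_eq has_sum_imp_sums) auto
  moreover have "(\<Sum>i. ennreal (\<sigma> i)) = ennreal s" "(\<Sum>i. ennreal (\<tau> i)) = ennreal t"
    using nn s t by (auto intro!: suminf_ennreal_eq has_sum_imp_sums)
  ultimately have "(\<integral>\<^sup>+c. 1 \<partial>label) = ennreal e + ennreal s + ennreal t + ennreal \<theta> + ennreal \<kappa>"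
    unfolding nn_integral_label by simp
  also have "\<dots> = 1" using ge nn sum by (simp add: ennreal_plus[symmetric] del: ennreal_plus)
  finally show "emeasure label (space label) = 1" by simp
qed

text \<open>The grapheur is a mixture over labels of the laws of single edges. Besides giving the
  sampling scheme, this shows that the formula in \<open>grapheur_real\<close> defines a probability
  measure.\<close>

lemma grapheur_real_eq_distr:
  "\<mu> T = distr (label \<Otimes>\<^sub>M unif2) borel (\<lambda>(c, w). edge T w c)"
  unfolding grapheur_real_def
proof (rule measure_of_borel_eqI)
  fix A :: "(real \<times> real) set" assume A: "A \<in> sets borel"
  interpret unif2: prob_space unif2 by (rule prob_space_unif2)
  interpret unif01: prob_space unif01 by (rule prob_space_unif01)
  have cT: "(\<lambda>x. T) \<in> M \<rightarrow>\<^sub>M iid_unif" for M :: "'m measure"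
    by (rule measurable_const) (simp add: space_iid_unif)
  have em: "(\<lambda>(c, w). edge T w c) \<in> label \<Otimes>\<^sub>M unif2 \<rightarrow>\<^sub>M borel"
    unfolding case_prod_beta'
    using measurable_fst[of label unif2] measurable_cong_sets[OF refl sets_label]
    by (intro measurable_edge cT) auto
  have em1: "(\<lambda>w. edge T w c) \<in> borel_measurable unif2" for c
    by (intro measurable_edge cT) auto
  define g where "g c = emeasure unif2 {w. edge T w c \<in> A}" for c
  have "emeasure (distr (label \<Otimes>\<^sub>M unif2) borel (\<lambda>(c, w). edge T w c)) A
      = (\<integral>\<^sup>+p. indicator A (case p of (c, w) \<Rightarrow> edge T w c) \<partial>(label \<Otimes>\<^sub>M unif2))"
    using A by (subst nn_integral_distr[symmetric, OF em]) auto
  also have "\<dots> = (\<integral>\<^sup>+c. \<integral>\<^sup>+w. indicator A (edge T w c) \<partial>unif2 \<partial>label)"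
    using A em by (subst unif2.nn_integral_fst[symmetric]) (auto intro: measurable_compose)
  also have "\<dots> = (\<integral>\<^sup>+c. g c \<partial>label)"
  proof (intro nn_integral_cong)
    fix c
    have "{w. edge T w c \<in> A} \<in> sets unif2"
      using measurable_sets[OF em1 A] by (simp add: vimage_def space_unif2)
    then have "(\<integral>\<^sup>+w. indicator {w. edge T w c \<in> A} w \<partial>unif2) = g c" by (simp add: g_def)
    then show "(\<integral>\<^sup>+w. indicator A (edge T w c) \<partial>unif2) = g c" by (simp add: indicator_def)
  qed
  finally have dist: "emeasure (distr (label \<Otimes>\<^sub>M unif2) borel (\<lambda>(c, w). edge T w c)) A = (\<integral>\<^sup>+c. g c \<partial>label)" .
  \<comment> \<open>Hereafter each label is evaluated separately. Diagonal labels and labels with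
    one fresh point read only the first coordinate of \<open>w\<close>, which reduces them to
    Lebesgue measure on the line through \<open>line\<close>.\<close>
  have [measurable]: "A \<in> sets (borel \<Otimes>\<^sub>M borel)" unfolding borel_prod by (rule A)
  have line: "emeasure unif2 {w. P (fst w)} = emeasure lborel {x\<in>{0..1}. P x}"
    if P: "Measurable.pred borel P" for P
  proof -
    have "{w. P (fst w)} = {x. P x} \<times> (UNIV :: real set)" by auto
    then have "emeasure unif2 {w. P (fst w)} = emeasure unif01 {x. P x}"
      using P unif01.emeasure_space_1 by (simp add: unif01.emeasure_pair_measure_Times pred_def)
    then show ?thesis using emeasure_unif01_Collect[OF P] by simp
  qed
  have "g (0, 0) = emeasure lborel {t\<in>{0..1}. (t, t) \<in> A}"
    using line[of "\<lambda>x. (x, x) \<in> A"] by (simp add: g_def edge_def)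
  moreover have "g (0, 1) = emeasure lborel (A \<inter> ({0..1} \<times> {0..1}))"
    using emeasure_unif2[OF A] by (simp add: g_def edge_def)
  moreover have "g (0, Suc (Suc i)) = emeasure lborel {x\<in>{0..1}. (x, T i) \<in> A}" for i
    using line[of "\<lambda>x. (x, T i) \<in> A"] by (simp add: g_def edge_def)
  moreover have "g (Suc (Suc i), 0) = emeasure lborel {y\<in>{0..1}. (T i, y) \<in> A}" for i
    using line[of "\<lambda>y. (T i, y) \<in> A"] by (simp add: g_def edge_def)
  moreover have "g (Suc (Suc i), Suc (Suc j)) = indicator A (T i, T j)" for i j
    using unif2.emeasure_space_1 by (simp add: g_def edge_def space_unif2 indicator_def)
  ultimately show "(\<Sum>i. \<Sum>j. ennreal (E i j) * indicator A (T i, T j))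
        + (\<Sum>i. ennreal (\<sigma> i) * emeasure lborel {y\<in>{0..1}. (T i, y) \<in> A})
        + (\<Sum>i. ennreal (\<tau> i) * emeasure lborel {x\<in>{0..1}. (x, T i) \<in> A})
        + ennreal \<theta> * emeasure lborel (A \<inter> ({0..1} \<times> {0..1}))
        + ennreal \<kappa> * emeasure lborel {t\<in>{0..1}. (t, t) \<in> A}
      = emeasure (distr (label \<Otimes>\<^sub>M unif2) borel (\<lambda>(c, w). edge T w c)) A"
    unfolding dist nn_integral_label by simp
qed simp

end

section \<open>Drawing labels before positions\<close>

definition sample :: "nat \<Rightarrow> (nat \<Rightarrow> real) \<Rightarrow> (nat \<Rightarrow> real \<times> real) \<Rightarrow> (nat \<Rightarrow> nat \<times> nat) \<Rightarrow> nat \<Rightarrow> real \<times> real" where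
  "sample n T \<omega> c = (\<lambda>l\<in>{..<n}. edge T (\<omega> l) (c l))"

abbreviation unifs :: "nat \<Rightarrow> (nat \<Rightarrow> real \<times> real) measure" where
  "unifs n \<equiv> \<Pi>\<^sub>M l\<in>{..<n}. unif2"

abbreviation sample_space :: "nat \<Rightarrow> (nat \<Rightarrow> real \<times> real) measure" where
  "sample_space n \<equiv> \<Pi>\<^sub>M l\<in>{..<n}. borel"

lemma prob_space_unifs: "prob_space (unifs n)"
  by (intro prob_space_PiM prob_space_unif2)

lemma indicator_PiE_restrict:
  "finite I \<Longrightarrow> indicator (Pi\<^sub>E I A) (\<lambda>l\<in>I. x l) = (\<Prod>l\<in>I. indicator (A l) (x l) :: ennreal)"
  by (auto simp: indicator_def PiE_iff prod_zero_iff)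

context grapheur
begin

abbreviation labels :: "nat \<Rightarrow> (nat \<Rightarrow> nat \<times> nat) measure" where
  "labels n \<equiv> \<Pi>\<^sub>M l\<in>{..<n}. label"

lemma prob_space_labels: "prob_space (labels n)"
  by (intro prob_space_PiM prob_space_label)

lemma measurable_sample:
  assumes T: "T \<in> M \<rightarrow>\<^sub>M iid_unif" and \<omega>: "\<omega> \<in> M \<rightarrow>\<^sub>M unifs n" and c: "c \<in> M \<rightarrow>\<^sub>M labels n"
  shows "(\<lambda>x. sample n (T x) (\<omega> x) (c x)) \<in> M \<rightarrow>\<^sub>M sample_space n"
  unfolding sample_def
proof (rule measurable_restrict)
  fix l assume l: "l \<in> {..<n}"
  have "(\<lambda>x. c x l) \<in> M \<rightarrow>\<^sub>M label"
    by (rule measurable_compose[OF c measurable_component_singleton[OF l]])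
  then have "(\<lambda>x. c x l) \<in> M \<rightarrow>\<^sub>M count_space UNIV"
    using measurable_cong_sets[OF refl sets_label] by blast
  then show "(\<lambda>x. edge (T x) (\<omega> x l) (c x l)) \<in> M \<rightarrow>\<^sub>M borel"
    by (intro measurable_edge T measurable_compose[OF \<omega> measurable_component_singleton[OF l]])
qed

lemma measurable_const_iid_unif: "(\<lambda>x. T) \<in> M \<rightarrow>\<^sub>M iid_unif"
  by (rule measurable_const) (simp add: space_iid_unif)

lemma measurable_edge_label: "(\<lambda>(c, w). edge T w c) \<in> label \<Otimes>\<^sub>M unif2 \<rightarrow>\<^sub>M borel"
  unfolding case_prod_beta'
  using measurable_fst[of label unif2] measurable_cong_sets[OF refl sets_label]
  by (intro measurable_edge measurable_const_iid_unif) auto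

lemma prob_space_label_unif2: "prob_space (label \<Otimes>\<^sub>M unif2)"
  by (intro prob_space_pair prob_space_label prob_space_unif2)

lemma prob_space_mu: "prob_space (\<mu> T)"
  unfolding grapheur_real_eq_distr
  by (rule prob_space.prob_space_distr[OF prob_space_label_unif2 measurable_edge_label])

lemma sets_mu: "sets (\<mu> T) = sets borel"
  unfolding grapheur_real_eq_distr by simp

lemma sets_PiM_mu: "sets (\<Pi>\<^sub>M l\<in>{..<n}. \<mu> T) = sets (sample_space n)"
  by (intro sets_PiM_cong refl sets_mu)

lemma nn_integral_mu:
  assumes "f \<in> borel_measurable borel"
  shows "(\<integral>\<^sup>+z. f z \<partial>\<mu> T) = (\<integral>\<^sup>+c. \<integral>\<^sup>+w. f (edge T w c) \<partial>unif2 \<partial>label)"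
proof -
  interpret unif2: prob_space unif2 by (rule prob_space_unif2)
  have "(\<integral>\<^sup>+z. f z \<partial>\<mu> T) = (\<integral>\<^sup>+p. f (case p of (c, w) \<Rightarrow> edge T w c) \<partial>(label \<Otimes>\<^sub>M unif2))"
    unfolding grapheur_real_eq_distr by (rule nn_integral_distr[OF measurable_edge_label]) (simp add: assms)
  also have "\<dots> = (\<integral>\<^sup>+c. \<integral>\<^sup>+w. f (case (c, w) of (c, w) \<Rightarrow> edge T w c) \<partial>unif2 \<partial>label)"
    by (rule unif2.nn_integral_fst[symmetric, OF measurable_compose[OF measurable_edge_label assms]])
  finally show ?thesis by simp
qed

text \<open>Given the atoms, a product of mixtures is a mixture of products. Both sides are compared
  on boxes, where the integral over labels and fresh points factors edge by edge.\<close>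

lemma PiM_mu_eq_distr:
  "(\<Pi>\<^sub>M l\<in>{..<n}. \<mu> T) = distr (labels n \<Otimes>\<^sub>M unifs n) (sample_space n) (\<lambda>(c, \<omega>). sample n T \<omega> c)"
proof (rule sym)
  interpret mu: prob_space "\<mu> T" by (rule prob_space_mu)
  interpret label: prob_space label by (rule prob_space_label)
  interpret unif2: prob_space unif2 by (rule prob_space_unif2)
  interpret unifs: prob_space "unifs n" by (rule prob_space_unifs)
  interpret Pmu: product_sigma_finite "\<lambda>_::nat. \<mu> T" by unfold_locales
  interpret Plabel: product_sigma_finite "\<lambda>_::nat. label" by unfold_locales
  interpret Punif2: product_sigma_finite "\<lambda>_::nat. unif2" by unfold_locales
  have sm: "(\<lambda>(c, \<omega>). sample n T \<omega> c) \<in> labels n \<Otimes>\<^sub>M unifs n \<rightarrow>\<^sub>M sample_space n"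
    unfolding case_prod_beta' by (intro measurable_sample measurable_const_iid_unif measurable_fst measurable_snd)
  show "distr (labels n \<Otimes>\<^sub>M unifs n) (sample_space n) (\<lambda>(c, \<omega>). sample n T \<omega> c) = (\<Pi>\<^sub>M l\<in>{..<n}. \<mu> T)"
  proof (rule Pmu.PiM_eqI)
    show "sets (distr (labels n \<Otimes>\<^sub>M unifs n) (sample_space n) (\<lambda>(c, \<omega>). sample n T \<omega> c)) = sets (\<Pi>\<^sub>M l\<in>{..<n}. \<mu> T)"
      by (simp add: sets_PiM_mu)
    fix A assume "\<And>l. l \<in> {..<n} \<Longrightarrow> A l \<in> sets (\<mu> T)"
    then have A: "A l \<in> sets borel" if "l < n" for l using that by (simp add: sets_mu)
    have PA: "Pi\<^sub>E {..<n} A \<in> sets (sample_space n)" using A by (intro sets_PiM_I_finite) auto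
    let ?h = "\<lambda>l c w. indicator (A l) (edge T w c) :: ennreal"
    have em1: "(\<lambda>w. edge T w c) \<in> borel_measurable unif2" for c
      by (intro measurable_edge measurable_const_iid_unif) auto
    have hm: "?h l c \<in> borel_measurable unif2" if "l < n" for l c
      using A[OF that] by (intro measurable_compose[OF em1]) simp
    have "emeasure (distr (labels n \<Otimes>\<^sub>M unifs n) (sample_space n) (\<lambda>(c, \<omega>). sample n T \<omega> c)) (Pi\<^sub>E {..<n} A)
        = (\<integral>\<^sup>+p. indicator (Pi\<^sub>E {..<n} A) (case p of (c, \<omega>) \<Rightarrow> sample n T \<omega> c) \<partial>(labels n \<Otimes>\<^sub>M unifs n))"
      using PA by (subst nn_integral_distr[symmetric, OF sm]) auto
    also have "\<dots> = (\<integral>\<^sup>+c. \<integral>\<^sup>+\<omega>. indicator (Pi\<^sub>E {..<n} A) (case (c, \<omega>) of (c, \<omega>) \<Rightarrow> sample n T \<omega> c) \<partial>unifs n \<partial>labels n)"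
      using PA by (intro unifs.nn_integral_fst[symmetric] measurable_compose[OF sm]) simp
    also have "\<dots> = (\<integral>\<^sup>+c. \<integral>\<^sup>+\<omega>. (\<Prod>l<n. ?h l (c l) (\<omega> l)) \<partial>unifs n \<partial>labels n)"
      by (simp add: sample_def indicator_PiE_restrict)
    also have "\<dots> = (\<integral>\<^sup>+c. (\<Prod>l<n. \<integral>\<^sup>+w. ?h l (c l) w \<partial>unif2) \<partial>labels n)"
      using hm by (intro nn_integral_cong Punif2.product_nn_integral_prod) auto
    also have "\<dots> = (\<Prod>l<n. \<integral>\<^sup>+c. \<integral>\<^sup>+w. ?h l c w \<partial>unif2 \<partial>label)"
      by (rule Plabel.product_nn_integral_prod) (auto simp: label_def)
    also have "\<dots> = (\<Prod>l<n. emeasure (\<mu> T) (A l))"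
      using A by (intro prod.cong refl, subst nn_integral_mu[symmetric]) (auto simp: sets_mu)
    finally show "emeasure (distr (labels n \<Otimes>\<^sub>M unifs n) (sample_space n) (\<lambda>(c, \<omega>). sample n T \<omega> c)) (Pi\<^sub>E {..<n} A)
        = (\<Prod>l<n. emeasure (\<mu> T) (A l))" .
  qed simp
qed

lemma nn_integral_PiM_mu:
  assumes "f \<in> borel_measurable (sample_space n)"
  shows "(\<integral>\<^sup>+z. f z \<partial>(\<Pi>\<^sub>M l\<in>{..<n}. \<mu> T)) = (\<integral>\<^sup>+c. \<integral>\<^sup>+\<omega>. f (sample n T \<omega> c) \<partial>unifs n \<partial>labels n)"
proof -
  interpret unifs: prob_space "unifs n" by (rule prob_space_unifs)
  have sm: "(\<lambda>(c, \<omega>). sample n T \<omega> c) \<in> labels n \<Otimes>\<^sub>M unifs n \<rightarrow>\<^sub>M sample_space n"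
    unfolding case_prod_beta' by (intro measurable_sample measurable_const_iid_unif measurable_fst measurable_snd)
  have "(\<integral>\<^sup>+z. f z \<partial>(\<Pi>\<^sub>M l\<in>{..<n}. \<mu> T)) = (\<integral>\<^sup>+p. f (case p of (c, \<omega>) \<Rightarrow> sample n T \<omega> c) \<partial>(labels n \<Otimes>\<^sub>M unifs n))"
    unfolding PiM_mu_eq_distr by (rule nn_integral_distr[OF sm]) (simp add: assms)
  also have "\<dots> = (\<integral>\<^sup>+c. \<integral>\<^sup>+\<omega>. f (case (c, \<omega>) of (c, \<omega>) \<Rightarrow> sample n T \<omega> c) \<partial>unifs n \<partial>labels n)"
    by (rule unifs.nn_integral_fst[symmetric, OF measurable_compose[OF sm assms]])
  finally show ?thesis by simp
qed

lemma measurable_mu: "\<mu> \<in> iid_unif \<rightarrow>\<^sub>M prob_algebra borel"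
proof -
  have "(\<lambda>T. distr (label \<Otimes>\<^sub>M unif2) borel (\<lambda>(c, w). edge T w c)) \<in> iid_unif \<rightarrow>\<^sub>M prob_algebra borel"
  proof (rule measurable_distr_prob_space2)
    show "(\<lambda>T. label \<Otimes>\<^sub>M unif2) \<in> iid_unif \<rightarrow>\<^sub>M prob_algebra (label \<Otimes>\<^sub>M unif2)"
      by (rule measurable_const) (simp add: space_prob_algebra prob_space_label_unif2)
    have "(\<lambda>p. fst (snd p)) \<in> iid_unif \<Otimes>\<^sub>M (label \<Otimes>\<^sub>M unif2) \<rightarrow>\<^sub>M label" by measurable
    then have "(\<lambda>p. fst (snd p)) \<in> iid_unif \<Otimes>\<^sub>M (label \<Otimes>\<^sub>M unif2) \<rightarrow>\<^sub>M count_space UNIV"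
      using measurable_cong_sets[OF refl sets_label] by blast
    then show "(\<lambda>(T, c, w). edge T w c) \<in> iid_unif \<Otimes>\<^sub>M (label \<Otimes>\<^sub>M unif2) \<rightarrow>\<^sub>M borel"
      unfolding case_prod_beta' by (intro measurable_edge) measurable
  qed
  then show ?thesis using grapheur_real_eq_distr by (simp cong: measurable_cong)
qed

lemma measurable_PiM_mu: "(\<lambda>T. \<Pi>\<^sub>M l\<in>{..<n}. \<mu> T) \<in> iid_unif \<rightarrow>\<^sub>M prob_algebra (sample_space n)"
  unfolding PiM_mu_eq_distr
proof (rule measurable_distr_prob_space2)
  show "(\<lambda>T. labels n \<Otimes>\<^sub>M unifs n) \<in> iid_unif \<rightarrow>\<^sub>M prob_algebra (labels n \<Otimes>\<^sub>M unifs n)"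
    by (rule measurable_const) (simp add: space_prob_algebra prob_space_pair prob_space_labels prob_space_unifs)
  show "(\<lambda>(T, c, \<omega>). sample n T \<omega> c) \<in> iid_unif \<Otimes>\<^sub>M (labels n \<Otimes>\<^sub>M unifs n) \<rightarrow>\<^sub>M sample_space n"
    unfolding case_prod_beta' by (intro measurable_sample) measurable
qed

lemma nn_integral_edge_sample:
  assumes "f \<in> borel_measurable (sample_space n)"
  shows "(\<integral>\<^sup>+z. f z \<partial>edge_sample E \<sigma> \<tau> \<theta> \<kappa> n) = (\<integral>\<^sup>+T. \<integral>\<^sup>+z. f z \<partial>(\<Pi>\<^sub>M l\<in>{..<n}. \<mu> T) \<partial>iid_unif)"
  unfolding edge_sample_def
  by (rule nn_integral_bind[OF assms measurable_prob_algebraD[OF measurable_PiM_mu]])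

lemma sets_edge_sample: "sets (edge_sample E \<sigma> \<tau> \<theta> \<kappa> n) = sets (sample_space n)"
  unfolding edge_sample_def
  by (rule sets_bind) (auto simp: sets_PiM_mu space_iid_unif)

text \<open>The law of the labels does not depend on the atoms, so the labels can be drawn
  outermost. The integrand may depend on \<open>T\<close> as well as on the sample, as the
  discrepancy from \<open>\<mu> T\<close> does.\<close>

lemma nn_integral_sample_Fubini:
  assumes f: "f \<in> borel_measurable (iid_unif \<Otimes>\<^sub>M sample_space n)"
  shows "(\<integral>\<^sup>+T. \<integral>\<^sup>+z. f (T, z) \<partial>(\<Pi>\<^sub>M l\<in>{..<n}. \<mu> T) \<partial>iid_unif)
       = (\<integral>\<^sup>+c. \<integral>\<^sup>+(T, \<omega>). f (T, sample n T \<omega> c) \<partial>(iid_unif \<Otimes>\<^sub>M unifs n) \<partial>labels n)"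
proof -
  interpret iid: prob_space iid_unif by (rule prob_space_iid_unif)
  interpret unifs: prob_space "unifs n" by (rule prob_space_unifs)
  interpret labels: prob_space "labels n" by (rule prob_space_labels)
  interpret pair_sigma_finite "labels n" iid_unif ..
  have f1: "(\<lambda>z. f (T, z)) \<in> borel_measurable (sample_space n)" for T
    by (rule measurable_compose[OF measurable_Pair1' f]) (simp add: space_iid_unif)
  have g: "(\<lambda>x. f (T x, sample n (T x) (\<omega> x) (c x))) \<in> borel_measurable M"
    if "T \<in> M \<rightarrow>\<^sub>M iid_unif" "\<omega> \<in> M \<rightarrow>\<^sub>M unifs n" "c \<in> M \<rightarrow>\<^sub>M labels n"
    for M :: "'x measure" and T \<omega> c
    by (intro measurable_compose[OF measurable_Pair[OF that(1) measurable_sample[OF that]] f])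
  have "(\<integral>\<^sup>+T. \<integral>\<^sup>+z. f (T, z) \<partial>(\<Pi>\<^sub>M l\<in>{..<n}. \<mu> T) \<partial>iid_unif)
      = (\<integral>\<^sup>+T. \<integral>\<^sup>+c. \<integral>\<^sup>+\<omega>. f (T, sample n T \<omega> c) \<partial>unifs n \<partial>labels n \<partial>iid_unif)"
    by (intro nn_integral_cong nn_integral_PiM_mu f1)
  also have "\<dots> = (\<integral>\<^sup>+c. \<integral>\<^sup>+T. \<integral>\<^sup>+\<omega>. f (T, sample n T \<omega> c) \<partial>unifs n \<partial>iid_unif \<partial>labels n)"
  proof (rule Fubini')
    have "(\<lambda>p. \<integral>\<^sup>+\<omega>. f (snd p, sample n (snd p) \<omega> (fst p)) \<partial>unifs n) \<in> borel_measurable (labels n \<Otimes>\<^sub>M iid_unif)"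
      by (rule unifs.borel_measurable_nn_integral, unfold case_prod_beta', rule g) measurable
    then show "(\<lambda>(c, T). \<integral>\<^sup>+\<omega>. f (T, sample n T \<omega> c) \<partial>unifs n) \<in> borel_measurable (labels n \<Otimes>\<^sub>M iid_unif)"
      by (simp add: case_prod_beta')
  qed
  also have "\<dots> = (\<integral>\<^sup>+c. \<integral>\<^sup>+(T, \<omega>). f (T, sample n T \<omega> c) \<partial>(iid_unif \<Otimes>\<^sub>M unifs n) \<partial>labels n)"
  proof (intro nn_integral_cong)
    fix c assume c: "c \<in> space (labels n)"
    have "(\<lambda>p. f (fst p, sample n (fst p) (snd p) c)) \<in> borel_measurable (iid_unif \<Otimes>\<^sub>M unifs n)"
      by (rule g) (use c in auto)
    then show "(\<integral>\<^sup>+T. \<integral>\<^sup>+\<omega>. f (T, sample n T \<omega> c) \<partial>unifs n \<partial>iid_unif)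
        = (\<integral>\<^sup>+(T, \<omega>). f (T, sample n T \<omega> c) \<partial>(iid_unif \<Otimes>\<^sub>M unifs n))"
      by (subst unifs.nn_integral_fst[symmetric]) (auto simp: case_prod_beta')
  qed
  finally show ?thesis .
qed

end

section \<open>Coupling for fixed labels\<close>

text \<open>\<open>Inl i\<close> denotes the atom \<open>T i\<close>, and \<open>Inr (l, b)\<close> one of the two fresh points of edge \<open>l\<close>.\<close>

fun site :: "(nat \<Rightarrow> real) \<Rightarrow> (nat \<Rightarrow> real \<times> real) \<Rightarrow> nat + nat \<times> bool \<Rightarrow> real" where
  "site T \<omega> (Inl i) = T i"
| "site T \<omega> (Inr (l, b)) = (if b then snd (\<omega> l) else fst (\<omega> l))"

fun vertex_site :: "nat \<Rightarrow> nat \<Rightarrow> nat + nat \<times> bool" where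
  "vertex_site l 0 = Inr (l, False)"
| "vertex_site l (Suc 0) = Inr (l, True)"
| "vertex_site l (Suc (Suc i)) = Inl i"

definition site_edges :: "(nat \<Rightarrow> nat \<times> nat) \<Rightarrow> nat \<Rightarrow> (nat + nat \<times> bool) \<times> (nat + nat \<times> bool)" where
  "site_edges c l = (vertex_site l (fst (c l)), vertex_site l (snd (c l)))"

lemma vertex_eq_site: "vertex T (\<omega> l) a = site T \<omega> (vertex_site l a)"
  by (cases "(l, a)" rule: vertex_site.cases) auto

lemma sample_eq_site: "l < n \<Longrightarrow> sample n T \<omega> c l = map_prod (site T \<omega>) (site T \<omega>) (site_edges c l)"
  by (simp add: sample_def edge_def site_edges_def vertex_eq_site)

lemma Inr_in_vertex_list:
  assumes "Inr (k, b) \<in> set (vertex_list n (site_edges c))"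
  shows "k < n"
proof -
  have "vertex_site l a = Inr (k, b) \<Longrightarrow> l = k" for l a by (cases "(l, a)" rule: vertex_site.cases) auto
  then show ?thesis using assms by (fastforce simp: set_vertex_list site_edges_def)
qed

lemma measurable_site:
  assumes "\<And>l b. v = Inr (l, b) \<Longrightarrow> l < n"
  shows "(\<lambda>p. site (fst p) (snd p) v) \<in> borel_measurable (iid_unif \<Otimes>\<^sub>M unifs n)"
proof (cases v)
  case (Inl i)
  have "(\<lambda>p. fst p i) \<in> iid_unif \<Otimes>\<^sub>M unifs n \<rightarrow>\<^sub>M unif01"
    unfolding iid_unif_def by measurable
  then show ?thesis using Inl measurable_cong_sets[OF refl sets_unif01] by (auto simp: site.simps)
next
  case (Inr q)
  obtain l b where q: "q = (l, b)" by (cases q)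
  have l: "l \<in> {..<n}" using assms Inr q by auto
  have "(\<lambda>p. snd p l) \<in> iid_unif \<Otimes>\<^sub>M unifs n \<rightarrow>\<^sub>M unif2"
    by (rule measurable_compose[OF measurable_snd measurable_component_singleton[OF l]])
  then have "(\<lambda>p. fst (snd p l)) \<in> iid_unif \<Otimes>\<^sub>M unifs n \<rightarrow>\<^sub>M unif01"
    "(\<lambda>p. snd (snd p l)) \<in> iid_unif \<Otimes>\<^sub>M unifs n \<rightarrow>\<^sub>M unif01" by measurable
  then have "(\<lambda>p. fst (snd p l)) \<in> borel_measurable (iid_unif \<Otimes>\<^sub>M unifs n)"
    "(\<lambda>p. snd (snd p l)) \<in> borel_measurable (iid_unif \<Otimes>\<^sub>M unifs n)"
    using measurable_cong_sets[OF refl sets_unif01] by auto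
  then show ?thesis using Inr q by (cases b) auto
qed

lemma measurable_sites:
  assumes "\<And>l b. Inr (l, b) \<in> set vs \<Longrightarrow> l < n"
  shows "(\<lambda>p. \<lambda>i\<in>{..<length vs}. site (fst p) (snd p) (vs ! i))
           \<in> iid_unif \<Otimes>\<^sub>M unifs n \<rightarrow>\<^sub>M (\<Pi>\<^sub>M i\<in>{..<length vs}. unif01)"
proof (rule measurable_restrict)
  fix i assume "i \<in> {..<length vs}"
  then have "vs ! i \<in> set vs" by simp
  then have "(\<lambda>p. site (fst p) (snd p) (vs ! i)) \<in> borel_measurable (iid_unif \<Otimes>\<^sub>M unifs n)"
    using assms by (intro measurable_site) metis
  then show "(\<lambda>p. site (fst p) (snd p) (vs ! i)) \<in> iid_unif \<Otimes>\<^sub>M unifs n \<rightarrow>\<^sub>M unif01"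
    using measurable_cong_sets[OF refl sets_unif01] by blast
qed

text \<open>Distinct sites read distinct coordinates of the base space, and these are independent
  and uniform. This is what gives the vertices of the sampled graph fresh uniform positions once the
  labels are fixed.\<close>

lemma distr_sites:
  assumes vs: "distinct vs" "\<And>l b. Inr (l, b) \<in> set vs \<Longrightarrow> l < n"
  shows "distr (iid_unif \<Otimes>\<^sub>M unifs n) (\<Pi>\<^sub>M i\<in>{..<length vs}. unif01)
           (\<lambda>p. \<lambda>i\<in>{..<length vs}. site (fst p) (snd p) (vs ! i)) = (\<Pi>\<^sub>M i\<in>{..<length vs}. unif01)"
proof -
  interpret unif01: prob_space unif01 by (rule prob_space_unif01)
  interpret unif2: prob_space unif2 by (rule prob_space_unif2)
  interpret unifs: prob_space "unifs n" by (rule prob_space_unifs)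
  interpret P: product_sigma_finite "\<lambda>_::nat. unif01" by unfold_locales
  interpret P2: product_sigma_finite "\<lambda>_::nat. unif2" by unfold_locales
  let ?m = "length vs" and ?N = "iid_unif \<Otimes>\<^sub>M unifs n"
  let ?X = "\<lambda>p. \<lambda>i\<in>{..<?m}. site (fst p) (snd p) (vs ! i)"
  show ?thesis
  proof (rule P.PiM_eqI)
    fix A assume "\<And>i. i \<in> {..<?m} \<Longrightarrow> A i \<in> sets unif01"
    then have A: "A i \<in> sets borel" if "i < ?m" for i using that by simp
    have inj: "inj_on (\<lambda>i. vs ! i) {..<?m}" using vs(1) by (auto simp: inj_on_def nth_eq_iff_index_eq)
    \<comment> \<open>The box is extended by \<open>UNIV\<close> to sites outside \<open>vs\<close>,
      so that its preimage is a rectangle \<open>BT \<times> B\<omega>\<close> and the extra factors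
      are 1.\<close>
    define A' where "A' v = (if v \<in> set vs then A (the_inv_into {..<?m} (\<lambda>i. vs ! i) v) else UNIV)" for v
    have A'_nth: "A' (vs ! i) = A i" if "i < ?m" for i
      using that inj by (simp add: A'_def the_inv_into_f_f)
    have A'_sets: "A' v \<in> sets borel" for v
      by (metis A A'_nth A'_def in_set_conv_nth sets.top space_borel)
    have A'_out: "A' v = UNIV" if "v \<notin> set vs" for v using that by (simp add: A'_def)
    define K where "K = {k. Inl k \<in> set vs}"
    have K: "finite K"
      using finite_vimageI[of "set vs" Inl] by (simp add: K_def vimage_def)
    define BT where "BT = prod_emb UNIV (\<lambda>_. unif01) K (\<Pi>\<^sub>E k\<in>K. A' (Inl k))"
    define B\<omega> where "B\<omega> = (\<Pi>\<^sub>E l\<in>{..<n}. A' (Inr (l, False)) \<times> A' (Inr (l, True)))"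
    have BT: "BT = {T. \<forall>k\<in>K. T k \<in> A' (Inl k)}"
      by (auto simp: BT_def prod_emb_def restrict_PiE_iff)
    have BTs: "BT \<in> sets iid_unif"
      unfolding BT_def iid_unif_def using K A'_sets by (intro sets_PiM_I) auto
    have Bs: "A' (Inr (l, False)) \<times> A' (Inr (l, True)) \<in> sets unif2" for l
      using A'_sets by (intro pair_measureI) auto
    have B\<omega>s: "B\<omega> \<in> sets (unifs n)"
      unfolding B\<omega>_def using Bs by (intro sets_PiM_I_finite) auto
    have "site T \<omega> v \<in> A' v" if T: "T \<in> BT" and \<omega>: "\<omega> \<in> B\<omega>" and v: "v \<in> set vs" for T \<omega> v
    proof (cases v)
      case (Inl k)
      then show ?thesis using T v by (auto simp: BT K_def)
    next
      case (Inr q)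
      obtain l b where q: "q = (l, b)" by (cases q)
      then have "l < n" using vs(2) v Inr by auto
      then have "\<omega> l \<in> A' (Inr (l, False)) \<times> A' (Inr (l, True))" using \<omega> by (auto simp: B\<omega>_def)
      then show ?thesis using Inr q by (cases b) auto
    qed
    moreover have "T \<in> BT \<and> \<omega> \<in> B\<omega>"
      if "\<omega> \<in> space (unifs n)" and s: "\<forall>v\<in>set vs. site T \<omega> v \<in> A' v" for T \<omega>
    proof
      show "T \<in> BT" using s by (force simp: BT K_def)
      have "\<omega> l \<in> A' (Inr (l, False)) \<times> A' (Inr (l, True))" for l
        using s A'_out[of "Inr (l, False)"] A'_out[of "Inr (l, True)"]
          bspec[OF s, of "Inr (l, False)"] bspec[OF s, of "Inr (l, True)"]
        by (cases "Inr (l, False) \<in> set vs"; cases "Inr (l, True) \<in> set vs") (auto simp: mem_Times_iff)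
      then show "\<omega> \<in> B\<omega>" using that(1) by (auto simp: B\<omega>_def space_PiM PiE_iff)
    qed
    moreover have "?X (T, \<omega>) \<in> Pi\<^sub>E {..<?m} A \<longleftrightarrow> (\<forall>v\<in>set vs. site T \<omega> v \<in> A' v)" for T \<omega>
      using A'_nth by (auto simp: PiE_iff all_set_conv_all_nth)
    moreover have "B\<omega> \<subseteq> space (unifs n)" using sets.sets_into_space[OF B\<omega>s] .
    ultimately have pre: "?X -` Pi\<^sub>E {..<?m} A \<inter> space ?N = BT \<times> B\<omega>"
      by (fastforce simp: space_pair_measure space_iid_unif)
    have "emeasure (distr ?N (\<Pi>\<^sub>M i\<in>{..<?m}. unif01) ?X) (Pi\<^sub>E {..<?m} A) = emeasure ?N (BT \<times> B\<omega>)"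
      using A by (subst emeasure_distr[OF measurable_sites[OF vs(2)]]) (auto intro!: sets_PiM_I_finite simp: pre)
    also have "\<dots> = emeasure iid_unif BT * emeasure (unifs n) B\<omega>"
      by (rule unifs.emeasure_pair_measure_Times[OF BTs B\<omega>s])
    also have "emeasure iid_unif BT = (\<Prod>k\<in>K. emeasure unif01 (A' (Inl k)))"
      unfolding BT_def iid_unif_def using K A'_sets by (intro emeasure_PiM_emb prob_space_unif01) auto
    also have "emeasure (unifs n) B\<omega> = (\<Prod>l<n. emeasure unif2 (A' (Inr (l, False)) \<times> A' (Inr (l, True))))"
      unfolding B\<omega>_def using Bs by (intro P2.emeasure_PiM) auto
    also have "\<dots> = (\<Prod>l<n. \<Prod>b\<in>UNIV. emeasure unif01 (A' (Inr (l, b))))"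
      using A'_sets by (intro prod.cong refl) (simp add: unif01.emeasure_pair_measure_Times UNIV_bool mult.commute)
    also have "\<dots> = (\<Prod>q\<in>{..<n} \<times> UNIV. emeasure unif01 (A' (Inr q)))"
      by (simp add: prod.cartesian_product)
    also have "(\<Prod>k\<in>K. emeasure unif01 (A' (Inl k))) * (\<Prod>q\<in>{..<n} \<times> UNIV. emeasure unif01 (A' (Inr q)))
        = (\<Prod>v\<in>Inl ` K. emeasure unif01 (A' v)) * (\<Prod>v\<in>Inr ` ({..<n} \<times> UNIV). emeasure unif01 (A' v))"
      by (simp add: prod.reindex)
    also have "\<dots> = (\<Prod>v\<in>Inl ` K \<union> Inr ` ({..<n} \<times> UNIV). emeasure unif01 (A' v))"
      using K by (intro prod.union_disjoint[symmetric]) auto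
    also have "\<dots> = (\<Prod>v\<in>set vs. emeasure unif01 (A' v))"
    proof (rule prod.mono_neutral_right)
      have "v \<in> Inl ` K \<union> Inr ` ({..<n} \<times> UNIV)" if "v \<in> set vs" for v
        using that vs(2) by (cases v rule: sum.exhaust) (auto simp: K_def)
      then show "set vs \<subseteq> Inl ` K \<union> Inr ` ({..<n} \<times> UNIV)" by blast
      show "\<forall>v\<in>Inl ` K \<union> Inr ` ({..<n} \<times> UNIV) - set vs. emeasure unif01 (A' v) = 1"
        using A'_out unif01.emeasure_space_1 by simp
    qed (use K in auto)
    also have "\<dots> = (\<Prod>i<?m. emeasure unif01 (A' (vs ! i)))"
      by (rule prod.reindex_bij_betw[symmetric, OF bij_betw_nth[OF vs(1) refl refl]])
    also have "\<dots> = (\<Prod>i<?m. emeasure unif01 (A i))"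
      by (intro prod.cong) (auto simp: A'_nth)
    finally show "emeasure (distr ?N (\<Pi>\<^sub>M i\<in>{..<?m}. unif01) ?X) (Pi\<^sub>E {..<?m} A) = (\<Prod>i<?m. emeasure unif01 (A i))" .
  qed simp_all
qed

text \<open>When coordinate \<open>i\<close> is integrated with the others fixed, a tie with
  coordinate \<open>j\<close> means hitting a single point.\<close>

lemma AE_PiM_unif01_inj_on: "AE X in (\<Pi>\<^sub>M i\<in>{..<m::nat}. unif01). inj_on X {..<m}"
proof -
  interpret unif01: prob_space unif01 by (rule prob_space_unif01)
  interpret P: product_sigma_finite "\<lambda>_::nat. unif01" by unfold_locales
  let ?P = "\<Pi>\<^sub>M i\<in>{..<m}. unif01"
  have ne: "AE X in ?P. X i \<noteq> X j" if ij: "i < m" "j < m" "i \<noteq> j" for i j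
  proof -
    let ?I = "{..<m} - {i}"
    have I: "{..<m} = insert i ?I" using ij by auto
    have cm: "(\<lambda>X. X k) \<in> borel_measurable ?P" if "k < m" for k
      using measurable_component_singleton[of k "{..<m}" "\<lambda>_. unif01"] that
        measurable_cong_sets[OF refl sets_unif01] by auto
    have S: "{X \<in> space ?P. X i = X j} \<in> sets ?P"
      using ij by (intro borel_measurable_eq cm) auto
    have "emeasure ?P {X \<in> space ?P. X i = X j} = (\<integral>\<^sup>+X. indicator {X \<in> space ?P. X i = X j} X \<partial>?P)"
      using S by simp
    also have "\<dots> = (\<integral>\<^sup>+X. \<integral>\<^sup>+y. indicator {X \<in> space ?P. X i = X j} (X(i := y)) \<partial>unif01 \<partial>(\<Pi>\<^sub>M k\<in>?I. unif01))"
      using P.product_nn_integral_insert[of ?I i "indicator {X \<in> space ?P. X i = X j}"] S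
      unfolding I[symmetric] by simp
    also have "\<dots> \<le> (\<integral>\<^sup>+X. \<integral>\<^sup>+y. indicator {X j} y \<partial>unif01 \<partial>(\<Pi>\<^sub>M k\<in>?I. unif01))"
      using ij by (intro nn_integral_mono) (auto split: split_indicator)
    also have "\<dots> = 0"
    proof -
      have "emeasure unif01 {x} = 0" for x
      proof -
        have "emeasure lborel ({0..1} \<inter> {x}) = 0" by (cases "x \<in> {0..1}") auto
        then show ?thesis by (subst emeasure_uniform_measure) auto
      qed
      then show ?thesis by simp
    qed
    finally have "emeasure ?P {X \<in> space ?P. X i = X j} = 0" by simp
    then show ?thesis using S by (intro AE_I[where N = "{X \<in> space ?P. X i = X j}"]) auto
  qed
  have "AE X in ?P. \<forall>i\<in>{..<m}. \<forall>j\<in>{..<m}. i \<noteq> j \<longrightarrow> X i \<noteq> X j"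
    by (intro AE_finite_allI AE_impI) (auto simp: ne)
  then show ?thesis by eventually_elim (auto simp: inj_on_def)
qed

context grapheur
begin

abbreviation base_space :: "nat \<Rightarrow> ((nat \<Rightarrow> real) \<times> (nat \<Rightarrow> real \<times> real)) measure" where
  "base_space n \<equiv> iid_unif \<Otimes>\<^sub>M unifs n"

lemma prob_space_base: "prob_space (base_space n)"
  by (intro prob_space_pair prob_space_iid_unif prob_space_unifs)

text \<open>Distinct sites almost surely receive distinct positions, so \<open>site\<close> is an
  injective relabelling of the formal edges.\<close>

lemma AE_pattern_law_sample:
  "AE p in base_space n. pattern_law n (sample n (fst p) (snd p) c) = pattern_law n (site_edges c)"
proof -
  let ?vs = "vertex_list n (site_edges c)"
  have "AE p in base_space n. inj_on (\<lambda>i\<in>{..<length ?vs}. site (fst p) (snd p) (?vs ! i)) {..<length ?vs}"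
  proof (rule AE_distrD[OF measurable_sites[OF Inr_in_vertex_list]])
    show "AE X in distr (base_space n) (\<Pi>\<^sub>M i\<in>{..<length ?vs}. unif01)
        (\<lambda>p. \<lambda>i\<in>{..<length ?vs}. site (fst p) (snd p) (?vs ! i)). inj_on X {..<length ?vs}"
      by (subst distr_sites[OF distinct_vertex_list Inr_in_vertex_list])
         (assumption, rule AE_PiM_unif01_inj_on)
  qed
  then show ?thesis
  proof eventually_elim
    case (elim p)
    show ?case
    proof (rule pattern_law_relabel[OF _ sample_eq_site])
      show "inj_on (site (fst p) (snd p)) (set ?vs)"
      proof (rule inj_onI)
        fix v w assume "v \<in> set ?vs" "w \<in> set ?vs" and eq: "site (fst p) (snd p) v = site (fst p) (snd p) w"
        then obtain i j where "i < length ?vs" "v = ?vs ! i" "j < length ?vs" "w = ?vs ! j"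
          by (metis in_set_conv_nth)
        then show "v = w" using inj_onD[OF elim, of i j] eq by simp
      qed
    qed
  qed
qed

text \<open>The first marginal of the coupling depends on the atoms alone, and these keep their
  uniform law for fixed labels. The second is the step grapheur because the empirical measure is
  \<open>graph_real\<close> at the positions of the listed sites, which \<open>distr_sites\<close>
  identifies as independent and uniform.\<close>

lemma W_box_bar_pattern_law_le:
  assumes n: "n \<ge> 1" and c: "c \<in> space (labels n)"
  shows "W_box_bar (grapheur_law E \<sigma> \<tau> \<theta> \<kappa>) (pattern_law n (site_edges c))
           \<le> (\<integral>\<^sup>+p. ennreal (discrepancy rat_rect (\<mu> (fst p)) n (sample n (fst p) (snd p) c)) \<partial>base_space n)"
proof -
  interpret N: prob_space "base_space n" by (rule prob_space_base)
  interpret unifs: prob_space "unifs n" by (rule prob_space_unifs)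
  let ?N = "base_space n" and ?K = "prob_algebra (borel :: (real \<times> real) measure)"
  let ?vs = "vertex_list n (site_edges c)"
  let ?m = "length ?vs" and ?G = "edge_weight n (site_edges c)"
  let ?emp = "\<lambda>p. empirical n (sample n (fst p) (snd p) c)"
  let ?C = "distr ?N (?K \<Otimes>\<^sub>M ?K) (\<lambda>p. (\<mu> (fst p), ?emp p))"
  have mu [measurable]: "(\<lambda>p. \<mu> (fst p)) \<in> ?N \<rightarrow>\<^sub>M ?K"
    by (rule measurable_compose[OF measurable_fst measurable_mu])
  have "(\<lambda>p. sample n (fst p) (snd p) c) \<in> ?N \<rightarrow>\<^sub>M sample_space n"
    using c by (intro measurable_sample) auto
  from measurable_compose[OF this measurable_empirical[OF n]]
  have emp [measurable]: "?emp \<in> ?N \<rightarrow>\<^sub>M ?K" .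
  have "distr ?C ?K fst = distr ?N ?K (\<lambda>p. \<mu> (fst p))"
    by (subst distr_distr) (auto simp: comp_def)
  also have "\<dots> = distr (distr ?N iid_unif fst) ?K \<mu>"
    by (subst distr_distr) (auto simp: comp_def measurable_mu)
  also have "distr ?N iid_unif fst = iid_unif"
    by (rule unifs.distr_pair_fst)
  finally have fst: "distr ?C ?K fst = grapheur_law E \<sigma> \<tau> \<theta> \<kappa>"
    by (simp add: grapheur_law_def)
  let ?Um = "\<Pi>\<^sub>M i\<in>{..<?m}. unif01"
  let ?X = "\<lambda>p. \<lambda>i\<in>{..<?m}. site (fst p) (snd p) (?vs ! i)"
  have Xm: "?X \<in> ?N \<rightarrow>\<^sub>M ?Um" by (rule measurable_sites[OF Inr_in_vertex_list])
  have X: "graph_real ?m ?G (?X p) = ?emp p" for p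
  proof -
    have "graph_real ?m ?G (?X p) = empirical n (\<lambda>l. map_prod (site (fst p) (snd p)) (site (fst p) (snd p)) (site_edges c l))"
      by (rule graph_real_edge_weight[OF n]) simp
    also have "\<dots> = ?emp p" by (rule empirical_cong) (simp add: sample_eq_site)
    finally show ?thesis .
  qed
  have "\<exists>i<?m. ?vs ! i = v" if "v \<in> set ?vs" for v using that by (metis in_set_conv_nth)
  then obtain idx where idx: "\<And>v. v \<in> set ?vs \<Longrightarrow> idx v < ?m \<and> ?vs ! idx v = v" by metis
  have cv: "fst (site_edges c l) \<in> set ?vs" "snd (site_edges c l) \<in> set ?vs" if "l < n" for l
    using that by (auto simp: set_vertex_list)
  \<comment> \<open>Written as an empirical measure of points that depend measurably on
    \<open>T\<close>, \<open>graph_real\<close> is a measurable map into the space of probability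
    measures.\<close>
  have graph: "graph_real ?m ?G T = empirical n (\<lambda>l\<in>{..<n}. map_prod (T \<circ> idx) (T \<circ> idx) (site_edges c l))" for T
  proof -
    have "graph_real ?m ?G T = empirical n (\<lambda>l. map_prod (T \<circ> idx) (T \<circ> idx) (site_edges c l))"
    proof (rule graph_real_edge_weight[OF n])
      fix i assume i: "i < ?m"
      then have "?vs ! idx (?vs ! i) = ?vs ! i" "idx (?vs ! i) < ?m" using idx by auto
      then have "idx (?vs ! i) = i" using i distinct_vertex_list nth_eq_iff_index_eq by blast
      then show "T i = (T \<circ> idx) (?vs ! i)" by simp
    qed
    then show ?thesis by (subst empirical_cong[where z' = "\<lambda>l. map_prod (T \<circ> idx) (T \<circ> idx) (site_edges c l)"]) auto
  qed
  \<comment> \<open>Stated for a general index set because it serves both for the finite product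
    \<open>?Um\<close> and for the infinite sequence in \<open>iid_unif\<close>.\<close>
  have gm: "graph_real ?m ?G \<in> (\<Pi>\<^sub>M i\<in>I. unif01) \<rightarrow>\<^sub>M ?K" if "{..<?m} \<subseteq> I" for I
  proof -
    have comp: "(\<lambda>T. T (idx v)) \<in> borel_measurable (\<Pi>\<^sub>M i\<in>I. unif01)" if "v \<in> set ?vs" for v
      using measurable_component_singleton[of "idx v" I "\<lambda>_. unif01"] idx[OF that] \<open>{..<?m} \<subseteq> I\<close>
        measurable_cong_sets[OF refl sets_unif01] by (auto simp: subset_iff)
    have "(\<lambda>T. \<lambda>l\<in>{..<n}. map_prod (T \<circ> idx) (T \<circ> idx) (site_edges c l)) \<in> (\<Pi>\<^sub>M i\<in>I. unif01) \<rightarrow>\<^sub>M sample_space n"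
    proof (rule measurable_restrict)
      fix l assume "l \<in> {..<n}"
      then have "(\<lambda>T. (T (idx (fst (site_edges c l))), T (idx (snd (site_edges c l))))) \<in> (\<Pi>\<^sub>M i\<in>I. unif01) \<rightarrow>\<^sub>M borel \<Otimes>\<^sub>M borel"
        by (intro measurable_Pair comp cv) auto
      then show "(\<lambda>T. map_prod (T \<circ> idx) (T \<circ> idx) (site_edges c l)) \<in> borel_measurable (\<Pi>\<^sub>M i\<in>I. unif01)"
        unfolding borel_prod by (simp add: map_prod_def case_prod_beta')
    qed
    from measurable_compose[OF this measurable_empirical[OF n]] show ?thesis
      unfolding graph[abs_def, symmetric] by (simp add: graph)
  qed
  have "distr ?C ?K snd = distr ?N ?K (\<lambda>p. graph_real ?m ?G (?X p))"
    by (subst distr_distr) (auto simp: comp_def X)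
  also have "\<dots> = distr (distr ?N ?Um ?X) ?K (graph_real ?m ?G)"
    by (subst distr_distr) (auto simp: comp_def gm Xm)
  also have "distr ?N ?Um ?X = ?Um" by (rule distr_sites[OF distinct_vertex_list Inr_in_vertex_list])
  also have "?Um = distr iid_unif ?Um (\<lambda>T. \<lambda>i\<in>{..<?m}. T i)"
    unfolding iid_unif_def
    using distr_PiM_reindex[of UNIV "\<lambda>_::nat. unif01" "\<lambda>i. i" "{..<?m}"] prob_space_unif01 by simp
  also have "distr (distr iid_unif ?Um (\<lambda>T. \<lambda>i\<in>{..<?m}. T i)) ?K (graph_real ?m ?G)
      = distr iid_unif ?K (\<lambda>T. graph_real ?m ?G (\<lambda>i\<in>{..<?m}. T i))"
    by (subst distr_distr) (auto simp: comp_def gm iid_unif_def intro!: measurable_restrict)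
  also have "\<dots> = distr iid_unif ?K (graph_real ?m ?G)"
  proof (intro arg_cong[where f = "distr iid_unif ?K"] ext)
    show "graph_real ?m ?G (\<lambda>i\<in>{..<?m}. T i) = graph_real ?m ?G T" for T
      unfolding graph by (intro empirical_cong) (use idx cv in \<open>auto simp: prod_eq_iff\<close>)
  qed
  finally have snd: "distr ?C ?K snd = pattern_law n (site_edges c)"
    by (simp add: pattern_law_def graph_law_def)
  have C: "?C \<in> couplings ?K (grapheur_law E \<sigma> \<tau> \<theta> \<kappa>) (pattern_law n (site_edges c))"
    unfolding couplings_def using fst snd by (auto intro!: N.prob_space_distr)
  have "W_box_bar (grapheur_law E \<sigma> \<tau> \<theta> \<kappa>) (pattern_law n (site_edges c))
      \<le> (\<integral>\<^sup>+x. (SUP S \<in> unit_intervals. SUP T \<in> unit_intervals. cut_diff S T x) \<partial>?C)"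
    unfolding W_box_bar_def by (rule INF_lower[OF C])
  \<comment> \<open>Measurability of this uncountable supremum is not established, so the transfer
    to the base space is an inequality, which has the required direction.\<close>
  also have "\<dots> \<le> (\<integral>\<^sup>+p. (SUP S \<in> unit_intervals. SUP T \<in> unit_intervals. cut_diff S T (\<mu> (fst p), ?emp p)) \<partial>?N)"
    by (rule nn_integral_distr_le) measurable
  also have "\<dots> \<le> (\<integral>\<^sup>+p. ennreal (discrepancy rat_rect (\<mu> (fst p)) n (sample n (fst p) (snd p) c)) \<partial>?N)"
  proof (intro nn_integral_mono SUP_least)
    fix p S T assume "S \<in> unit_intervals" "T \<in> unit_intervals"
    then have "\<bar>measure (\<mu> (fst p)) (S \<times> T) - measure (?emp p) (S \<times> T)\<bar>
        \<le> discrepancy rat_rect (\<mu> (fst p)) n (sample n (fst p) (snd p) c)"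
      using discrepancy_upper[OF prob_space_mu]
      by (intro interval_rect_diff_le prob_space_mu sets_mu prob_space_empirical n sets_empirical)
         (auto simp: unit_intervals_def measure_empirical rat_rect_in_sets)
    then show "cut_diff S T (\<mu> (fst p), ?emp p)
        \<le> ennreal (discrepancy rat_rect (\<mu> (fst p)) n (sample n (fst p) (snd p) c))"
      by (simp add: cut_diff_def ennreal_leI)
  qed
  finally show ?thesis .
qed

end

section \<open>Expectation and tail bounds for the sampled graph\<close>

lemma W_box_le_W_box_bar: "W_box P Q \<le> W_box_bar P Q"
  unfolding W_box_def W_box_bar_def
proof (rule INF_mono, rule bexI, intro SUP_least)
  fix C S T assume "S \<in> unit_intervals" "T \<in> unit_intervals"
  then show "(\<integral>\<^sup>+x. cut_diff S T x \<partial>C)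
      \<le> (\<integral>\<^sup>+x. (SUP S \<in> unit_intervals. SUP T \<in> unit_intervals. cut_diff S T x) \<partial>C)"
    by (intro nn_integral_mono SUP_upper2[where i = S] SUP_upper2[where i = T]) auto
qed

context grapheur
begin

lemma prob_space_edge_sample: "prob_space (edge_sample E \<sigma> \<tau> \<theta> \<kappa> n)"
proof
  have PiM: "emeasure (\<Pi>\<^sub>M l\<in>{..<n}. \<mu> T) (space (\<Pi>\<^sub>M l\<in>{..<n}. \<mu> T)) = 1" for T
    by (intro prob_space.emeasure_space_1 prob_space_PiM prob_space_mu)
  have "(\<integral>\<^sup>+z. 1 \<partial>edge_sample E \<sigma> \<tau> \<theta> \<kappa> n) = 1"
    using PiM prob_space.emeasure_space_1[OF prob_space_iid_unif] by (subst nn_integral_edge_sample) auto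
  then show "emeasure (edge_sample E \<sigma> \<tau> \<theta> \<kappa> n) (space (edge_sample E \<sigma> \<tau> \<theta> \<kappa> n)) = 1" by simp
qed

lemma measurable_discrepancy_mu:
  "(\<lambda>p. discrepancy rat_rect (\<mu> (fst p)) n (snd p)) \<in> borel_measurable (iid_unif \<Otimes>\<^sub>M sample_space n)"
proof -
  have [measurable]: "(\<lambda>p. measure (\<mu> (fst p)) (rat_rect r)) \<in> borel_measurable (iid_unif \<Otimes>\<^sub>M sample_space n)" for r
    by (rule measurable_compose[OF measurable_compose[OF measurable_fst measurable_mu]
          measurable_measure_prob_algebra[OF rat_rect_in_sets]])
  note rat_rect_in_sets[measurable]
  have "(\<lambda>p. SUP r. \<bar>measure (\<mu> (fst p)) (rat_rect r) - (\<Sum>l<n. indicator (rat_rect r) (snd p l)) / n\<bar>)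
      \<in> borel_measurable (iid_unif \<Otimes>\<^sub>M sample_space n)"
    by (intro borel_measurable_cSUP bdd_above_discrepancy prob_space_mu) (auto simp: countableI_type)
  then show ?thesis by (simp add: discrepancy_def)
qed

context
  fixes n :: nat
  assumes n: "n \<ge> 1"
begin

abbreviation (input) disc :: "(nat \<Rightarrow> nat \<times> nat) \<Rightarrow> (nat \<Rightarrow> real) \<times> (nat \<Rightarrow> real \<times> real) \<Rightarrow> real" where
  "disc c p \<equiv> discrepancy rat_rect (\<mu> (fst p)) n (sample n (fst p) (snd p) c)"

abbreviation (input) W :: "(nat \<Rightarrow> real \<times> real) \<Rightarrow> ennreal" where
  "W z \<equiv> W_box_bar (grapheur_law E \<sigma> \<tau> \<theta> \<kappa>) (pattern_law n z)"

lemma measurable_disc: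
  assumes "c \<in> space (labels n)"
  shows "disc c \<in> borel_measurable (base_space n)"
proof -
  have "(\<lambda>p. (fst p, sample n (fst p) (snd p) c)) \<in> base_space n \<rightarrow>\<^sub>M iid_unif \<Otimes>\<^sub>M sample_space n"
    using assms by (intro measurable_Pair measurable_sample) auto
  from measurable_compose[OF this measurable_discrepancy_mu] show ?thesis by simp
qed

lemma disc_bounds: "0 \<le> disc c p" "disc c p \<le> 1" "\<bar>disc c p\<bar> \<le> 1"
  using discrepancy_bounds[OF prob_space_mu, where R = rat_rect] by auto

lemma integrable_disc: "c \<in> space (labels n) \<Longrightarrow> integrable (base_space n) (disc c)"
  using disc_bounds(3)
  by (intro finite_measure.integrable_const_bound[OF _ _ measurable_disc, where B = 1]
        prob_space.finite_measure prob_space_base AE_I2) auto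

lemma measurable_W: "W \<in> borel_measurable (sample_space n)"
  by (rule borel_measurableI_le) (rule sets_pattern_law)

text \<open>For fixed labels the distance is almost surely constant in the positions, and that
  constant is at most the mean discrepancy given the labels.\<close>

lemma AE_W_le:
  assumes "c \<in> space (labels n)"
  shows "AE p in base_space n. W (sample n (fst p) (snd p) c) \<le> (\<integral>\<^sup>+q. ennreal (disc c q) \<partial>base_space n)"
  using AE_pattern_law_sample[of n c]
  by eventually_elim (use W_box_bar_pattern_law_le[OF n assms] in simp)

text \<open>Both orders of integration are used: labels outermost for the coupling, then atoms
  outermost again, where the points are independent with law \<open>\<mu> T\<close> and the
  discrepancy bound applies.\<close>

lemma nn_integral_W_le:
  "(\<integral>\<^sup>+z. W z \<partial>edge_sample E \<sigma> \<tau> \<theta> \<kappa> n) \<le> ennreal (152 / sqrt n)"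
proof -
  interpret N: prob_space "base_space n" by (rule prob_space_base)
  interpret iid: prob_space iid_unif by (rule prob_space_iid_unif)
  have "(\<integral>\<^sup>+z. W z \<partial>edge_sample E \<sigma> \<tau> \<theta> \<kappa> n) = (\<integral>\<^sup>+T. \<integral>\<^sup>+z. W z \<partial>(\<Pi>\<^sub>M l\<in>{..<n}. \<mu> T) \<partial>iid_unif)"
    by (rule nn_integral_edge_sample[OF measurable_W])
  also have "\<dots> = (\<integral>\<^sup>+c. \<integral>\<^sup>+p. W (sample n (fst p) (snd p) c) \<partial>base_space n \<partial>labels n)"
    using nn_integral_sample_Fubini[OF measurable_compose[OF measurable_snd measurable_W]]
    by (simp add: case_prod_beta')
  also have "\<dots> \<le> (\<integral>\<^sup>+c. \<integral>\<^sup>+p. (\<integral>\<^sup>+q. ennreal (disc c q) \<partial>base_space n) \<partial>base_space n \<partial>labels n)"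
    by (intro nn_integral_mono nn_integral_mono_AE AE_W_le)
  also have "\<dots> = (\<integral>\<^sup>+c. \<integral>\<^sup>+q. ennreal (disc c q) \<partial>base_space n \<partial>labels n)"
    by (simp add: N.emeasure_space_1)
  also have "\<dots> = (\<integral>\<^sup>+T. \<integral>\<^sup>+z. ennreal (discrepancy rat_rect (\<mu> T) n z) \<partial>(\<Pi>\<^sub>M l\<in>{..<n}. \<mu> T) \<partial>iid_unif)"
    using nn_integral_sample_Fubini[OF measurable_compose[OF measurable_discrepancy_mu measurable_ennreal], of n]
    by (simp add: case_prod_beta')
  also have "\<dots> \<le> (\<integral>\<^sup>+T. ennreal (152 / sqrt n) \<partial>iid_unif)"
    by (intro nn_integral_mono nn_integral_discrepancy_rat_rect_le prob_space_mu sets_mu n)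
  also have "\<dots> = ennreal (152 / sqrt n)" by (simp add: iid.emeasure_space_1)
  finally show ?thesis .
qed

text \<open>A Chernoff bound for the conditional mean \<open>h\<close> of the discrepancy given the
  labels, which dominates \<open>W\<close> almost surely. Jensen's inequality replaces
  \<open>exp (s * h)\<close> by the conditional mean of \<open>exp (s * disc c p)\<close>, which can
  be integrated with the atoms outermost.\<close>

lemma emeasure_W_gt_le:
  assumes s: "s > 0" and r: "r \<ge> 0"
  shows "(\<integral>\<^sup>+z. indicator {z. ennreal r < W z} z \<partial>edge_sample E \<sigma> \<tau> \<theta> \<kappa> n)
           \<le> ennreal (exp (- s * r + s * (152 / sqrt n) + s\<^sup>2 / (8 * n)))"
proof -
  interpret N: prob_space "base_space n" by (rule prob_space_base)
  interpret iid: prob_space iid_unif by (rule prob_space_iid_unif)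
  let ?I = "\<lambda>z. indicator {z. ennreal r < W z} z :: ennreal"
  have Im: "?I \<in> borel_measurable (sample_space n)"
    using measurable_W by (intro borel_measurable_indicator') auto
  have dm: "(\<lambda>p. ennreal (exp (s * discrepancy rat_rect (\<mu> (fst p)) n (snd p)))) \<in> borel_measurable (iid_unif \<Otimes>\<^sub>M sample_space n)"
    using measurable_discrepancy_mu by measurable
  have pt: "(\<integral>\<^sup>+p. ?I (sample n (fst p) (snd p) c) \<partial>base_space n)
      \<le> ennreal (exp (- s * r)) * (\<integral>\<^sup>+p. ennreal (exp (s * disc c p)) \<partial>base_space n)"
    if c: "c \<in> space (labels n)" for c
  proof -
    define h where "h = (\<integral>p. disc c p \<partial>base_space n)"
    have h: "(\<integral>\<^sup>+q. ennreal (disc c q) \<partial>base_space n) = ennreal h"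
      unfolding h_def using disc_bounds(1) by (intro nn_integral_eq_integral integrable_disc c AE_I2)
    \<comment> \<open>Given the labels \<open>h\<close> is a number: if \<open>h \<le> r\<close>,
      the event is null; otherwise \<open>exp (s * (h - r))\<close> is at least 1 and bounds the
      indicator.\<close>
    show ?thesis
    proof (cases "h \<le> r")
      case True
      have "AE p in base_space n. ?I (sample n (fst p) (snd p) c) = 0"
        using AE_W_le[OF c] unfolding h
      proof eventually_elim
        case (elim p)
        then show ?case using ennreal_leI[OF True] by (auto simp: indicator_def not_less)
      qed
      then have "(\<integral>\<^sup>+p. ?I (sample n (fst p) (snd p) c) \<partial>base_space n) = (\<integral>\<^sup>+p. 0 \<partial>base_space n)"
        by (rule nn_integral_cong_AE)
      then show ?thesis by simp
    next
      case False
      have int: "integrable (base_space n) (\<lambda>p. exp (s * disc c p))"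
      proof (rule N.integrable_const_bound[where B = "exp s"])
        show "AE p in base_space n. norm (exp (s * disc c p)) \<le> exp s"
          using disc_bounds(2) s by (intro AE_I2) (auto intro: mult_left_le)
      qed (use measurable_disc[OF c] in measurable)
      \<comment> \<open>Jensen's inequality via the tangent line of \<open>exp\<close> at
        \<open>s * h\<close>, whose linear term integrates to 0.\<close>
      have "exp (s * h) = (\<integral>p. exp (s * h) * (1 + s * (disc c p - h)) \<partial>base_space n)"
        using integrable_disc[OF c] by (simp add: h_def N.prob_space)
      also have "\<dots> \<le> (\<integral>p. exp (s * disc c p) \<partial>base_space n)"
      proof (rule integral_mono[OF _ int])
        show "integrable (base_space n) (\<lambda>p. exp (s * h) * (1 + s * (disc c p - h)))"
          using integrable_disc[OF c] by simp
        fix p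
        have "exp (s * h) * (1 + s * (disc c p - h)) \<le> exp (s * h) * exp (s * (disc c p - h))"
          by (intro mult_left_mono exp_ge_add_one_self) auto
        then show "exp (s * h) * (1 + s * (disc c p - h)) \<le> exp (s * disc c p)"
          by (simp add: exp_add[symmetric] algebra_simps)
      qed
      finally have jensen: "exp (s * h) \<le> (\<integral>p. exp (s * disc c p) \<partial>base_space n)" .
      have "(\<integral>\<^sup>+p. ?I (sample n (fst p) (snd p) c) \<partial>base_space n) \<le> (\<integral>\<^sup>+p. 1 \<partial>base_space n)"
        by (intro nn_integral_mono) (auto split: split_indicator)
      also have "\<dots> = ennreal 1" by (simp add: N.emeasure_space_1)
      also have "\<dots> \<le> ennreal (exp (- s * r) * exp (s * h))"
        using False s by (intro ennreal_leI) (simp add: exp_add[symmetric] mult_left_mono)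
      also have "\<dots> \<le> ennreal (exp (- s * r)) * ennreal (\<integral>p. exp (s * disc c p) \<partial>base_space n)"
        unfolding ennreal_mult'[symmetric, OF exp_ge_zero] using jensen by (intro ennreal_leI mult_left_mono) auto
      also have "ennreal (\<integral>p. exp (s * disc c p) \<partial>base_space n) = (\<integral>\<^sup>+p. ennreal (exp (s * disc c p)) \<partial>base_space n)"
        by (intro nn_integral_eq_integral[symmetric] int) auto
      finally show ?thesis .
    qed
  qed
  have "(\<integral>\<^sup>+z. ?I z \<partial>edge_sample E \<sigma> \<tau> \<theta> \<kappa> n) = (\<integral>\<^sup>+T. \<integral>\<^sup>+z. ?I z \<partial>(\<Pi>\<^sub>M l\<in>{..<n}. \<mu> T) \<partial>iid_unif)"
    by (rule nn_integral_edge_sample[OF Im])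
  also have "\<dots> = (\<integral>\<^sup>+c. \<integral>\<^sup>+p. ?I (sample n (fst p) (snd p) c) \<partial>base_space n \<partial>labels n)"
    using nn_integral_sample_Fubini[OF measurable_compose[OF measurable_snd Im]]
    by (simp add: case_prod_beta')
  also have "\<dots> \<le> (\<integral>\<^sup>+c. ennreal (exp (- s * r)) * (\<integral>\<^sup>+p. ennreal (exp (s * disc c p)) \<partial>base_space n) \<partial>labels n)"
    by (intro nn_integral_mono pt)
  also have "\<dots> = ennreal (exp (- s * r)) * (\<integral>\<^sup>+c. \<integral>\<^sup>+p. ennreal (exp (s * disc c p)) \<partial>base_space n \<partial>labels n)"
  proof (rule nn_integral_cmult)
    have "(\<lambda>x. (fst (snd x), sample n (fst (snd x)) (snd (snd x)) (fst x)))
        \<in> labels n \<Otimes>\<^sub>M base_space n \<rightarrow>\<^sub>M iid_unif \<Otimes>\<^sub>M sample_space n"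
      by (intro measurable_Pair measurable_sample) measurable
    from measurable_compose[OF this dm]
    have "(\<lambda>x. ennreal (exp (s * disc (fst x) (snd x)))) \<in> borel_measurable (labels n \<Otimes>\<^sub>M base_space n)"
      by simp
    then have "(\<lambda>(c, p). ennreal (exp (s * disc c p))) \<in> borel_measurable (labels n \<Otimes>\<^sub>M base_space n)"
      by (simp add: case_prod_beta')
    then show "(\<lambda>c. \<integral>\<^sup>+p. ennreal (exp (s * disc c p)) \<partial>base_space n) \<in> borel_measurable (labels n)"
      by (rule N.borel_measurable_nn_integral)
  qed
  also have "(\<integral>\<^sup>+c. \<integral>\<^sup>+p. ennreal (exp (s * disc c p)) \<partial>base_space n \<partial>labels n)
      = (\<integral>\<^sup>+T. \<integral>\<^sup>+z. ennreal (exp (s * discrepancy rat_rect (\<mu> T) n z)) \<partial>(\<Pi>\<^sub>M l\<in>{..<n}. \<mu> T) \<partial>iid_unif)"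
    using nn_integral_sample_Fubini[OF dm] by (simp add: case_prod_beta')
  also have "\<dots> \<le> (\<integral>\<^sup>+T. ennreal (exp (s * (152 / sqrt n) + s\<^sup>2 / (8 * n))) \<partial>iid_unif)"
    by (intro nn_integral_mono nn_integral_exp_discrepancy_rat_rect_le prob_space_mu sets_mu n s)
  also have "\<dots> = ennreal (exp (s * (152 / sqrt n) + s\<^sup>2 / (8 * n)))" by (simp add: iid.emeasure_space_1)
  also have "ennreal (exp (- s * r)) * \<dots> = ennreal (exp (- s * r + s * (152 / sqrt n) + s\<^sup>2 / (8 * n)))"
    by (simp add: ennreal_mult'[symmetric] exp_add[symmetric] add.assoc)
  finally show ?thesis by (simp add: mult_left_mono)
qed

lemma emeasure_W_le:
  assumes \<epsilon>: "\<epsilon> > 0"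
  shows "ennreal (1 - exp (- 2 * \<epsilon>\<^sup>2)) \<le> emeasure (edge_sample E \<sigma> \<tau> \<theta> \<kappa> n)
           {z \<in> space (edge_sample E \<sigma> \<tau> \<theta> \<kappa> n). W z \<le> ennreal ((174 + \<epsilon>) / sqrt n)}"
proof -
  let ?P = "edge_sample E \<sigma> \<tau> \<theta> \<kappa> n"
  interpret P: prob_space ?P by (rule prob_space_edge_sample)
  \<comment> \<open>This \<open>s\<close> minimises
    \<open>- s * \<epsilon> / sqrt n + s^2 / (8 * n)\<close>, with minimum
    \<open>- 2 * \<epsilon>^2\<close>. The gap between 174 and 152 adds
    \<open>- 88 * \<epsilon>\<close> to the exponent, which only helps.\<close>
  define r s where "r = (174 + \<epsilon>) / sqrt n" and "s = 4 * \<epsilon> * sqrt n"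
  have n0: "real n > 0" using n by simp
  have rs: "r \<ge> 0" "s > 0" using n0 \<epsilon> by (auto simp: r_def s_def)
  have sr: "s * r = 4 * \<epsilon> * (174 + \<epsilon>)" "s * (152 / sqrt n) = 4 * \<epsilon> * 152" "s\<^sup>2 / (8 * n) = 2 * \<epsilon>\<^sup>2"
    using n0 by (auto simp: r_def s_def power_mult_distrib)
  have expo: "- s * r + s * (152 / sqrt n) + s\<^sup>2 / (8 * n) \<le> - 2 * \<epsilon>\<^sup>2"
    unfolding minus_mult_left[symmetric] sr using \<epsilon> by (simp add: algebra_simps power2_eq_square)
  have sp: "space ?P = space (sample_space n)" by (rule sets_eq_imp_space_eq[OF sets_edge_sample])
  have A: "{z \<in> space ?P. W z \<le> ennreal r} \<in> sets ?P"
    unfolding sp sets_edge_sample by (rule sets_pattern_law)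
  have B: "{z \<in> space ?P. ennreal r < W z} \<in> sets ?P"
    unfolding sp sets_edge_sample by (rule sets_pattern_law)
  have "emeasure ?P {z \<in> space ?P. ennreal r < W z} = (\<integral>\<^sup>+z. indicator {z. ennreal r < W z} z \<partial>?P)"
    unfolding nn_integral_indicator[OF B, symmetric] by (intro nn_integral_cong) (auto split: split_indicator)
  also have "\<dots> \<le> ennreal (exp (- s * r + s * (152 / sqrt n) + s\<^sup>2 / (8 * n)))"
    by (rule emeasure_W_gt_le[OF rs(2,1)])
  also have "\<dots> \<le> ennreal (exp (- 2 * \<epsilon>\<^sup>2))" using expo by (intro ennreal_leI) simp
  finally have "P.prob {z \<in> space ?P. ennreal r < W z} \<le> exp (- 2 * \<epsilon>\<^sup>2)"
    by (simp add: P.emeasure_eq_measure)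
  moreover have "P.prob {z \<in> space ?P. W z \<le> ennreal r} = 1 - P.prob {z \<in> space ?P. ennreal r < W z}"
    using P.prob_neg[of "\<lambda>z. ennreal r < W z"] B by (simp add: not_less)
  ultimately show ?thesis unfolding r_def[symmetric] by (simp add: P.emeasure_eq_measure ennreal_leI)
qed

end

end

theorem mainTheorem12:
  fixes E :: "nat \<Rightarrow> nat \<Rightarrow> real" and \<sigma> \<tau> :: "nat \<Rightarrow> real" and \<theta> \<kappa> :: real and n :: nat
  assumes coeffs: "grapheur_coeffs E \<sigma> \<tau> \<theta> \<kappa>"
    and n: "n \<ge> 1"
  defines "M \<equiv> grapheur_law E \<sigma> \<tau> \<theta> \<kappa>"
    and "P \<equiv> edge_sample E \<sigma> \<tau> \<theta> \<kappa> n"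
  shows "(\<integral>\<^sup>+ z. W_box M (sampled_graph_law n z) \<partial>P)
           \<le> (\<integral>\<^sup>+ z. W_box_bar M (sampled_graph_law n z) \<partial>P)
         \<and> (\<integral>\<^sup>+ z. W_box_bar M (sampled_graph_law n z) \<partial>P) \<le> ennreal (174 / sqrt (real n))
         \<and> (\<forall>\<epsilon>>0. \<exists>A\<in>sets P.
              A \<subseteq> {z \<in> space P. W_box M (sampled_graph_law n z) \<le> W_box_bar M (sampled_graph_law n z)
                         \<and> W_box_bar M (sampled_graph_law n z) \<le> ennreal ((174 + \<epsilon>) / sqrt (real n))}
              \<and> emeasure P A \<ge> ennreal (1 - exp (- 2 * \<epsilon>\<^sup>2)))"
proof (intro conjI allI impI)
  interpret grapheur E \<sigma> \<tau> \<theta> \<kappa> by unfold_locales (rule coeffs)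
  show "(\<integral>\<^sup>+ z. W_box M (sampled_graph_law n z) \<partial>P) \<le> (\<integral>\<^sup>+ z. W_box_bar M (sampled_graph_law n z) \<partial>P)"
    by (intro nn_integral_mono W_box_le_W_box_bar)
  have "(\<integral>\<^sup>+ z. W_box_bar M (sampled_graph_law n z) \<partial>P) \<le> ennreal (152 / sqrt (real n))"
    unfolding sampled_graph_law_eq M_def P_def by (rule nn_integral_W_le[OF n])
  also have "\<dots> \<le> ennreal (174 / sqrt (real n))" by (intro ennreal_leI divide_right_mono) auto
  finally show "(\<integral>\<^sup>+ z. W_box_bar M (sampled_graph_law n z) \<partial>P) \<le> ennreal (174 / sqrt (real n))" .
  fix \<epsilon> :: real assume \<epsilon>: "\<epsilon> > 0"
  \<comment> \<open>The comparison of the two distances holds for every sample, so the upper bound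
    alone determines the event.\<close>
  let ?A = "{z \<in> space P. W_box_bar M (pattern_law n z) \<le> ennreal ((174 + \<epsilon>) / sqrt (real n))}"
  show "\<exists>A\<in>sets P. A \<subseteq> {z \<in> space P. W_box M (sampled_graph_law n z) \<le> W_box_bar M (sampled_graph_law n z)
                         \<and> W_box_bar M (sampled_graph_law n z) \<le> ennreal ((174 + \<epsilon>) / sqrt (real n))}
              \<and> emeasure P A \<ge> ennreal (1 - exp (- 2 * \<epsilon>\<^sup>2))"
  proof (intro bexI[of _ ?A] conjI)
    show "?A \<in> sets P"
      unfolding P_def sets_eq_imp_space_eq[OF sets_edge_sample] sets_edge_sample by (rule sets_pattern_law)
    show "ennreal (1 - exp (- 2 * \<epsilon>\<^sup>2)) \<le> emeasure P ?A"
      unfolding M_def P_def by (rule emeasure_W_le[OF n \<epsilon>])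
  qed (auto simp: W_box_le_W_box_bar sampled_graph_law_eq)
qed

end
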